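(* Fix a spin $s\in\{\tfrac12,1,\tfrac32,\dots\}$ and exponents $0\le c\le b<1$. For each $N$, let $J=sN$, let $M_{\min}<M_{\max}$ be magnetic quantum numbers with $M_{\max}-M_{\min}\sim N^{b}$ and $|M_{\min}|,|M_{\max}|=O(N^b)$, let $d=d(N)\sim N^{c}$, and consider the code space $$\mathfrak{C}=\mathrm{span}\{|J,M\rangle:\ M=M_{\min},\,M_{\min}+\Delta,\,M_{\min}+2\Delta,\dots,M_{\max}\}.$$ If $\Delta\ge 2sd+1$, then $\mathfrak{C}$ is a $(\!(N,k)\!)$ approximate quantum error-correcting code with $k=O((b-c)\log_2N)$ (read as $O(1)$ if $b=c$) whose inaccuracy against heralded erasures of at most $d$ qudits satisfies $$\epsilon(\mathcal N)=O\!\left(N^{-(1-b-c/2)}\right).$$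
   Context: System: $N$ spin-$s$ degrees of freedom (qudits of dimension $2s+1$) with local spin operators $\hat q_j^z,\hat q_j^\pm$ satisfying $[\hat q_j^+,\hat q_j^-]=2\hat q_j^z$, $[\hat q_j^z,\hat q_j^\pm]=\pm\hat q_j^\pm$ (spin-$s$ irreducible representation on each site), and total operators $\hat Q^z=\sum_j\hat q_j^z$, $\hat Q^\pm=\sum_j\hat q_j^\pm$. For $J=sN$ (the maximal total spin, multiplicity one, totally permutation-symmetric), $\{|J,M\rangle\}_{M=-J}^{J}$ is the orthonormal basis of the spin-$J$ irrep with $\hat Q^z|J,M\rangle=M|J,M\rangle$, $\hat Q^\pm|J,M\rangle=\sqrt{(J\mp M)(J\pm M+1)}\,|J,M\pm1\rangle$. Heralded erasure noise: $\mathcal N(\rho)=\sum_\alpha p_\alpha|\alpha\rangle\langle\alpha|_C\otimes\mathrm{Tr}_\alpha(\rho)$, where $\alpha$ ranges over sets of at most $d$ qudits, $(p_\alpha)$ is an arbitrary probability distribution, $C$ is a classical register recording which qudits are lost, and $\mathrm{Tr}_\alpha$ is the partial trace over the qudits in $\alpha$ (in particular a single known set $\alpha$ is allowed). $X\sim Y$ means $X=\Theta(Y)$ as $N\to\infty$; implied constants in $O(\cdot)$ may depend on $s,b,c$ and the constants in the assumed scalings, but not on the $\alpha$ or $p_\alpha$. A code with code space $\mathfrak C$ of dimension $2^k$ is denoted $(\!(N,k)\!)$; $k=\log_2\big(\tfrac{M_{\max}-M_{\min}}{\Delta}+1\big)$ is its number of logical qubits (not necessarily an integer). Let $V$ be an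 isometry from a $2^k$-dimensional logical space $L$ onto $\mathfrak C$. The code inaccuracy against a noise channel $\mathcal N$ is $\epsilon(\mathcal N)=\min_{\mathcal R}D_P\big(\mathcal R\circ\mathcal N\circ\mathcal V,\mathrm{id}_L\big)$, where $\mathcal V(\cdot)=V(\cdot)V^\dagger$, the minimum is over quantum channels $\mathcal R$ to $L$, and the purified distance of channels $\mathcal E,\mathcal F$ on $L$ is $D_P(\mathcal E,\mathcal F)=\max_{|\psi\rangle}\sqrt{1-f^2\big[(\mathcal E\otimes\mathrm{id})(|\psi\rangle\langle\psi|),(\mathcal F\otimes\mathrm{id})(|\psi\rangle\langle\psi|)\big]}$, with $|\psi\rangle$ ranging over unit vectors of $L\otimes L$ and $f(\rho,\sigma)=\mathrm{Tr}\sqrt{\sqrt\rho\,\sigma\sqrt\rho}$. *)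

theory Defs
  imports Complex_Main "HOL-Library.FuncSet" "HOL-Library.Function_Algebras"
    "HOL-Library.Nonpos_Ints"
begin

section \<open>Finite-dimensional operators with labelled bases\<close>

text \<open>
  A Hilbert space with an orthonormal basis labelled by a finite set \<open>I\<close> is represented by the
  functions \<open>'i \<Rightarrow> complex\<close> vanishing outside \<open>I\<close>; an operator is given by its matrix elements
  (row label first), vanishing outside the relevant label sets.  Tensor products are labelled by
  pairs.  This lets the dimension depend on the number of sites.
\<close>

type_synonym ('a, 'b) cmat = "'a \<Rightarrow> 'b \<Rightarrow> complex"

interpretation cfun: vector_space "\<lambda>(a::complex) (v::'i \<Rightarrow> complex) i. a * v i"
  by unfold_locales (auto simp: fun_eq_iff algebra_simps)

definition vecs :: "'i set \<Rightarrow> ('i \<Rightarrow> complex) set" where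
  "vecs I = {v. \<forall>i. v i \<noteq> 0 \<longrightarrow> i \<in> I}"

definition mats :: "'i set \<Rightarrow> 'j set \<Rightarrow> ('i, 'j) cmat set" where
  "mats I J = {A. \<forall>i j. A i j \<noteq> 0 \<longrightarrow> i \<in> I \<and> j \<in> J}"

definition vinner :: "'i set \<Rightarrow> ('i \<Rightarrow> complex) \<Rightarrow> ('i \<Rightarrow> complex) \<Rightarrow> complex" where
  "vinner I v w = (\<Sum>i\<in>I. cnj (v i) * w i)"

definition unit_vecs :: "'i set \<Rightarrow> ('i \<Rightarrow> complex) set" where
  "unit_vecs I = {v \<in> vecs I. vinner I v v = 1}"

definition mapply :: "'j set \<Rightarrow> ('i, 'j) cmat \<Rightarrow> ('j \<Rightarrow> complex) \<Rightarrow> 'i \<Rightarrow> complex" where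
  "mapply J A v = (\<lambda>i. \<Sum>j\<in>J. A i j * v j)"

definition mmul :: "'j set \<Rightarrow> ('i, 'j) cmat \<Rightarrow> ('j, 'k) cmat \<Rightarrow> ('i, 'k) cmat" where
  "mmul J A B = (\<lambda>i k. \<Sum>j\<in>J. A i j * B j k)"

definition mone :: "'i set \<Rightarrow> ('i, 'i) cmat" where
  "mone I = (\<lambda>i j. if i \<in> I \<and> i = j then 1 else 0)"

definition madj :: "('i, 'j) cmat \<Rightarrow> ('j, 'i) cmat" where
  "madj A = (\<lambda>j i. cnj (A i j))"

definition mtrace :: "'i set \<Rightarrow> ('i, 'i) cmat \<Rightarrow> complex" where
  "mtrace I A = (\<Sum>i\<in>I. A i i)"

definition outer :: "('i \<Rightarrow> complex) \<Rightarrow> ('i, 'i) cmat" where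
  "outer v = (\<lambda>i j. v i * cnj (v j))"

text \<open>Over the complex numbers, nonnegativity of all quadratic forms includes hermiticity.\<close>

definition psd :: "'i set \<Rightarrow> ('i, 'i) cmat set" where
  "psd I = {A \<in> mats I I. \<forall>v\<in>vecs I. vinner I v (mapply I A v) \<in> \<real>\<^sub>\<ge>\<^sub>0}"

text \<open>The unique positive semidefinite square root (meaningful for \<open>A \<in> psd I\<close>).\<close>

definition msqrt :: "'i set \<Rightarrow> ('i, 'i) cmat \<Rightarrow> ('i, 'i) cmat" where
  "msqrt I A = (THE B. B \<in> psd I \<and> mmul I B B = A)"

definition fidelity :: "'i set \<Rightarrow> ('i, 'i) cmat \<Rightarrow> ('i, 'i) cmat \<Rightarrow> real" where
  "fidelity I \<rho> \<sigma> =
     Re (mtrace I (msqrt I (mmul I (mmul I (msqrt I \<rho>) \<sigma>) (msqrt I \<rho>))))"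


section \<open>Quantum channels and the purified distance\<close>

type_synonym ('a, 'b) superop = "('a, 'a) cmat \<Rightarrow> ('b, 'b) cmat"

text \<open>\<open>ampliate \<Phi>\<close> is the map \<open>\<Phi> \<otimes> id\<close>, applied blockwise in the second tensor factor.\<close>

definition ampliate :: "('a, 'b) superop \<Rightarrow> ('a \<times> 'r, 'b \<times> 'r) superop" where
  "ampliate \<Phi> X = (\<lambda>(b, r) (b', r'). \<Phi> (\<lambda>a a'. X (a, r) (a', r')) b b')"

definition completely_positive :: "'a set \<Rightarrow> 'b set \<Rightarrow> ('a, 'b) superop \<Rightarrow> bool" where
  "completely_positive I K \<Phi> \<longleftrightarrow>
     (\<forall>n::nat. \<forall>X \<in> psd (I \<times> {..<n}). ampliate \<Phi> X \<in> psd (K \<times> {..<n}))"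

definition channel :: "'a set \<Rightarrow> 'b set \<Rightarrow> ('a, 'b) superop \<Rightarrow> bool" where
  "channel I K \<Phi> \<longleftrightarrow>
     (\<forall>X\<in>mats I I. \<Phi> X \<in> mats K K) \<and>
     (\<forall>X\<in>mats I I. \<forall>Y\<in>mats I I. \<Phi> (\<lambda>i j. X i j + Y i j) = (\<lambda>i j. \<Phi> X i j + \<Phi> Y i j)) \<and>
     (\<forall>a. \<forall>X\<in>mats I I. \<Phi> (\<lambda>i j. a * X i j) = (\<lambda>i j. a * \<Phi> X i j)) \<and>
     completely_positive I K \<Phi> \<and>
     (\<forall>X\<in>mats I I. mtrace K (\<Phi> X) = mtrace I X)"

definition purified_dist :: "'l set \<Rightarrow> ('l, 'l) superop \<Rightarrow> ('l, 'l) superop \<Rightarrow> real" where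
  "purified_dist L \<E> \<F> =
     (SUP \<psi>\<in>unit_vecs (L \<times> L).
        sqrt (1 - (fidelity (L \<times> L) (ampliate \<E> (outer \<psi>)) (ampliate \<F> (outer \<psi>)))\<^sup>2))"

definition isometry_onto ::
  "'l set \<Rightarrow> 'i set \<Rightarrow> ('i \<Rightarrow> complex) set \<Rightarrow> ('i, 'l) cmat \<Rightarrow> bool" where
  "isometry_onto L I S V \<longleftrightarrow>
     V \<in> mats I L \<and> mmul I (madj V) V = mone L \<and> mapply L V ` vecs L = S"

definition encoding :: "'l set \<Rightarrow> ('i, 'l) cmat \<Rightarrow> ('l, 'i) superop" where
  "encoding L V X = mmul L (mmul L V X) (madj V)"

text \<open>
  The code inaccuracy for a noise channel with output space \<open>K\<close>.  The infimum over recovery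
  channels is attained: the channels form a compact set and the distance is continuous.
\<close>

definition inaccuracy ::
  "'l set \<Rightarrow> 'k set \<Rightarrow> ('i, 'l) cmat \<Rightarrow> ('i, 'k) superop \<Rightarrow> real" where
  "inaccuracy L K V \<N> =
     (INF \<R>\<in>{\<R>. channel K L \<R>}. purified_dist L (\<R> \<circ> \<N> \<circ> encoding L V) id)"


section \<open>Spin systems\<close>

text \<open>\<open>{- j, - j + 1, \<dots>, j}\<close> for a spin \<open>j\<close> with \<open>2 j\<close> a natural number.\<close>

definition mags :: "real \<Rightarrow> real set" where
  "mags j = {m. j - m \<in> \<nat> \<and> j + m \<in> \<nat>}"

text \<open>
  The spin-\<open>s\<close> irreducible representation in its standard weight basis, labelled by \<open>mags s\<close>.
\<close>

definition spin_z :: "(real, real) cmat" where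
  "spin_z = (\<lambda>m' m. if m' = m then complex_of_real m else 0)"

definition spin_plus :: "real \<Rightarrow> (real, real) cmat" where
  "spin_plus s =
     (\<lambda>m' m. if m' = m + 1 then complex_of_real (sqrt ((s - m) * (s + m + 1))) else 0)"

definition spin_minus :: "real \<Rightarrow> (real, real) cmat" where
  "spin_minus s =
     (\<lambda>m' m. if m' = m - 1 then complex_of_real (sqrt ((s + m) * (s - m + 1))) else 0)"

text \<open>Product basis of the spins located at the sites in \<open>A\<close>.\<close>

definition configs :: "real \<Rightarrow> nat set \<Rightarrow> (nat \<Rightarrow> real) set" where
  "configs s A = A \<rightarrow>\<^sub>E mags s"

definition site_op ::
  "real \<Rightarrow> nat \<Rightarrow> nat \<Rightarrow> (real, real) cmat \<Rightarrow> (nat \<Rightarrow> real, nat \<Rightarrow> real) cmat" where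
  "site_op s N j q =
     (\<lambda>x y. if x \<in> configs s {..<N} \<and> y \<in> configs s {..<N} \<and> (\<forall>i. i \<noteq> j \<longrightarrow> x i = y i)
            then q (x j) (y j) else 0)"

definition total_op ::
  "real \<Rightarrow> nat \<Rightarrow> (real, real) cmat \<Rightarrow> (nat \<Rightarrow> real, nat \<Rightarrow> real) cmat" where
  "total_op s N q = (\<lambda>x y. \<Sum>j<N. site_op s N j q x y)"

text \<open>
  \<open>ket M\<close> is the state \<open>|J,M\<rangle>\<close> of the multiplet of maximal total spin \<open>J = s N\<close>; the conditions
  determine the family up to a common phase.  At \<open>M = \<plusminus> J\<close> the square root vanishes, so the
  value of \<open>ket\<close> outside \<open>mags J\<close> is irrelevant.
\<close>

definition max_spin_basis :: "real \<Rightarrow> nat \<Rightarrow> (real \<Rightarrow> (nat \<Rightarrow> real) \<Rightarrow> complex) \<Rightarrow> bool" where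
  "max_spin_basis s N ket \<longleftrightarrow>
     (let J = s * real N; I = configs s {..<N} in
      (\<forall>M\<in>mags J. ket M \<in> vecs I) \<and>
      (\<forall>M\<in>mags J. \<forall>M'\<in>mags J. vinner I (ket M) (ket M') = (if M = M' then 1 else 0)) \<and>
      (\<forall>M\<in>mags J.
         mapply I (total_op s N spin_z) (ket M) = (\<lambda>x. complex_of_real M * ket M x) \<and>
         mapply I (total_op s N (spin_plus s)) (ket M) =
           (\<lambda>x. complex_of_real (sqrt ((J - M) * (J + M + 1))) * ket (M + 1) x) \<and>
         mapply I (total_op s N (spin_minus s)) (ket M) =
           (\<lambda>x. complex_of_real (sqrt ((J + M) * (J - M + 1))) * ket (M - 1) x)))"

definition code_space ::
  "(real \<Rightarrow> (nat \<Rightarrow> real) \<Rightarrow> complex) \<Rightarrow> real \<Rightarrow> real \<Rightarrow> nat \<Rightarrow> ((nat \<Rightarrow> real) \<Rightarrow> complex) set" where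
  "code_space ket Mmin Mmax \<Delta> =
     cfun.span {ket (Mmin + real i * real \<Delta>) | i::nat. Mmin + real i * real \<Delta> \<le> Mmax}"

definition logical_qubits :: "real \<Rightarrow> real \<Rightarrow> nat \<Rightarrow> real" where
  "logical_qubits Mmin Mmax \<Delta> = log 2 ((Mmax - Mmin) / real \<Delta> + 1)"


section \<open>Heralded erasure noise\<close>

definition erasure_sets :: "nat \<Rightarrow> nat \<Rightarrow> nat set set" where
  "erasure_sets N d = {\<alpha>. \<alpha> \<subseteq> {..<N} \<and> card \<alpha> \<le> d}"

definition erasure_distribution :: "nat \<Rightarrow> nat \<Rightarrow> (nat set \<Rightarrow> real) \<Rightarrow> bool" where
  "erasure_distribution N d p \<longleftrightarrow>
     (\<forall>\<alpha>\<in>erasure_sets N d. 0 \<le> p \<alpha>) \<and> (\<Sum>\<alpha>\<in>erasure_sets N d. p \<alpha>) = 1"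

text \<open>\<open>partial_trace s \<alpha> \<rho>\<close> traces out the spins at the sites in \<open>\<alpha>\<close>.\<close>

definition partial_trace ::
  "real \<Rightarrow> nat set \<Rightarrow> (nat \<Rightarrow> real, nat \<Rightarrow> real) superop" where
  "partial_trace s \<alpha> \<rho> =
     (\<lambda>y y'. \<Sum>z\<in>configs s \<alpha>. \<rho> (override_on y z \<alpha>) (override_on y' z \<alpha>))"

text \<open>
  The output space is the orthogonal sum over \<open>\<alpha>\<close> of \<open>|\<alpha>\<rangle>\<close> tensored with the space of the
  remaining spins, whose dimension depends on \<open>\<alpha>\<close>.
\<close>

definition erasure_output :: "real \<Rightarrow> nat \<Rightarrow> nat \<Rightarrow> (nat set \<times> (nat \<Rightarrow> real)) set" where
  "erasure_output s N d = (SIGMA \<alpha>:erasure_sets N d. configs s ({..<N} - \<alpha>))"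

definition erasure_noise ::
  "real \<Rightarrow> nat \<Rightarrow> nat \<Rightarrow> (nat set \<Rightarrow> real) \<Rightarrow> (nat \<Rightarrow> real, nat set \<times> (nat \<Rightarrow> real)) superop" where
  "erasure_noise s N d p \<rho> =
     (\<lambda>(\<alpha>, y) (\<alpha>', y').
        if \<alpha> = \<alpha>' \<and> (\<alpha>, y) \<in> erasure_output s N d \<and> (\<alpha>', y') \<in> erasure_output s N d
        then complex_of_real (p \<alpha>) * partial_trace s \<alpha> \<rho> y y' else 0)"

end

theory Submission
  imports Defs "HOL-Computational_Algebra.Formal_Power_Series"
begin

text \<open>
  Lowering from the top of the multiplet shows that \<open>|J,M\<rangle>\<close> is, up to a common phase, the Dicke state
  whose squared amplitude at a configuration with occupation numbers \<open>k\<^sub>j = s + m\<^sub>j\<close> is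
  \<open>(\<Prod>j. C(2s, k\<^sub>j)) / C(2sN, J + M)\<close>.  Erasing a known set of sites splits it into Dicke states: if the
  environment holds occupation \<open>k\<close>, the remaining sites are in the Dicke state of occupation
  \<open>J + M - k\<close>, with hypergeometric probability.  Because \<open>\<Delta> > 2 s d\<close>, the number \<open>J + M - k\<close> determines
  both \<open>M\<close> and \<open>k\<close>, so one recovery channel can restore \<open>M\<close> and discard \<open>k\<close>.  What is left is a
  dephasing by the Bhattacharyya coefficients of the hypergeometric laws belonging to different \<open>M\<close>.
  Drawing the \<open>a \<le> 2 s d\<close> erased units one by one, each draw costs at most the squared difference of
  two success probabilities that are \<open>O(N powr (b - 1))\<close> apart; the infidelity is therefore
  \<open>O(N powr (c + 2 b - 2))\<close>.
\<close>

section \<open>Matrices and the positive square root\<close>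

text \<open>What has to be bounded is a fidelity for an arbitrary input entangled with a reference,
  while the code dimension may grow with N. Two facts keep the bound free of that dimension.
  Fidelity with a pure state is a quadratic form, and the part of it that is kept depends on the
  input only through the probabilities \<open>q j\<close> of the codewords: it is the sum over
  losses \<alpha> and environment outcomes z of \<open>p \<alpha>\<close> times the square of a
  \<open>q\<close>-average of amplitudes. Expanding the square gives a \<open>q\<close>-weighted
  average of affinities over pairs of codewords, so one lower bound for all pairs settles every
  input.

  The quarter margins come from comparing affinity with squared distance: the square root is
  1-Lipschitz on numbers at least 1/4, and both the occupied and the empty fraction must stay in
  that range during all draws. Magnetizations and losses are o(N), since b < 1 and c < 1, so the
  fraction stays near 1/2.

  The fidelity is stated with a square root given by a definite description; its existence and
  uniqueness are settled first, by a power series instead of diagonalization.\<close>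

lemma vecs_eq_0: "v \<in> vecs I \<Longrightarrow> i \<notin> I \<Longrightarrow> v i = 0"
  by (auto simp: vecs_def)

lemma mats_eq_0: "A \<in> mats I J \<Longrightarrow> i \<notin> I \<or> j \<notin> J \<Longrightarrow> A i j = 0"
  by (auto simp: mats_def)

lemma vinner_self: "vinner I v v = of_real (\<Sum>i\<in>I. (cmod (v i))\<^sup>2)"
  by (simp add: vinner_def complex_norm_square[symmetric] mult.commute)

lemma vinner_self_nonneg: "vinner I v v \<in> \<real>\<^sub>\<ge>\<^sub>0"
  by (simp only: vinner_self nonneg_Reals_of_real_iff) (simp add: sum_nonneg)

lemma vinner_cnj: "cnj (vinner I v w) = vinner I w v"
  by (simp add: vinner_def mult.commute)

lemma vinner_self_0:
  assumes "finite I" "v \<in> vecs I" "vinner I v v = 0" shows "v = (\<lambda>_. 0)"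
proof
  fix i
  have "(\<Sum>i\<in>I. (cmod (v i))\<^sup>2) = 0" using assms(3) by (simp only: vinner_self of_real_eq_0_iff)
  then have "\<forall>i\<in>I. (cmod (v i))\<^sup>2 = 0" using assms(1) by (subst (asm) sum_nonneg_eq_0_iff) auto
  then show "v i = 0" using vecs_eq_0[OF assms(2)] by (cases "i \<in> I") auto
qed

lemma vinner_form:
  "vinner I u (mapply J A w) = (\<Sum>i\<in>I. \<Sum>j\<in>J. cnj (u i) * A i j * w j)"
  by (simp add: vinner_def mapply_def sum_distrib_left mult.assoc)

lemma mapply_mmul: "mapply J (mmul I A B) v = mapply I A (mapply J B v)"
  unfolding mapply_def mmul_def
  by (rule ext, simp add: sum_distrib_left sum_distrib_right mult.assoc, rule sum.swap)

lemma vinner_mapply_adj: "vinner I u (mapply J A w) = vinner J (mapply I (madj A) u) w"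
  unfolding vinner_def mapply_def madj_def
  by (simp add: sum_distrib_left sum_distrib_right, subst sum.swap, simp add: algebra_simps)

lemma mmul_assoc: "mmul J (mmul I A B) C = mmul I A (mmul J B C)"
  unfolding mmul_def
  by (intro ext, simp add: sum_distrib_left sum_distrib_right mult.assoc, rule sum.swap)

lemma mapply_vecs: "A \<in> mats I J \<Longrightarrow> mapply J A v \<in> vecs I"
  by (auto simp: vecs_def mapply_def mats_def intro: ccontr elim!: sum.not_neutral_contains_not_neutral)

lemma mmul_mats: "A \<in> mats I J \<Longrightarrow> B \<in> mats J K \<Longrightarrow> mmul J A B \<in> mats I K"
  by (auto simp: mmul_def mats_def elim!: sum.not_neutral_contains_not_neutral)

lemma psd_mats: "A \<in> psd I \<Longrightarrow> A \<in> mats I I" by (simp add: psd_def)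

lemma psd_form: "A \<in> psd I \<Longrightarrow> v \<in> vecs I \<Longrightarrow> vinner I v (mapply I A v) \<in> \<real>\<^sub>\<ge>\<^sub>0"
  by (simp add: psd_def)

text \<open>Polarization: a form that is real on all vectors supported on \<open>i\<close> and
  \<open>j\<close> forces the two off-diagonal entries to be conjugate.\<close>

lemma psd_hermitian:
  assumes I: "finite I" and A: "A \<in> psd I"
  shows "cnj (A i j) = A j i"
proof (cases "i \<in> I \<and> j \<in> I")
  case False
  then show ?thesis using mats_eq_0[OF psd_mats[OF A]] by auto
next
  case True
  then have ij: "i \<in> I" "j \<in> I" by auto
  have form: "Im (cnj a * A i i * a + cnj a * A i j * b + cnj b * A j i * a + cnj b * A j j * b) = 0" for a b
  proof -
    let ?e = "\<lambda>i a k. if k = i then (a::complex) else 0"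
    let ?v = "\<lambda>k. ?e i a k + ?e j b k"
    have "?v \<in> vecs I" using ij by (auto simp: vecs_def split: if_splits)
    then have "Im (vinner I ?v (mapply I A ?v)) = 0"
      using psd_form[OF A] by (simp add: complex_nonneg_Reals_iff)
    moreover have B: "(\<Sum>k\<in>I. \<Sum>l\<in>I. cnj (?e i' a' k) * A k l * ?e j' b' l) = cnj a' * A i' j' * b'"
      if "i' \<in> I" "j' \<in> I" for i' j' a' b'
      using that I by (simp add: if_distrib[of cnj] if_distrib[of "\<lambda>x. x * _"] if_distrib[of "\<lambda>x. _ * x"] cong: if_cong)
    have "vinner I ?v (mapply I A ?v) =
        (\<Sum>k\<in>I. \<Sum>l\<in>I. cnj (?e i a k) * A k l * ?e i a l) + (\<Sum>k\<in>I. \<Sum>l\<in>I. cnj (?e i a k) * A k l * ?e j b l)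
      + (\<Sum>k\<in>I. \<Sum>l\<in>I. cnj (?e j b k) * A k l * ?e i a l) + (\<Sum>k\<in>I. \<Sum>l\<in>I. cnj (?e j b k) * A k l * ?e j b l)"
      unfolding vinner_form sum.distrib[symmetric] by (intro sum.cong refl) (simp add: algebra_simps)
    then have "vinner I ?v (mapply I A ?v) =
        cnj a * A i i * a + cnj a * A i j * b + cnj b * A j i * a + cnj b * A j j * b"
      using ij by (simp only: B)
    ultimately show ?thesis by simp
  qed
  \<comment> \<open>The first two choices make the diagonal real; (1, 1) makes the imaginary parts
    of \<open>A i j\<close> and \<open>A j i\<close> opposite, and (1, i) with the imaginary unit
    makes their real parts equal.\<close>
  from form[of 1 0] form[of 0 1] form[of 1 1] form[of 1 \<i>]
  show ?thesis by (simp add: complex_eq_iff)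
qed

lemma psd_madj: "finite I \<Longrightarrow> A \<in> psd I \<Longrightarrow> madj A = A"
  by (simp add: madj_def psd_hermitian fun_eq_iff)

lemma psd_self_adj:
  "finite I \<Longrightarrow> A \<in> psd I \<Longrightarrow> vinner I u (mapply I A w) = vinner I (mapply I A u) w"
  by (simp add: vinner_mapply_adj psd_madj)

text \<open>
  The Taylor coefficients of \<open>sqrt (1 - x)\<close>.  Only the zeroth is positive and the partial sums stay
  nonnegative, which makes the series converge, to a positive operator, at every \<open>0 \<le> X \<le> 1\<close>.
\<close>

definition sqrt_coeff :: "nat \<Rightarrow> real" where
  "sqrt_coeff n = ((1/2) gchoose n) * (-1) ^ n"

text \<open>The alternating sum along the row of 1/2 collapses to the single term
  \<open>(-1) ^ m * ((-1/2) gchoose m)\<close>, whose successive ratios (m + 1/2) / (m + 1) are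
  positive.\<close>

lemma sqrt_coeff_partial_sum: "(\<Sum>k\<le>m. sqrt_coeff k) \<ge> 0"
proof -
  have *: "(- 1) ^ m * ((-1/2::real) gchoose m) \<ge> 0" for m
  proof (induction m)
    case (Suc m)
    have "real (Suc m) * ((-1/2::real) gchoose Suc m) = (- 1/2 - real m) * ((-1/2) gchoose m)"
      using gbinomial_absorption[of m "-1/2::real"] gbinomial_absorb_comp[of "-1/2::real" m] by simp
    then have "((-1/2::real) gchoose Suc m) = (- 1/2 - real m) / real (Suc m) * ((-1/2) gchoose m)"
      by (simp add: nonzero_eq_divide_eq mult.commute)
    then have "(- 1) ^ Suc m * ((-1/2::real) gchoose Suc m)
        = (1/2 + real m) / real (Suc m) * ((- 1) ^ m * ((-1/2::real) gchoose m))"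
      by (simp only: power_Suc) (simp add: divide_simps, simp add: algebra_simps)
    also have "\<dots> \<ge> 0" using Suc by (intro mult_nonneg_nonneg[of "_ / _"]) (auto simp del: zero_le_mult_iff)
    finally show ?case .
  qed simp
  show ?thesis unfolding sqrt_coeff_def gbinomial_sum_lower_neg using *[of m] by simp
qed

lemma sqrt_coeff_0: "sqrt_coeff 0 = 1" by (simp add: sqrt_coeff_def)

lemma sqrt_coeff_nonpos: "sqrt_coeff (Suc n) \<le> 0"
proof (induction n)
  case 0 then show ?case by (simp add: sqrt_coeff_def)
next
  case (Suc n)
  have "real (Suc (Suc n)) * ((1/2::real) gchoose Suc (Suc n)) = (1/2 - real (Suc n)) * ((1/2) gchoose Suc n)"
    using gbinomial_absorption[of "Suc n" "1/2::real"] gbinomial_absorb_comp[of "1/2::real" "Suc n"] by simp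
  then have "((1/2::real) gchoose Suc (Suc n)) = (1/2 - real (Suc n)) / real (Suc (Suc n)) * ((1/2) gchoose Suc n)"
    by (simp add: nonzero_eq_divide_eq mult.commute)
  then have "sqrt_coeff (Suc (Suc n)) = (1/2 + real n) / real (Suc (Suc n)) * sqrt_coeff (Suc n)"
    by (simp only: sqrt_coeff_def power_Suc) (simp add: divide_simps, simp add: algebra_simps)
  also have "\<dots> \<le> 0" using Suc by (intro mult_nonneg_nonpos) auto
  finally show ?case .
qed

text \<open>With only one positive coefficient, equal to 1, the sum of absolute values is 2 minus
  the signed partial sum, hence at most 2. Convergence at the boundary point 1 matters because the
  operators to be inserted may have norm 1.\<close>

lemma sqrt_coeff_abs_summable: "summable (\<lambda>n. \<bar>sqrt_coeff n\<bar>)"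
proof (rule summableI_nonneg_bounded[of _ 2])
  fix n show "(\<Sum>i<n. \<bar>sqrt_coeff i\<bar>) \<le> 2"
  proof (cases n)
    case (Suc m)
    have "(\<Sum>i<Suc m. \<bar>sqrt_coeff i\<bar>) = 2 - (\<Sum>k\<le>m. sqrt_coeff k)"
      unfolding lessThan_Suc_atMost[symmetric] sum.lessThan_Suc_shift
      by (simp add: sqrt_coeff_0 sqrt_coeff_nonpos sum_negf)
    then show ?thesis using sqrt_coeff_partial_sum[of m] Suc by simp
  qed simp
qed auto

text \<open>Vandermonde for 1/2 + 1/2 = 1: the square of the series is the polynomial 1 - x.\<close>

lemma sqrt_coeff_convolution:
  "(\<Sum>i\<le>k. sqrt_coeff i * sqrt_coeff (k - i)) = (if k = 0 then 1 else if k = 1 then -1 else 0)"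
proof -
  have "(\<Sum>i\<le>k. sqrt_coeff i * sqrt_coeff (k - i))
      = (-1)^k * (\<Sum>i\<in>{0..k}. ((1/2::real) gchoose i) * ((1/2) gchoose (k - i)))"
    unfolding sum_distrib_left sqrt_coeff_def atMost_atLeast0
    by (intro sum.cong refl) (simp add: power_add[symmetric] mult_ac)
  also have "\<dots> = (-1)^k * ((1::real) gchoose k)"
    by (subst gbinomial_Vandermonde) simp
  also have "(1::real) gchoose k = of_nat (1 choose k)"
    by (subst binomial_gbinomial) simp
  also have "(-1)^k * real (1 choose k) = (if k = 0 then 1 else if k = 1 then -1 else 0)"
    by (auto simp: binomial_eq_0_iff neq0_conv)
  finally show ?thesis .
qed

section \<open>Identity matrix, adjoints and powers\<close>

lemma mone_mats: "mone I \<in> mats I I" by (auto simp: mone_def mats_def)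

lemma mmul_mone_left: "finite I \<Longrightarrow> A \<in> mats I J \<Longrightarrow> mmul I (mone I) A = A"
  by (intro ext, rename_tac i j, case_tac "i \<in> I")
     (auto simp: mmul_def mone_def mats_eq_0 if_distrib[of "\<lambda>x. x * _"] cong: if_cong)

lemma mmul_mone_right: "finite J \<Longrightarrow> A \<in> mats I J \<Longrightarrow> mmul J A (mone J) = A"
  by (auto simp: mmul_def mone_def fun_eq_iff mats_eq_0 if_distrib[of "\<lambda>x. _ * x"] cong: if_cong conj_cong)

lemma mapply_mone: "finite I \<Longrightarrow> v \<in> vecs I \<Longrightarrow> mapply I (mone I) v = v"
  by (intro ext, rename_tac i, case_tac "i \<in> I")
     (auto simp: mapply_def mone_def vecs_eq_0 if_distrib[of "\<lambda>x. x * _"] cong: if_cong)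

lemma madj_mmul: "madj (mmul I A B) = mmul I (madj B) (madj A)"
  by (simp add: madj_def mmul_def mult.commute)

lemma madj_mone: "madj (mone I) = mone I"
  by (auto simp: madj_def mone_def fun_eq_iff)

definition mpow :: "'i set \<Rightarrow> ('i, 'i) cmat \<Rightarrow> nat \<Rightarrow> ('i, 'i) cmat" where
  "mpow I X n = (mmul I X ^^ n) (mone I)"

lemma mpow_0: "mpow I X 0 = mone I" and mpow_Suc: "mpow I X (Suc n) = mmul I X (mpow I X n)"
  by (simp_all add: mpow_def)

lemma mpow_mats: "X \<in> mats I I \<Longrightarrow> mpow I X n \<in> mats I I"
  by (induction n) (auto simp: mpow_0 mpow_Suc mone_mats mmul_mats)

lemma mpow_add:
  assumes "finite I" "X \<in> mats I I"
  shows "mmul I (mpow I X m) (mpow I X n) = mpow I X (m + n)"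
  by (induction m) (simp_all add: mpow_0 mpow_Suc mmul_mone_left[OF _ mpow_mats] assms mmul_assoc)

lemma mpow_1: "finite I \<Longrightarrow> X \<in> mats I I \<Longrightarrow> mpow I X 1 = X"
  by (simp add: mpow_0 mpow_Suc mmul_mone_right)

lemma mpow_madj:
  assumes "finite I" "X \<in> mats I I" "madj X = X"
  shows "madj (mpow I X n) = mpow I X n"
proof (induction n)
  case (Suc n)
  have "madj (mpow I X (Suc n)) = mmul I (mpow I X n) (mpow I X 1)"
    by (simp only: mpow_Suc madj_mmul Suc assms mpow_1)
  then show ?case using mpow_add[OF assms(1,2), of n 1] by simp
qed (simp add: mpow_0 madj_mone)

lemma vinner_diff_left: "vinner I (\<lambda>i. u i - v i) w = vinner I u w - vinner I v w"
  and vinner_diff_right: "vinner I w (\<lambda>i. u i - v i) = vinner I w u - vinner I w v"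
  by (simp_all add: vinner_def algebra_simps sum_subtractf)

lemma mapply_diff: "mapply I A (\<lambda>i. u i - v i) = (\<lambda>i. mapply I A u i - mapply I A v i)"
  by (simp add: mapply_def algebra_simps sum_subtractf)

lemma vecs_diff: "u \<in> vecs I \<Longrightarrow> v \<in> vecs I \<Longrightarrow> (\<lambda>i. u i - v i) \<in> vecs I"
  by (auto simp: vecs_def) (metis)

text \<open>The condition 0 \<le> X \<le> 1, stated through quadratic forms alone, so that the
  estimates below avoid eigenvalues.\<close>

locale psd_contraction =
  fixes I :: "'i set" and X :: "('i, 'i) cmat"
  assumes fin: "finite I" and psd: "X \<in> psd I"
    and le: "\<And>v. v \<in> vecs I \<Longrightarrow> Re (vinner I v (mapply I X v)) \<le> Re (vinner I v v)"
begin

text \<open>Positivity of X tested on v - Xv yields 2 |Xv|^2 \<le> <v, Xv> + <Xv, XXv>, and the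
  right side is at most |v|^2 + |Xv|^2 because X \<le> 1.\<close>

lemma norm_mapply_le:
  assumes v: "v \<in> vecs I"
  shows "Re (vinner I (mapply I X v) (mapply I X v)) \<le> Re (vinner I v v)"
proof -
  define y where "y = mapply I X v"
  let ?u = "\<lambda>i. v i - y i"
  have y: "y \<in> vecs I" unfolding y_def by (intro mapply_vecs psd_mats psd)
  then have u: "?u \<in> vecs I" by (intro vecs_diff v)
  have "vinner I v (mapply I X y) = vinner I y y"
    using psd_self_adj[OF fin psd, of v y] by (simp add: y_def)
  moreover have "Re (vinner I ?u (mapply I X ?u)) \<ge> 0"
    using psd_form[OF psd u] by (simp add: complex_nonneg_Reals_iff)
  ultimately have "Re (vinner I v y) - Re (vinner I y y) - Re (vinner I y y) + Re (vinner I y (mapply I X y)) \<ge> 0"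
    unfolding mapply_diff vinner_diff_left vinner_diff_right by (simp add: y_def)
  moreover have "Re (vinner I y (mapply I X y)) \<le> Re (vinner I y y)" by (rule le[OF y])
  moreover have "Re (vinner I v y) \<le> Re (vinner I v v)" unfolding y_def by (rule le[OF v])
  ultimately show ?thesis unfolding y_def by linarith
qed

lemma norm_mpow_le:
  assumes v: "v \<in> vecs I"
  shows "Re (vinner I (mapply I (mpow I X n) v) (mapply I (mpow I X n) v)) \<le> Re (vinner I v v)"
proof (induction n)
  case 0 then show ?case by (simp add: mpow_0 mapply_mone fin v)
next
  case (Suc n)
  have "mapply I (mpow I X n) v \<in> vecs I" by (intro mapply_vecs mpow_mats psd_mats psd)
  from norm_mapply_le[OF this] Suc show ?case by (simp add: mpow_Suc mapply_mmul)
qed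

text \<open>Moving half of the factors to the left turns an even power into a squared norm and an
  odd one into the form of X itself, taken at a lower power applied to v.\<close>

lemma form_mpow:
  assumes v: "v \<in> vecs I"
  shows "vinner I v (mapply I (mpow I X n) v) \<in> \<real>\<^sub>\<ge>\<^sub>0 \<and>
    Re (vinner I v (mapply I (mpow I X n) v)) \<le> Re (vinner I v v)"
proof -
  let ?w = "\<lambda>k. mapply I (mpow I X k) v"
  have X: "X \<in> mats I I" by (rule psd_mats[OF psd])
  have w: "?w k \<in> vecs I" for k by (intro mapply_vecs mpow_mats X)
  have *: "vinner I v (mapply I (mpow I X (k + l)) v) = vinner I (?w k) (?w l)" for k l
    unfolding mpow_add[OF fin X, symmetric] mapply_mmul
    by (subst vinner_mapply_adj) (simp only: mpow_madj[OF fin X psd_madj[OF fin psd]])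
  show ?thesis
  proof (cases "even n")
    case True
    then obtain k where "n = k + k" by (metis evenE mult_2)
    then show ?thesis using *[of k k] norm_mpow_le[OF v, of k] by (simp add: vinner_self_nonneg)
  next
    case False
    then obtain k where n: "n = k + Suc k" by (metis add_Suc_right mult_2 oddE Suc_eq_plus1)
    have "vinner I v (mapply I (mpow I X n) v) = vinner I (?w k) (mapply I X (?w k))"
      using *[of k "Suc k"] unfolding n mpow_Suc mapply_mmul by simp
    then show ?thesis using psd_form[OF psd w, of k] le[OF w, of k] norm_mpow_le[OF v, of k] by simp
  qed
qed

text \<open>The entry is a coordinate of the image of a basis vector, whose norm does not grow. Thus
  the matrix series is dominated entrywise by the scalar one.\<close>

lemma mpow_entry_le: "cmod (mpow I X n i j) \<le> 1"
proof (cases "i \<in> I \<and> j \<in> I")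
  case False
  then have "mpow I X n i j = 0" using mats_eq_0[OF mpow_mats[OF psd_mats[OF psd]]] by blast
  then show ?thesis by simp
next
  case True
  define e where "e = (\<lambda>k. if k = j then 1 else 0 :: complex)"
  have e: "e \<in> vecs I" using True by (auto simp: e_def vecs_def)
  have ej: "mapply I (mpow I X n) e i = mpow I X n i j"
    using True fin by (simp add: mapply_def e_def if_distrib[of "\<lambda>x. _ * x"] cong: if_cong)
  have "(\<Sum>k\<in>I. (cmod (e k))\<^sup>2) = (\<Sum>k\<in>I. if k = j then 1 else 0)"
    by (intro sum.cong) (auto simp: e_def)
  then have e1: "Re (vinner I e e) = 1" using True fin by (simp only: vinner_self Re_complex_of_real) simp
  have "(cmod (mpow I X n i j))\<^sup>2 \<le> (\<Sum>k\<in>I. (cmod (mapply I (mpow I X n) e k))\<^sup>2)"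
    unfolding ej[symmetric] using True fin by (intro member_le_sum) auto
  also have "\<dots> \<le> 1"
    using norm_mpow_le[OF e, of n] unfolding e1 by (simp only: vinner_self Re_complex_of_real)
  finally show ?thesis by (simp add: abs_square_le_1)
qed

definition sqrt_op where "sqrt_op i j = (\<Sum>n. of_real (sqrt_coeff n) * mpow I X n i j)"

lemma sqrt_op_summable: "summable (\<lambda>n. norm (of_real (sqrt_coeff n) * mpow I X n i j))"
  by (rule summable_comparison_test'[OF sqrt_coeff_abs_summable, of 0])
     (auto simp: norm_mult mult_left_le mpow_entry_le)

lemma sqrt_op_sums: "(\<lambda>n. of_real (sqrt_coeff n) * mpow I X n i j) sums sqrt_op i j"
  unfolding sqrt_op_def by (rule summable_sums[OF summable_norm_cancel[OF sqrt_op_summable]])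

text \<open>In the entrywise Cauchy product the powers \<open>l\<close> and \<open>n - l\<close>
  merge, and what remains is the scalar convolution, which keeps only the powers 0 and 1.\<close>

lemma sqrt_op_square: "mmul I sqrt_op sqrt_op = (\<lambda>i j. mone I i j - X i j)"
proof (intro ext)
  fix i j
  have X: "X \<in> mats I I" by (rule psd_mats[OF psd])
  let ?a = "\<lambda>n. complex_of_real (sqrt_coeff n)"
  let ?t = "\<lambda>k. \<lambda>n. \<Sum>l\<le>n. (?a l * mpow I X l i k) * (?a (n - l) * mpow I X (n - l) k j)"
  have "(?t k) sums (sqrt_op i k * sqrt_op k j)" for k
    unfolding sqrt_op_def by (rule Cauchy_product_sums; rule sqrt_op_summable)
  then have "(\<lambda>n. \<Sum>k\<in>I. ?t k n) sums (mmul I sqrt_op sqrt_op i j)"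
    unfolding mmul_def by (rule sums_sum)
  moreover have "(\<Sum>k\<in>I. ?t k n) = of_real (if n = 0 then 1 else if n = 1 then -1 else 0) * mpow I X n i j" for n
  proof -
    have "(\<Sum>k\<in>I. ?t k n) = (\<Sum>l\<le>n. ?a l * ?a (n - l) * mmul I (mpow I X l) (mpow I X (n - l)) i j)"
      unfolding mmul_def sum_distrib_left by (subst sum.swap) (simp add: mult_ac)
    also have "\<dots> = (\<Sum>l\<le>n. ?a l * ?a (n - l)) * mpow I X n i j"
      unfolding sum_distrib_right by (intro sum.cong refl) (simp add: mpow_add fin X)
    finally show ?thesis unfolding sqrt_coeff_convolution[symmetric] by simp
  qed
  moreover have "(\<lambda>n. of_real (if n = 0 then 1 else if n = 1 then -1 else 0) * mpow I X n i j)
      sums (\<Sum>n\<in>{0,1}. of_real (if n = 0 then 1 else if n = 1 then -1 else 0) * mpow I X n i j)"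
    by (rule sums_finite) auto
  ultimately have "mmul I sqrt_op sqrt_op i j = (\<Sum>n\<in>{0,1}. of_real (if n = 0 then 1 else if n = 1 then -1 else 0) * mpow I X n i j)"
    by (metis (no_types, lifting) sums_cong sums_unique2)
  then show "mmul I sqrt_op sqrt_op i j = mone I i j - X i j"
    using mpow_1[OF fin X] by (simp add: mpow_0)
qed

lemma sqrt_op_psd: "sqrt_op \<in> psd I"
proof -
  have "sqrt_op i j = 0" if "i \<notin> I \<or> j \<notin> I" for i j
    using mats_eq_0[OF mpow_mats[OF psd_mats[OF psd]] that] by (simp add: sqrt_op_def)
  then have "sqrt_op \<in> mats I I" by (auto simp: mats_def)
  moreover have "vinner I v (mapply I sqrt_op v) \<in> \<real>\<^sub>\<ge>\<^sub>0" if v: "v \<in> vecs I" for v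
  proof -
    let ?f = "\<lambda>n. vinner I v (mapply I (mpow I X n) v)"
    have "(\<lambda>n. \<Sum>i\<in>I. \<Sum>j\<in>I. cnj (v i) * (of_real (sqrt_coeff n) * mpow I X n i j) * v j) sums
        vinner I v (mapply I sqrt_op v)"
      unfolding vinner_form by (intro sums_sum sums_mult sums_mult2 sqrt_op_sums)
    also have "(\<lambda>n. \<Sum>i\<in>I. \<Sum>j\<in>I. cnj (v i) * (of_real (sqrt_coeff n) * mpow I X n i j) * v j)
        = (\<lambda>n. of_real (sqrt_coeff n) * ?f n)"
      unfolding vinner_form sum_distrib_left by (intro ext sum.cong refl) (simp add: mult_ac)
    finally have s: "(\<lambda>n. of_real (sqrt_coeff n) * ?f n) sums vinner I v (mapply I sqrt_op v)" .
    have f: "Im (?f n) = 0" "Re (?f n) \<ge> 0" "Re (?f n) \<le> Re (vinner I v v)" for n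
      using form_mpow[OF v, of n] by (auto simp: complex_nonneg_Reals_iff)
    have f0: "?f 0 = vinner I v v" by (simp add: mpow_0 mapply_mone fin v)
    have sRe: "(\<lambda>n. sqrt_coeff n * Re (?f n)) sums Re (vinner I v (mapply I sqrt_op v))"
      using sums_Re[OF s] by simp
    have sIm: "(\<lambda>n. 0) sums Im (vinner I v (mapply I sqrt_op v))"
      using sums_Im[OF s] by (simp add: f)
    have "Re (vinner I v (mapply I sqrt_op v)) \<ge> 0"
    proof (rule LIMSEQ_le_const)
      show "(\<lambda>n. \<Sum>i\<le>n. sqrt_coeff i * Re (?f i)) \<longlonglongrightarrow> Re (vinner I v (mapply I sqrt_op v))"
        using sRe by (simp add: sums_def_le)
      \<comment> \<open>No form exceeds the zeroth one, and all coefficients beyond the zeroth are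
        nonpositive; replacing every form by the zeroth therefore only lowers the sum, down to a
        nonnegative partial sum of coefficients times |v|^2.\<close>
      have "0 \<le> (\<Sum>i\<le>n. sqrt_coeff i * Re (?f i))" for n
      proof -
        have "0 \<le> (\<Sum>i\<le>n. sqrt_coeff i) * Re (vinner I v v)"
          using sqrt_coeff_partial_sum f(2)[of 0] by (simp add: f0)
        also have "\<dots> = (\<Sum>i\<le>n. sqrt_coeff i * Re (?f 0))"
          by (simp add: sum_distrib_right f0)
        also have "\<dots> \<le> (\<Sum>i\<le>n. sqrt_coeff i * Re (?f i))"
        proof (rule sum_mono)
          fix i show "sqrt_coeff i * Re (?f 0) \<le> sqrt_coeff i * Re (?f i)"
            using sqrt_coeff_nonpos f(3)[of i] by (cases i) (auto intro: mult_left_mono_neg simp: f0)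
        qed
        finally show ?thesis .
      qed
      then show "\<exists>N. \<forall>n\<ge>N. 0 \<le> (\<Sum>i\<le>n. sqrt_coeff i * Re (?f i))" by blast
    qed
    moreover have "Im (vinner I v (mapply I sqrt_op v)) = 0"
      using sIm sums_unique2 sums_zero by blast
    ultimately show ?thesis by (simp add: complex_nonneg_Reals_iff)
  qed
  ultimately show ?thesis by (simp add: psd_def)
qed

end

text \<open>Scaling reduces the claim to a contraction: the root of A is sqrt l times the root of 1
  - X, with X = 1 - A / l.\<close>

lemma psd_sqrt_exists:
  assumes I: "finite I" and A: "A \<in> psd I"
  shows "\<exists>B\<in>psd I. mmul I B B = A"
proof -
  \<comment> \<open>The sum of the moduli of the entries dominates the form of A; the extra 1 keeps
    \<open>l\<close> positive when A = 0.\<close>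
  define l where "l = 1 + (\<Sum>i\<in>I. \<Sum>j\<in>I. cmod (A i j))"
  have l: "l > 0" unfolding l_def by (intro add_pos_nonneg sum_nonneg) auto
  define X where "X = (\<lambda>i j. mone I i j - A i j / of_real l)"
  have form: "vinner I v (mapply I X v) = vinner I v v - vinner I v (mapply I A v) / of_real l"
    if "v \<in> vecs I" for v
  proof -
    have "mapply I X v = (\<lambda>i. mapply I (mone I) v i - mapply I A v i / of_real l)"
      unfolding mapply_def X_def by (simp add: algebra_simps sum_subtractf sum_divide_distrib)
    then show ?thesis unfolding mapply_mone[OF I that]
      by (simp add: vinner_def algebra_simps sum_subtractf sum_divide_distrib)
  qed
  have A0: "Re (vinner I v (mapply I A v)) \<ge> 0" "Im (vinner I v (mapply I A v)) = 0" if "v \<in> vecs I" for v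
    using psd_form[OF A that] by (auto simp: complex_nonneg_Reals_iff)
  have Al: "Re (vinner I v (mapply I A v)) \<le> l * Re (vinner I v v)" for v
  proof -
    let ?N = "\<Sum>k\<in>I. (cmod (v k))\<^sup>2"
    have "Re (vinner I v (mapply I A v)) \<le> cmod (vinner I v (mapply I A v))" by (rule complex_Re_le_cmod)
    also have "\<dots> \<le> (\<Sum>i\<in>I. \<Sum>j\<in>I. cmod (A i j) * ?N)"
      unfolding vinner_form
    proof (intro order_trans[OF norm_sum] sum_mono)
      fix i j assume ij: "i \<in> I" "j \<in> I"
      have "(cmod (v i))\<^sup>2 \<le> ?N" "(cmod (v j))\<^sup>2 \<le> ?N"
        using ij I by (auto intro: member_le_sum)
      moreover have "2 * (cmod (v i) * cmod (v j)) \<le> (cmod (v i))\<^sup>2 + (cmod (v j))\<^sup>2"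
        using sum_squares_bound[of "cmod (v i)" "cmod (v j)"] by simp
      ultimately have "cmod (v i) * cmod (v j) \<le> ?N" by linarith
      then have "cmod (A i j) * (cmod (v i) * cmod (v j)) \<le> cmod (A i j) * ?N"
        by (intro mult_left_mono) auto
      then show "cmod (cnj (v i) * A i j * v j) \<le> cmod (A i j) * ?N"
        by (simp add: norm_mult mult_ac)
    qed
    also have "\<dots> = (l - 1) * ?N" by (simp add: l_def sum_distrib_right)
    also have "\<dots> \<le> l * ?N" by (intro mult_right_mono sum_nonneg) auto
    finally show ?thesis by (simp only: vinner_self Re_complex_of_real)
  qed
  have "X \<in> psd I"
    using mats_eq_0[OF psd_mats[OF A]] A0 Al l
    by (auto simp: psd_def mats_def X_def[THEN fun_cong, THEN fun_cong] mone_def form complex_nonneg_Reals_iff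
        field_simps Im_divide_of_real vinner_self split: if_splits)
  then interpret psd_contraction I X
    using A0 l I by unfold_locales (auto simp: form)
  define B where "B = (\<lambda>i j. of_real (sqrt l) * sqrt_op i j)"
  have "B \<in> mats I I" using psd_mats[OF sqrt_op_psd] by (auto simp: B_def mats_def)
  moreover have "vinner I v (mapply I B v) = of_real (sqrt l) * vinner I v (mapply I sqrt_op v)" for v
    unfolding vinner_form B_def sum_distrib_left by (intro sum.cong refl) (simp add: mult_ac)
  ultimately have "B \<in> psd I" using sqrt_op_psd l by (auto simp: psd_def)
  moreover have "mmul I B B = A"
  proof (intro ext)
    fix i j
    have "mmul I B B i j = of_real (sqrt l * sqrt l) * mmul I sqrt_op sqrt_op i j"
      unfolding mmul_def B_def sum_distrib_left of_real_mult by (intro sum.cong refl) (simp only: mult_ac)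
    then show "mmul I B B i j = A i j"
      using l unfolding sqrt_op_square by (simp add: X_def)
  qed
  ultimately show ?thesis by blast
qed

text \<open>For B = CC with C positive, the form at v is the squared norm of Cv; if it vanishes, so
  does Bv = C(Cv).\<close>

lemma psd_kernel:
  assumes I: "finite I" and B: "B \<in> psd I" and v: "v \<in> vecs I" and 0: "vinner I v (mapply I B v) = 0"
  shows "mapply I B v = (\<lambda>_. 0)"
proof -
  obtain C where C: "C \<in> psd I" "mmul I C C = B" using psd_sqrt_exists[OF I B] by blast
  have "vinner I (mapply I C v) (mapply I C v) = 0"
    using 0 unfolding C(2)[symmetric] mapply_mmul by (subst (asm) psd_self_adj[OF I C(1)])
  then have "mapply I C v = (\<lambda>_. 0)"
    by (intro vinner_self_0[OF I] mapply_vecs psd_mats C)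
  then show ?thesis by (simp add: C(2)[symmetric] mapply_mmul) (simp add: mapply_def)
qed

text \<open>The trace of a threefold product, unfolded to one triple sum so that cyclicity becomes
  an interchange of summations.\<close>

definition trace3 where "trace3 I A B C = (\<Sum>i\<in>I. \<Sum>j\<in>I. \<Sum>k\<in>I. A i j * B j k * C k i)" for I :: "'i set" and A :: "('i,'i) cmat"

lemma trace3_mmul: "trace3 I A B C = mtrace I (mmul I (mmul I A B) C)"
  unfolding trace3_def mtrace_def mmul_def sum_distrib_right by (intro sum.cong refl sum.swap)

lemma trace3_cyclic: "trace3 I A B C = trace3 I B C A"
proof -
  have "trace3 I A B C = (\<Sum>j\<in>I. \<Sum>i\<in>I. \<Sum>k\<in>I. A i j * B j k * C k i)"
    unfolding trace3_def by (rule sum.swap)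
  also have "\<dots> = (\<Sum>j\<in>I. \<Sum>k\<in>I. \<Sum>i\<in>I. A i j * B j k * C k i)"
    by (intro sum.cong refl sum.swap)
  finally show ?thesis by (simp add: trace3_def mult_ac)
qed

text \<open>
  For \<open>D = B - C\<close> and \<open>S = B + C\<close> with \<open>B\<^sup>2 = C\<^sup>2\<close>, cyclicity gives \<open>tr (D S D) = 0\<close>.  As \<open>B\<close> and \<open>C\<close> are
  positive, both annihilate the columns of \<open>D\<close>, so that \<open>D\<^sup>2 = 0\<close>.
\<close>

lemma psd_sqrt_unique:
  assumes I: "finite I" and B: "B \<in> psd I" and C: "C \<in> psd I" and eq: "mmul I B B = mmul I C C"
  shows "B = C"
proof -
  define D where "D = (\<lambda>i j. B i j - C i j)"
  define d where "d = (\<lambda>j i. D i j)"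
  have d: "d j \<in> vecs I" for j
  proof -
    have "d j i = 0" if "i \<notin> I" for i
      using that mats_eq_0[OF psd_mats[OF B], of i j] mats_eq_0[OF psd_mats[OF C], of i j] by (simp add: d_def D_def)
    then show ?thesis by (auto simp: vecs_def)
  qed
  have D: "cnj (D i j) = D j i" for i j by (simp add: D_def psd_hermitian[OF I B] psd_hermitian[OF I C])
  have "(\<Sum>j\<in>I. vinner I (d j) (mapply I B (d j)) + vinner I (d j) (mapply I C (d j)))
      = (\<Sum>j\<in>I. \<Sum>i\<in>I. \<Sum>k\<in>I. D j i * (B i k + C i k) * D k j)"
    unfolding vinner_form sum.distrib[symmetric] d_def D by (simp add: algebra_simps)
  also have "\<dots> = trace3 I B B B - trace3 I B B C + trace3 I B C B - trace3 I B C C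
      - trace3 I C B B + trace3 I C B C - trace3 I C C B + trace3 I C C C"
    unfolding trace3_def D_def sum_subtractf[symmetric] sum.distrib[symmetric]
    by (intro sum.cong refl) (simp add: algebra_simps)
  also have "\<dots> = 0"
  proof -
    have "trace3 I B B B = trace3 I C C B" "trace3 I B B C = trace3 I C C C"
      by (simp_all only: trace3_mmul eq)
    moreover have "trace3 I B C B = trace3 I C B B" "trace3 I C B C = trace3 I B C C"
      by (rule trace3_cyclic)+
    ultimately show ?thesis by simp
  qed
  finally have s0: "(\<Sum>j\<in>I. vinner I (d j) (mapply I B (d j)) + vinner I (d j) (mapply I C (d j))) = 0" .
  have nn: "Re (vinner I (d j) (mapply I B (d j))) \<ge> 0" "Re (vinner I (d j) (mapply I C (d j))) \<ge> 0"
     "Im (vinner I (d j) (mapply I B (d j))) = 0" "Im (vinner I (d j) (mapply I C (d j))) = 0" for j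
    using psd_form[OF B d] psd_form[OF C d] by (auto simp: complex_nonneg_Reals_iff)
  have "(\<Sum>j\<in>I. Re (vinner I (d j) (mapply I B (d j))) + Re (vinner I (d j) (mapply I C (d j)))) = 0"
    using arg_cong[OF s0, of Re] by simp
  then have "\<forall>j\<in>I. Re (vinner I (d j) (mapply I B (d j))) + Re (vinner I (d j) (mapply I C (d j))) = 0"
    using nn I by (subst (asm) sum_nonneg_eq_0_iff) auto
  then have "vinner I (d j) (mapply I B (d j)) = 0 \<and> vinner I (d j) (mapply I C (d j)) = 0" if "j \<in> I" for j
    using that nn[of j] by (auto simp add: complex_eq_iff add_nonneg_eq_0_iff)
  then have k: "mapply I B (d j) = (\<lambda>_. 0)" "mapply I C (d j) = (\<lambda>_. 0)" if "j \<in> I" for j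
    using that psd_kernel[OF I _ d] B C by auto
  have "vinner I (d j) (d j) = 0" if "j \<in> I" for j
  proof -
    have "vinner I (d j) (d j) = mapply I B (d j) j - mapply I C (d j) j"
      by (simp add: vinner_def mapply_def d_def D sum_subtractf[symmetric] left_diff_distrib[symmetric]) (simp add: D_def)
    then show ?thesis by (simp add: k that)
  qed
  then have "d j = (\<lambda>_. 0)" if "j \<in> I" for j using that by (intro vinner_self_0[OF I d]) auto
  then have "D i j = 0" for i j using d[of j] D[of i j] vecs_eq_0[OF d, of i j] vecs_eq_0[OF d, of j i]
    by (cases "j \<in> I") (auto simp: d_def fun_eq_iff)
  then show ?thesis by (simp add: D_def fun_eq_iff)
qed

section \<open>The chosen square root and the fidelity with a pure state\<close>

lemma msqrt_psd: "finite I \<Longrightarrow> A \<in> psd I \<Longrightarrow> msqrt I A \<in> psd I"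
  and msqrt_square: "finite I \<Longrightarrow> A \<in> psd I \<Longrightarrow> mmul I (msqrt I A) (msqrt I A) = A"
proof -
  assume "finite I" "A \<in> psd I"
  then have "\<exists>!B. B \<in> psd I \<and> mmul I B B = A"
    by (metis psd_sqrt_exists psd_sqrt_unique)
  from theI'[OF this] show "msqrt I A \<in> psd I" "mmul I (msqrt I A) (msqrt I A) = A"
    unfolding msqrt_def by auto
qed

lemma msqrt_eqI: "finite I \<Longrightarrow> B \<in> psd I \<Longrightarrow> msqrt I (mmul I B B) = B"
  unfolding msqrt_def by (intro the_equality) (auto intro: psd_sqrt_unique)

text \<open>With R the root of \<open>\<rho>\<close> and w = Rv, the operator under the outer root
  is the rank-one matrix of w. Its root is the same matrix divided by |w|, of trace |w|, and |w|^2
  is the form of \<open>\<rho>\<close> at v.\<close>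

lemma fidelity_pure:
  assumes I: "finite I" and \<rho>: "\<rho> \<in> psd I" and v: "v \<in> vecs I"
  shows "(fidelity I \<rho> (outer v))\<^sup>2 = Re (vinner I v (mapply I \<rho> v))"
proof -
  define R where "R = msqrt I \<rho>"
  have R: "R \<in> psd I" "mmul I R R = \<rho>" unfolding R_def using msqrt_psd msqrt_square I \<rho> by auto
  define w where "w = mapply I R v"
  define c where "c = sqrt (\<Sum>i\<in>I. (cmod (w i))\<^sup>2)"
  have c: "c \<ge> 0" "vinner I w w = of_real (c\<^sup>2)" unfolding vinner_self c_def by (auto simp: sum_nonneg)
  have w: "w \<in> vecs I" unfolding w_def by (intro mapply_vecs psd_mats R)
  \<comment> \<open>If w = 0, division by zero makes B = 0, which is still the right root.\<close>
  define B where "B = (\<lambda>i j. w i * cnj (w j) / of_real c)"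
  have "vinner I u (mapply I B u) = vinner I u w * vinner I w u / of_real c" for u
    unfolding vinner_form B_def unfolding vinner_def sum_product sum_divide_distrib
    by (simp add: mult_ac)
  then have "vinner I u (mapply I B u) = of_real ((cmod (vinner I u w))\<^sup>2 / c)" for u
    by (simp only: vinner_cnj complex_norm_square of_real_divide)
  then have B: "B \<in> psd I"
    using vecs_eq_0[OF w] c by (auto simp: psd_def mats_def B_def)
  have BB: "mmul I B B = outer w"
  proof (cases "c = 0")
    case True
    then have "w = (\<lambda>_. 0)" using vinner_self_0[OF I w] c by simp
    then show ?thesis by (simp add: B_def mmul_def outer_def)
  next
    case False
    have "mmul I B B i j = w i * cnj (w j) * vinner I w w / (of_real c)\<^sup>2" for i j
      unfolding mmul_def B_def vinner_def by (simp add: sum_distrib_left sum_divide_distrib power2_eq_square mult_ac)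
    then show ?thesis using False c by (simp add: outer_def fun_eq_iff)
  qed
  have "mmul I (mmul I R (outer v)) R i j = w i * cnj (w j)" for i j
  proof -
    have "mmul I (mmul I R (outer v)) R i j = (\<Sum>k\<in>I. (\<Sum>l\<in>I. R i l * v l * cnj (v k)) * R k j)"
      by (simp add: mmul_def outer_def mult.assoc)
    also have "\<dots> = w i * (\<Sum>k\<in>I. cnj (v k) * R k j)"
      unfolding w_def mapply_def by (simp add: sum_distrib_left sum_distrib_right mult_ac)
    also have "(\<Sum>k\<in>I. cnj (v k) * R k j) = cnj (w j)"
      by (simp add: w_def mapply_def psd_hermitian[OF I R(1)] mult.commute)
    finally show ?thesis .
  qed
  then have "mmul I (mmul I R (outer v)) R = mmul I B B" by (simp add: BB outer_def fun_eq_iff)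
  then have "fidelity I \<rho> (outer v) = Re (mtrace I B)"
    unfolding fidelity_def R_def[symmetric] by (simp add: msqrt_eqI[OF I B])
  also have "mtrace I B = vinner I w w / of_real c"
    by (simp add: mtrace_def B_def vinner_def sum_divide_distrib mult.commute)
  also have "\<dots> = of_real c" using c by (simp add: power2_eq_square)
  finally have "(fidelity I \<rho> (outer v))\<^sup>2 = Re (vinner I w w)" using c by simp
  also have "vinner I w w = vinner I v (mapply I \<rho> v)"
    unfolding w_def R(2)[symmetric] mapply_mmul by (rule psd_self_adj[OF I R(1), symmetric])
  finally show ?thesis .
qed

section \<open>Kraus maps and the inaccuracy\<close>

definition kraus :: "'q set \<Rightarrow> 'a set \<Rightarrow> ('q \<Rightarrow> ('b, 'a) cmat) \<Rightarrow> ('a, 'b) superop" where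
  "kraus Q I A X = (\<lambda>b b'. \<Sum>q\<in>Q. \<Sum>a\<in>I. \<Sum>a'\<in>I. A q b a * X a a' * cnj (A q b' a'))"

definition tensor_id :: "('b, 'a) cmat \<Rightarrow> ('b \<times> 'r, 'a \<times> 'r) cmat" where
  "tensor_id A = (\<lambda>(b, r) (a, r'). if r = r' then A b a else 0)"

lemma kraus_mats:
  assumes "\<And>q. q \<in> Q \<Longrightarrow> A q \<in> mats K I" shows "kraus Q I A X \<in> mats K K"
proof -
  have "kraus Q I A X b b' = 0" if "b \<notin> K \<or> b' \<notin> K" for b b'
    unfolding kraus_def by (intro sum.neutral ballI) (use that mats_eq_0[OF assms] in auto)
  then show ?thesis by (auto simp: mats_def)
qed

lemma kraus_mmul:
  "kraus Q I A X = (\<lambda>b b'. \<Sum>q\<in>Q. mmul I (mmul I (A q) X) (madj (A q)) b b')"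
  unfolding kraus_def mmul_def madj_def sum_distrib_right
  by (intro ext sum.cong refl sum.swap)

lemma mapply_sum: "mapply K (\<lambda>b b'. \<Sum>q\<in>Q. M q b b') v = (\<lambda>b. \<Sum>q\<in>Q. mapply K (M q) v b)"
  unfolding mapply_def sum_distrib_right by (intro ext sum.swap)

lemma vinner_sum_right: "vinner K u (\<lambda>b. \<Sum>q\<in>Q. w q b) = (\<Sum>q\<in>Q. vinner K u (w q))"
  unfolding vinner_def sum_distrib_left by (rule sum.swap)

lemma madj_madj: "madj (madj A) = A" by (simp add: madj_def)

lemma kraus_form:
  "vinner K v (mapply K (kraus Q I A X) v) =
   (\<Sum>q\<in>Q. vinner I (mapply K (madj (A q)) v) (mapply I X (mapply K (madj (A q)) v)))"
  unfolding kraus_mmul mapply_sum vinner_sum_right mapply_mmul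
  by (subst vinner_mapply_adj) (rule refl)

lemma madj_mats: "A \<in> mats I J \<Longrightarrow> madj A \<in> mats J I"
  by (auto simp: mats_def madj_def)

lemma nonneg_Reals_sum: "(\<And>q. q \<in> Q \<Longrightarrow> f q \<in> \<real>\<^sub>\<ge>\<^sub>0) \<Longrightarrow> (\<Sum>q\<in>Q. f q :: complex) \<in> \<real>\<^sub>\<ge>\<^sub>0"
  by (simp add: complex_nonneg_Reals_iff sum_nonneg)

lemma kraus_psd:
  assumes "\<And>q. q \<in> Q \<Longrightarrow> A q \<in> mats K I" and "X \<in> psd I"
  shows "kraus Q I A X \<in> psd K"
  using assms by (simp add: psd_def kraus_mats kraus_form)
    (intro ballI nonneg_Reals_sum psd_form[OF assms(2)] mapply_vecs madj_mats assms(1))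

text \<open>Each Kraus operator contributes a nonnegative term, so a lower bound on a fidelity may
  keep only the operators that are easy to evaluate.\<close>

lemma kraus_outer_form:
  "vinner K v (mapply K (kraus Q I A (outer w)) v) = of_real (\<Sum>q\<in>Q. (cmod (vinner K v (mapply I (A q) w)))\<^sup>2)"
proof -
  have "vinner I u (mapply I (outer w) u) = of_real ((cmod (vinner I u w))\<^sup>2)" for u
  proof -
    have "vinner I u (mapply I (outer w) u) = vinner I u w * vinner I w u"
      unfolding vinner_form outer_def unfolding vinner_def sum_product by (simp add: mult_ac)
    then show ?thesis by (simp only: complex_norm_square vinner_cnj)
  qed
  then show ?thesis
    unfolding kraus_form of_real_sum
    by (intro sum.cong refl) (simp only: vinner_mapply_adj[of K v I])
qed

lemma sum_swap_pairs:
  "(\<Sum>a\<in>A. \<Sum>b\<in>B. \<Sum>c\<in>C. \<Sum>d\<in>D. f a b c d) = (\<Sum>c\<in>C. \<Sum>d\<in>D. \<Sum>a\<in>A. \<Sum>b\<in>B. f a b c d)"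
proof -
  have "(\<Sum>a\<in>A. \<Sum>b\<in>B. \<Sum>c\<in>C. \<Sum>d\<in>D. f a b c d) = (\<Sum>a\<in>A. \<Sum>c\<in>C. \<Sum>b\<in>B. \<Sum>d\<in>D. f a b c d)"
    by (rule sum.cong[OF refl], rule sum.swap)
  also have "\<dots> = (\<Sum>c\<in>C. \<Sum>a\<in>A. \<Sum>d\<in>D. \<Sum>b\<in>B. f a b c d)"
    by (subst sum.swap, rule sum.cong[OF refl], rule sum.cong[OF refl], rule sum.swap)
  also have "\<dots> = (\<Sum>c\<in>C. \<Sum>d\<in>D. \<Sum>a\<in>A. \<Sum>b\<in>B. f a b c d)"
    by (rule sum.cong[OF refl], rule sum.swap)
  finally show ?thesis .
qed

lemma kraus_comp:
  assumes "finite P"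
  shows "kraus Q K A (kraus P I B X) = kraus (Q \<times> P) I (\<lambda>(q, p). mmul K (A q) (B p)) X"
proof (intro ext)
  fix b b'
  have "kraus Q K A (kraus P I B X) b b' = (\<Sum>q\<in>Q. \<Sum>k\<in>K. \<Sum>k'\<in>K. \<Sum>p\<in>P. \<Sum>a\<in>I. \<Sum>a'\<in>I.
     A q b k * (B p k a * X a a' * cnj (B p k' a')) * cnj (A q b' k'))"
    by (simp add: kraus_def sum_distrib_left sum_distrib_right)
  also have "\<dots> = (\<Sum>q\<in>Q. \<Sum>k\<in>K. \<Sum>p\<in>P. \<Sum>k'\<in>K. \<Sum>a\<in>I. \<Sum>a'\<in>I.
     A q b k * (B p k a * X a a' * cnj (B p k' a')) * cnj (A q b' k'))"
    by (rule sum.cong[OF refl], rule sum.cong[OF refl], rule sum.swap)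
  also have "\<dots> = (\<Sum>q\<in>Q. \<Sum>p\<in>P. \<Sum>k\<in>K. \<Sum>k'\<in>K. \<Sum>a\<in>I. \<Sum>a'\<in>I.
     A q b k * (B p k a * X a a' * cnj (B p k' a')) * cnj (A q b' k'))"
    by (rule sum.cong[OF refl], rule sum.swap)
  also have "\<dots> = (\<Sum>q\<in>Q. \<Sum>p\<in>P. \<Sum>a\<in>I. \<Sum>a'\<in>I. \<Sum>k\<in>K. \<Sum>k'\<in>K.
     A q b k * (B p k a * X a a' * cnj (B p k' a')) * cnj (A q b' k'))"
    by (rule sum.cong[OF refl], rule sum.cong[OF refl], rule sum_swap_pairs)
  also have "\<dots> = kraus (Q \<times> P) I (\<lambda>(q, p). mmul K (A q) (B p)) X b b'"
  proof -
    have "(\<Sum>k\<in>K. \<Sum>k'\<in>K. A q b k * (B p k a * X a a' * cnj (B p k' a')) * cnj (A q b' k'))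
        = mmul K (A q) (B p) b a * cnj (mmul K (A q) (B p) b' a') * X a a'" for q p a a'
      unfolding mmul_def cnj_sum sum_product unfolding sum_distrib_right by (simp add: mult_ac)
    then show ?thesis unfolding kraus_def sum.cartesian_product' by (simp add: mult_ac)
  qed
  finally show "kraus Q K A (kraus P I B X) b b' = kraus (Q \<times> P) I (\<lambda>(q, p). mmul K (A q) (B p)) X b b'" .
qed

lemma ampliate_kraus:
  fixes A :: "'q \<Rightarrow> ('b, 'a) cmat" and X :: "('a \<times> 'r, 'a \<times> 'r) cmat"
  assumes R: "finite R" and X: "X \<in> mats (I \<times> R) (I \<times> R)"
  shows "ampliate (kraus Q I A) X = kraus Q (I \<times> R) (\<lambda>q. tensor_id (A q)) X"
proof (intro ext)
  fix x x' :: "'b \<times> 'r"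
  obtain b r b' r' where x: "x = (b, r)" "x' = (b', r')" by (cases x, cases x')
  show "ampliate (kraus Q I A) X x x' = kraus Q (I \<times> R) (\<lambda>q. tensor_id (A q)) X x x'"
  proof (cases "r \<in> R \<and> r' \<in> R")
    case True
    have "kraus Q (I \<times> R) (\<lambda>q. tensor_id (A q)) X x x' =
      (\<Sum>q\<in>Q. \<Sum>a\<in>I. \<Sum>s\<in>R. \<Sum>a'\<in>I. \<Sum>s'\<in>R.
         if s' = r' then if s = r then A q b a * X (a, s) (a', s') * cnj (A q b' a') else 0 else 0)"
      unfolding kraus_def x tensor_id_def sum.cartesian_product'
      by (intro sum.cong refl) auto
    also have "\<dots> = ampliate (kraus Q I A) X x x'"
      using True R by (simp add: x ampliate_def kraus_def) (subst sum.swap, simp)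
    finally show ?thesis by simp
  next
    case False
    then have "X (a, r) (a', r') = 0" for a a' using mats_eq_0[OF X, of "(a, r)" "(a', r')"] by auto
    then have "ampliate (kraus Q I A) X x x' = 0" by (simp add: x ampliate_def kraus_def)
    moreover have "kraus Q (I \<times> R) (\<lambda>q. tensor_id (A q)) X x x' = 0"
      unfolding kraus_def x tensor_id_def by (intro sum.neutral ballI) (use False in \<open>auto split: if_splits\<close>)
    ultimately show ?thesis by simp
  qed
qed

lemma ampliate_kraus_psd:
  assumes R: "finite R" and X: "X \<in> psd (I \<times> R)" and A: "\<And>q. q \<in> Q \<Longrightarrow> A q \<in> mats K I"
  shows "ampliate (kraus Q I A) X \<in> psd (K \<times> R)"
proof -
  have A0: "A q b a = 0" if "q \<in> Q" "b \<notin> K" for q b a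
    using mats_eq_0[OF A[OF that(1)]] that by blast
  \<comment> \<open>\<open>tensor_id\<close> is the identity on all reference labels and so need not
    be supported on \<open>K \<times> R\<close>; cutting off its other rows changes nothing on
    columns in \<open>I \<times> R\<close>.\<close>
  let ?B = "\<lambda>q x y. if x \<in> K \<times> R then tensor_id (A q) x y else 0"
  have T: "tensor_id (A q) x y = ?B q x y" if "q \<in> Q" "y \<in> I \<times> R" for q x y
    using that A0[OF that(1)] by (cases x, cases y) (auto simp: tensor_id_def)
  have "kraus Q (I \<times> R) (\<lambda>q. tensor_id (A q)) X = kraus Q (I \<times> R) ?B X"
    unfolding kraus_def
    by (intro ext sum.cong refl arg_cong2[where f = "(*)"] arg_cong[where f = cnj] T)
  moreover have "?B q \<in> mats (K \<times> R) (I \<times> R)" if "q \<in> Q" for q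
    using A[OF that] by (auto simp: mats_def tensor_id_def split: if_splits)
  ultimately show ?thesis
    unfolding ampliate_kraus[OF R psd_mats[OF X]] using kraus_psd[OF _ X, of Q ?B] by simp
qed

lemma kraus_add: "kraus Q I A (\<lambda>i j. X i j + Y i j) = (\<lambda>i j. kraus Q I A X i j + kraus Q I A Y i j)"
  unfolding kraus_def sum.distrib[symmetric] by (intro ext sum.cong refl) (simp add: algebra_simps)

lemma kraus_scale: "kraus Q I A (\<lambda>i j. a * X i j) = (\<lambda>i j. a * kraus Q I A X i j)"
  unfolding kraus_def sum_distrib_left by (intro ext sum.cong refl) (simp add: algebra_simps)

text \<open>The assumption \<open>tp\<close> is the completeness relation, that the products of
  adjoint and operator sum to the identity, written in transposed form.\<close>

lemma kraus_channel:
  assumes "finite I" and A: "\<And>q. q \<in> Q \<Longrightarrow> A q \<in> mats K I"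
    and tp: "\<And>a a'. a \<in> I \<Longrightarrow> a' \<in> I \<Longrightarrow> (\<Sum>q\<in>Q. \<Sum>b\<in>K. A q b a * cnj (A q b a')) = (if a = a' then 1 else 0)"
  shows "channel I K (kraus Q I A)"
proof -
  have "mtrace K (kraus Q I A X) = mtrace I X" for X
  proof -
    have "mtrace K (kraus Q I A X) = (\<Sum>a\<in>I. \<Sum>a'\<in>I. \<Sum>b\<in>K. \<Sum>q\<in>Q. A q b a * X a a' * cnj (A q b a'))"
      unfolding mtrace_def kraus_def by (rule sum_swap_pairs)
    also have "\<dots> = (\<Sum>a\<in>I. \<Sum>a'\<in>I. X a a' * (\<Sum>q\<in>Q. \<Sum>b\<in>K. A q b a * cnj (A q b a')))"
      unfolding sum.swap[of _ K Q] sum_distrib_left by (simp add: mult_ac)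
    also have "\<dots> = (\<Sum>a\<in>I. \<Sum>a'\<in>I. if a = a' then X a a' else 0)"
      by (intro sum.cong refl) (simp add: tp)
    also have "\<dots> = mtrace I X" using assms(1) by (simp add: mtrace_def)
    finally show ?thesis .
  qed
  then show ?thesis
    unfolding channel_def completely_positive_def
    by (simp add: kraus_mats[OF A] kraus_add kraus_scale ampliate_kraus_psd A)
qed

section \<open>Bounding the inaccuracy by a single recovery\<close>

lemma outer_psd: "w \<in> vecs I \<Longrightarrow> outer w \<in> psd I"
proof -
  assume w: "w \<in> vecs I"
  have "vinner I u (mapply I (outer w) u) = vinner I w u * cnj (vinner I w u)" for u
    unfolding vinner_form outer_def vinner_cnj unfolding vinner_def by (subst mult.commute, unfold sum_product) (simp add: mult_ac)
  then have "vinner I u (mapply I (outer w) u) = of_real ((cmod (vinner I w u))\<^sup>2)" for u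
    by (simp only: complex_norm_square)
  then show "outer w \<in> psd I" using w by (auto simp: psd_def mats_def vecs_def outer_def)
qed

lemma unit_vecs_vecs: "v \<in> unit_vecs I \<Longrightarrow> v \<in> vecs I" by (simp add: unit_vecs_def)

lemma ampliate_comp: "ampliate (F \<circ> G) X = ampliate F (ampliate G X)"
  by (simp add: ampliate_def fun_eq_iff)

lemma ampliate_id: "ampliate id X = X"
  by (simp add: ampliate_def fun_eq_iff)

text \<open>
  The infimum over recoveries is meaningful only if the distances are bounded below uniformly.  For the
  product input \<open>b 0\<close> the squared fidelity is a diagonal entry of the recovered state, hence at most
  the trace of the recovered operator, which no channel can change.
\<close>

lemma inaccuracy_le:
  fixes n :: nat
  assumes K: "finite K" and n: "n > 0"
    and E: "\<N> \<circ> encoding {..<n} V = kraus Q {..<n} B" and B: "\<And>q. q \<in> Q \<Longrightarrow> B q \<in> mats K {..<n}"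
    and R: "channel K {..<n} \<R>" and e: "e \<ge> 0"
    and le: "\<And>\<psi>. \<psi> \<in> unit_vecs ({..<n} \<times> {..<n}) \<Longrightarrow>
      1 - Re (vinner ({..<n} \<times> {..<n}) \<psi> (mapply ({..<n} \<times> {..<n}) (ampliate (\<R> \<circ> \<N> \<circ> encoding {..<n} V) (outer \<psi>)) \<psi>)) \<le> e\<^sup>2"
  shows "inaccuracy {..<n} K V \<N> \<le> e"
proof -
  let ?L = "{..<n}"
  define Y where "Y \<psi> = ampliate (kraus Q ?L B) (outer \<psi>)" for \<psi> :: "nat \<times> nat \<Rightarrow> complex"
  have Y: "Y \<psi> \<in> psd (K \<times> ?L)" if "\<psi> \<in> vecs (?L \<times> ?L)" for \<psi>
    unfolding Y_def by (intro ampliate_kraus_psd outer_psd that B) auto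
  have amp: "ampliate (R' \<circ> \<N> \<circ> encoding ?L V) (outer \<psi>) = ampliate R' (Y \<psi>)" for R' :: "('a, nat) superop" and \<psi>
    by (simp add: comp_assoc E ampliate_comp Y_def)
  have psd: "ampliate R' (Y \<psi>) \<in> psd (?L \<times> ?L)" if "channel K ?L R'" "\<psi> \<in> vecs (?L \<times> ?L)" for R' \<psi>
    using that Y by (simp add: channel_def completely_positive_def)
  have fid: "(fidelity (?L \<times> ?L) (ampliate (R' \<circ> \<N> \<circ> encoding ?L V) (outer \<psi>)) (ampliate id (outer \<psi>)))\<^sup>2 =
      Re (vinner (?L \<times> ?L) \<psi> (mapply (?L \<times> ?L) (ampliate R' (Y \<psi>)) \<psi>))"
    if "channel K ?L R'" "\<psi> \<in> vecs (?L \<times> ?L)" for R' \<psi>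
    unfolding amp ampliate_id by (intro fidelity_pure psd that) auto
  define b where "b l = (\<lambda>k. if k = (l, 0 :: nat) then 1 else 0 :: complex)" for l :: nat
  have b: "b l \<in> vecs (?L \<times> ?L)" if "l < n" for l using that n by (auto simp: b_def vecs_def)
  have bform: "vinner (?L \<times> ?L) (b l) (mapply (?L \<times> ?L) M (b l)) = M (l, 0) (l, 0)" if "l < n" for M l
    using that n by (simp add: vinner_def mapply_def b_def if_distrib[of "\<lambda>x. x * _"] if_distrib[of "\<lambda>x. _ * x"] if_distrib[of cnj] cong: if_cong)
  have b0: "b 0 \<in> unit_vecs (?L \<times> ?L)"
    using b[of 0] n by (simp add: unit_vecs_def vinner_def) (simp add: b_def if_distrib[of "\<lambda>x. x * _"] if_distrib[of "\<lambda>x. _ * x"] if_distrib[of cnj] cong: if_cong)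
  define Z where "Z = (\<lambda>k k'. Y (b 0) (k, 0) (k', 0))"
  have Z: "Z \<in> mats K K" using psd_mats[OF Y[OF b[OF n]]] by (auto simp: mats_def Z_def)
  have low: "sqrt (1 - Re (mtrace K Z)) \<le> purified_dist ?L (R' \<circ> \<N> \<circ> encoding ?L V) id" if R': "channel K ?L R'" for R'
  proof -
    have d: "R' Z l l \<in> \<real>\<^sub>\<ge>\<^sub>0" if "l < n" for l
      using psd_form[OF psd[OF R' b[OF n]] b[OF that]] unfolding bform[OF that] by (simp add: ampliate_def Z_def)
    have "Re (vinner (?L \<times> ?L) (b 0) (mapply (?L \<times> ?L) (ampliate R' (Y (b 0))) (b 0))) = Re (R' Z 0 0)"
      unfolding bform[OF n] by (simp add: ampliate_def Z_def)
    also have "\<dots> \<le> (\<Sum>l<n. Re (R' Z l l))"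
      using n d by (intro member_le_sum) (auto simp: complex_nonneg_Reals_iff)
    also have "\<dots> = Re (mtrace ?L (R' Z))" by (simp add: mtrace_def)
    also have "\<dots> = Re (mtrace K Z)" using R' Z by (simp add: channel_def)
    finally have "sqrt (1 - Re (mtrace K Z)) \<le> sqrt (1 - (fidelity (?L \<times> ?L) (ampliate (R' \<circ> \<N> \<circ> encoding ?L V) (outer (b 0))) (ampliate id (outer (b 0))))\<^sup>2)"
      unfolding fid[OF R' b[OF n]] by simp
    also have "\<dots> \<le> purified_dist ?L (R' \<circ> \<N> \<circ> encoding ?L V) id"
      unfolding purified_dist_def
      by (rule cSUP_upper[OF b0], rule bdd_aboveI[of _ 1]) auto
    finally show ?thesis .
  qed
  have "inaccuracy ?L K V \<N> \<le> purified_dist ?L (\<R> \<circ> \<N> \<circ> encoding ?L V) id"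
    unfolding inaccuracy_def
    by (rule cINF_lower, rule bdd_belowI[of _ "sqrt (1 - Re (mtrace K Z))"]) (auto intro: low R)
  also have "\<dots> \<le> e"
    unfolding purified_dist_def
  proof (rule cSUP_least)
    show "unit_vecs (?L \<times> ?L) \<noteq> {}" using b0 by blast
    fix \<psi> assume \<psi>: "\<psi> \<in> unit_vecs (?L \<times> ?L)"
    show "sqrt (1 - (fidelity (?L \<times> ?L) (ampliate (\<R> \<circ> \<N> \<circ> encoding ?L V) (outer \<psi>)) (ampliate id (outer \<psi>)))\<^sup>2) \<le> e"
      unfolding fid[OF R unit_vecs_vecs[OF \<psi>]]
      using le[OF \<psi>] e unfolding amp by (intro real_le_lsqrt) auto
  qed
  finally show ?thesis .
qed

text \<open>The reference merely indexes slices that do not interact, so an entangled input is no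
  harder than a family of unnormalized logical vectors.\<close>

lemma tensor_id_form:
  assumes "finite L" "finite R"
  shows "vinner (K \<times> R) v (mapply (L \<times> R) (tensor_id A) w) =
    (\<Sum>r\<in>R. vinner K (\<lambda>l. v (l, r)) (mapply L A (\<lambda>l. w (l, r))))"
proof -
  have "mapply (L \<times> R) (tensor_id A) w (k, r) = mapply L A (\<lambda>l. w (l, r)) k" if "r \<in> R" for k r
    using that assms unfolding mapply_def tensor_id_def sum.cartesian_product'
    by (simp add: if_distrib[of "\<lambda>x. x * _"] cong: if_cong)
  then show ?thesis
    unfolding vinner_def sum.cartesian_product' by (subst sum.swap) simp
qed

section \<open>Affinity of hypergeometric distributions\<close>

text \<open>
  The Bhattacharyya coefficient of two hypergeometric laws: \<open>a\<close> draws from \<open>n\<close> units of which \<open>K\<close>,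
  respectively \<open>K'\<close>, are occupied.
\<close>

definition hypergeometric_affinity :: "nat \<Rightarrow> nat \<Rightarrow> nat \<Rightarrow> nat \<Rightarrow> real" where
  "hypergeometric_affinity n a K K' = (\<Sum>k\<le>a. real (a choose k) *
     (sqrt (real ((n - a) choose (K - k)) / real (n choose K)) *
      sqrt (real ((n - a) choose (K' - k)) / real (n choose K'))))"

text \<open>Pascal's rule; the two sums correspond to one distinguished draw being empty or
  occupied.\<close>

lemma sum_binomial_Suc:
  fixes f :: "nat \<Rightarrow> real"
  shows "(\<Sum>k\<le>Suc a. real (Suc a choose k) * f k) =
     (\<Sum>k\<le>a. real (a choose k) * f k) + (\<Sum>k\<le>a. real (a choose k) * f (Suc k))"
proof -
  have "(\<Sum>k\<le>a. real (a choose k) * f k) = (\<Sum>k\<le>Suc a. real (a choose k) * f k)"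
    by (simp add: binomial_eq_0)
  also have "\<dots> = f 0 + (\<Sum>k\<le>a. real (a choose Suc k) * f (Suc k))"
    by (subst sum.atMost_Suc_shift) simp
  finally show ?thesis
    by (subst sum.atMost_Suc_shift) (simp add: algebra_simps sum.distrib)
qed

text \<open>Conditioning on one draw: with probability \<open>K / Suc n\<close> it is occupied and
  leaves \<open>K - 1\<close> occupied units, otherwise it leaves \<open>K\<close>. The affinity is
  the sum of the affinities of the two branches, each weighted by the geometric mean of its
  probabilities under both laws.\<close>

lemma hypergeometric_affinity_Suc:
  assumes "Suc a \<le> K" "Suc a \<le> K'" "K \<le> n" "K' \<le> n"
  shows "hypergeometric_affinity (Suc n) (Suc a) K K' =
     sqrt ((1 - real K / real (Suc n)) * (1 - real K' / real (Suc n))) * hypergeometric_affinity n a K K' +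
     sqrt (real K / real (Suc n) * (real K' / real (Suc n))) * hypergeometric_affinity n a (K - 1) (K' - 1)"
proof -
  \<comment> \<open>The absorption identities trade the normalization of \<open>Suc n\<close> units
    for that of \<open>n\<close> units times the probability of an empty draw here, of an occupied
    draw in \<open>r2\<close>.\<close>
  have r1: "sqrt (x / real (Suc n choose L)) = sqrt (1 - real L / real (Suc n)) * sqrt (x / real (n choose L))"
    if "L \<le> n" for L x
  proof -
    have "(Suc n - L) * (Suc n choose L) = Suc n * (n choose L)"
      using binomial_absorb_comp[of "Suc n" L] by simp
    then have "real (Suc n - L) * real (Suc n choose L) = real (Suc n) * real (n choose L)"
      by (metis of_nat_mult)
    moreover have "real (Suc n - L) = real (Suc n) - real L" using that by (simp add: of_nat_diff)
    ultimately have "(real (Suc n) - real L) * real (Suc n choose L) = real (Suc n) * real (n choose L)" by simp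
    moreover have "real (Suc n choose L) > 0" "real (n choose L) > 0" using that by auto
    ultimately have "1 / real (Suc n choose L) = (1 - real L / real (Suc n)) / real (n choose L)"
      by (simp add: divide_simps mult_ac del: of_nat_Suc)
    then have "x / real (Suc n choose L) = (1 - real L / real (Suc n)) * (x / real (n choose L))"
      by (metis mult.commute mult.left_commute times_divide_eq_right mult.right_neutral)
    then show ?thesis by (simp only: real_sqrt_mult)
  qed
  have r2: "sqrt (x / real (Suc n choose L)) = sqrt (real L / real (Suc n)) * sqrt (x / real (n choose (L - 1)))"
    if "L \<le> n" "0 < L" for L x
  proof -
    have "L * (Suc n choose L) = Suc n * (n choose (L - 1))"
      using Suc_times_binomial[of "L - 1" n] that by simp
    then have "real L * real (Suc n choose L) = real (Suc n) * real (n choose (L - 1))"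
      by (metis of_nat_mult)
    moreover have "real (Suc n choose L) > 0" "real (n choose (L - 1)) > 0" using that by auto
    ultimately have "1 / real (Suc n choose L) = (real L / real (Suc n)) / real (n choose (L - 1))"
      by (simp add: divide_simps mult_ac del: of_nat_Suc)
    then have "x / real (Suc n choose L) = (real L / real (Suc n)) * (x / real (n choose (L - 1)))"
      by (metis mult.commute mult.left_commute times_divide_eq_right mult.right_neutral)
    then show ?thesis by (simp only: real_sqrt_mult)
  qed
  have "hypergeometric_affinity (Suc n) (Suc a) K K' =
     (\<Sum>k\<le>a. real (a choose k) * (sqrt (real ((n - a) choose (K - k)) / real (Suc n choose K)) *
        sqrt (real ((n - a) choose (K' - k)) / real (Suc n choose K')))) +
     (\<Sum>k\<le>a. real (a choose k) * (sqrt (real ((n - a) choose (K - 1 - k)) / real (Suc n choose K)) *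
        sqrt (real ((n - a) choose (K' - 1 - k)) / real (Suc n choose K'))))"
    unfolding hypergeometric_affinity_def sum_binomial_Suc by simp
  also have "(\<Sum>k\<le>a. real (a choose k) * (sqrt (real ((n - a) choose (K - k)) / real (Suc n choose K)) *
        sqrt (real ((n - a) choose (K' - k)) / real (Suc n choose K')))) =
     sqrt ((1 - real K / real (Suc n)) * (1 - real K' / real (Suc n))) * hypergeometric_affinity n a K K'"
    unfolding hypergeometric_affinity_def sum_distrib_left r1[OF assms(3)] r1[OF assms(4)] real_sqrt_mult
    by (simp add: mult_ac)
  also have "(\<Sum>k\<le>a. real (a choose k) * (sqrt (real ((n - a) choose (K - 1 - k)) / real (Suc n choose K)) *
        sqrt (real ((n - a) choose (K' - 1 - k)) / real (Suc n choose K')))) =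
     sqrt (real K / real (Suc n) * (real K' / real (Suc n))) * hypergeometric_affinity n a (K - 1) (K' - 1)"
  proof -
    have "0 < K" "0 < K'" using assms by auto
    then show ?thesis
      unfolding hypergeometric_affinity_def sum_distrib_left r2[OF assms(3) \<open>0 < K\<close>] r2[OF assms(4) \<open>0 < K'\<close>] real_sqrt_mult
      by (simp add: mult_ac)
  qed
  finally show ?thesis .
qed

text \<open>Twice the defect of the affinity is the sum of the squared differences of the roots of
  p, q and of 1 - p, 1 - q. Each of them is at most (p - q)^2, since the roots of two numbers that
  are at least 1/4 add up to at least 1.\<close>

lemma bernoulli_affinity:
  fixes p q :: real
  assumes "1/4 \<le> p" "p \<le> 3/4" "1/4 \<le> q" "q \<le> 3/4"
  shows "1 - (p - q)\<^sup>2 \<le> sqrt ((1 - p) * (1 - q)) + sqrt (p * q)"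
proof -
  have *: "(sqrt x - sqrt y)\<^sup>2 \<le> (x - y)\<^sup>2" if "1/4 \<le> x" "1/4 \<le> y" for x y :: real
  proof -
    have "sqrt x \<ge> 1/2" "sqrt y \<ge> 1/2" by (rule real_le_rsqrt, use that in \<open>simp add: power2_eq_square\<close>)+
    then have "1 \<le> (sqrt x + sqrt y)\<^sup>2" by (intro one_le_power) linarith
    then have "(sqrt x - sqrt y)\<^sup>2 * 1 \<le> (sqrt x - sqrt y)\<^sup>2 * (sqrt x + sqrt y)\<^sup>2"
      by (intro mult_left_mono) auto
    also have "\<dots> = ((sqrt x)\<^sup>2 - (sqrt y)\<^sup>2)\<^sup>2" by (simp add: power_mult_distrib[symmetric] power2_eq_square algebra_simps)
    also have "\<dots> = (x - y)\<^sup>2" using that by simp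
    finally show ?thesis by simp
  qed
  have "(sqrt p - sqrt q)\<^sup>2 = p + q - 2 * sqrt (p * q)"
    using assms by (simp add: power2_diff real_sqrt_mult)
  moreover have "(sqrt (1 - p) - sqrt (1 - q))\<^sup>2 = 2 - p - q - 2 * sqrt ((1 - p) * (1 - q))"
    using assms by (simp add: power2_diff real_sqrt_mult)
  moreover have "((1 - p) - (1 - q))\<^sup>2 = (p - q)\<^sup>2" by (simp add: power2_eq_square algebra_simps)
  ultimately show ?thesis using *[of p q] *[of "1 - p" "1 - q"] assms by simp
qed

lemma hypergeometric_affinity_nonneg: "hypergeometric_affinity n a K K' \<ge> 0"
  unfolding hypergeometric_affinity_def by (intro sum_nonneg mult_nonneg_nonneg) auto

text \<open>A factor 1 - (D / m)^2 is lost for each draw. The slack \<open>4 * a\<close> keeps the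
  occupied fraction between 1/4 and 3/4 while \<open>a\<close> units are removed, occupied or not.
  The bound \<open>m\<close> on the remaining population survives the induction because n - a does
  not change, and neither does the difference of \<open>K\<close> and \<open>K'\<close>.\<close>

lemma hypergeometric_affinity_ge:
  fixes m D :: real
  assumes "m > 0" "m \<le> real n - real a"
    "n + 4 * a \<le> 4 * K" "n + 4 * a \<le> 4 * K'" "4 * K + 4 * a \<le> 3 * n" "4 * K' + 4 * a \<le> 3 * n"
    and D: "\<bar>real K - real K'\<bar> \<le> D"
  shows "1 - real a * (D / m)\<^sup>2 \<le> hypergeometric_affinity n a K K'"
  using assms(2-)
proof (induction a arbitrary: n K K')
  case 0
  then have "K \<le> n" "K' \<le> n" by auto
  then show ?case by (simp add: hypergeometric_affinity_def)
next
  case (Suc a n' K K')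
  then obtain n where n': "n' = Suc n" by (cases n') auto
  let ?\<theta> = "(D / m)\<^sup>2"
  let ?N = "real (Suc n)"
  show ?case
  \<comment> \<open>If the bound for \<open>a\<close> draws is negative, the claim is trivial;
    otherwise the estimate for one draw may be multiplied by it.\<close>
  proof (cases "1 - real a * ?\<theta> \<ge> 0")
    case False
    then have "1 - real (Suc a) * ?\<theta> \<le> 0" using zero_le_power2[of "D / m"] unfolding of_nat_Suc distrib_right by linarith
    then show ?thesis using hypergeometric_affinity_nonneg order_trans by blast
  next
    case True
    have m: "m \<le> real n - real a" "m \<le> ?N" using Suc.prems n' by auto
    have D: "\<bar>real K - real K'\<bar> \<le> D" "\<bar>real (K - 1) - real (K' - 1)\<bar> \<le> D"
      using Suc.prems by (auto simp: of_nat_diff)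
    have IH1: "1 - real a * ?\<theta> \<le> hypergeometric_affinity n a K K'"
      using Suc.prems n' m D by (intro Suc.IH) auto
    have IH2: "1 - real a * ?\<theta> \<le> hypergeometric_affinity n a (K - 1) (K' - 1)"
      using Suc.prems n' m D by (intro Suc.IH) auto
    let ?p = "real K / ?N" and ?q = "real K' / ?N"
    have nn: "0 \<le> sqrt ((1 - ?p) * (1 - ?q))" "0 \<le> sqrt (?p * ?q)"
      using Suc.prems n' by (auto simp: divide_simps mult_nonneg_nonneg)
    have "(?p - ?q)\<^sup>2 = (\<bar>real K - real K'\<bar> / ?N)\<^sup>2" by (simp add: power_divide diff_divide_distrib[symmetric])
    also have "\<dots> \<le> ?\<theta>" using m D \<open>m > 0\<close> by (intro power_mono frac_le) auto
    finally have "1 - ?\<theta> \<le> 1 - (?p - ?q)\<^sup>2" by simp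
    also have "\<dots> \<le> sqrt ((1 - ?p) * (1 - ?q)) + sqrt (?p * ?q)"
    proof (rule bernoulli_affinity)
      have "real (n' + 4 * Suc a) \<le> real (4 * K)" "real (n' + 4 * Suc a) \<le> real (4 * K')"
        "real (4 * K + 4 * Suc a) \<le> real (3 * n')" "real (4 * K' + 4 * Suc a) \<le> real (3 * n')"
        using Suc.prems by (simp_all only: of_nat_le_iff)
      then show "1/4 \<le> ?p" "?p \<le> 3/4" "1/4 \<le> ?q" "?q \<le> 3/4"
        unfolding n' by (simp_all add: divide_simps)
    qed
    finally have S: "1 - ?\<theta> \<le> sqrt ((1 - ?p) * (1 - ?q)) + sqrt (?p * ?q)" .
    have "1 - real (Suc a) * ?\<theta> \<le> (1 - ?\<theta>) * (1 - real a * ?\<theta>)"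
      by (simp add: algebra_simps)
    also have "\<dots> \<le> (sqrt ((1 - ?p) * (1 - ?q)) + sqrt (?p * ?q)) * (1 - real a * ?\<theta>)"
      using S True by (intro mult_right_mono) auto
    also have "\<dots> \<le> sqrt ((1 - ?p) * (1 - ?q)) * hypergeometric_affinity n a K K' + sqrt (?p * ?q) * hypergeometric_affinity n a (K - 1) (K' - 1)"
      unfolding distrib_right by (intro add_mono mult_left_mono IH1 IH2 nn)
    also have "\<dots> = hypergeometric_affinity n' (Suc a) K K'"
      unfolding n' using Suc.prems n' by (intro hypergeometric_affinity_Suc[symmetric]) auto
    finally show ?thesis .
  qed
qed

section \<open>Dicke states\<close>

text \<open>
  Occupation numbers \<open>s + m \<in> {0..2 s}\<close> replace the magnetizations \<open>m\<close>, and \<open>t\<close> stands for \<open>2 s\<close>, so that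
  all labels become natural numbers.
\<close>

definition occ1 :: "real \<Rightarrow> real \<Rightarrow> nat" where
  "occ1 s m = nat \<lfloor>s + m\<rfloor>"

definition occ :: "real \<Rightarrow> nat set \<Rightarrow> (nat \<Rightarrow> real) \<Rightarrow> nat" where
  "occ s A x = (\<Sum>j\<in>A. occ1 s (x j))"

text \<open>A spin \<open>s\<close> is the symmetric part of \<open>t\<close> spins 1/2; this counts
  the bit strings, \<open>t\<close> bits per site, with the prescribed number of ones at each site.
  Accordingly \<open>dicke\<close> is the uniform superposition of the strings with \<open>l\<close>
  ones, rewritten in symmetric site states.\<close>

definition weight :: "real \<Rightarrow> nat \<Rightarrow> nat set \<Rightarrow> (nat \<Rightarrow> real) \<Rightarrow> nat" where
  "weight s t A x = (\<Prod>j\<in>A. t choose occ1 s (x j))"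

definition dicke :: "real \<Rightarrow> nat \<Rightarrow> nat set \<Rightarrow> nat \<Rightarrow> (nat \<Rightarrow> real) \<Rightarrow> complex" where
  "dicke s t A l x = (if x \<in> configs s A \<and> occ s A x = l
     then of_real (sqrt (real (weight s t A x) / real ((t * card A) choose l))) else 0)"

lemma binomial_step: "Suc k \<le> n \<Longrightarrow> Suc k * (n choose Suc k) = (n - k) * (n choose k)"
  using Suc_times_binomial[of k "n - 1"] binomial_absorb_comp[of n k]
  by (cases n) (simp_all del: binomial_Suc_Suc)

locale spin =
  fixes s :: real and t :: nat
  assumes t: "2 * s = real t"
begin

lemma mags_iff: "m \<in> mags (s * real N) \<longleftrightarrow> (\<exists>k\<le>t * N. m = real k - s * real N)"
proof
  assume "m \<in> mags (s * real N)"
  then obtain k l where k: "s * real N + m = real k" and l: "s * real N - m = real l" by (auto simp: mags_def Nats_def)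
  have "real k + real l = 2 * s * real N" using k l by simp
  then have "real (k + l) = real (t * N)" using t by simp
  then have "k + l = t * N" by (simp only: of_nat_eq_iff)
  then show "\<exists>k\<le>t * N. m = real k - s * real N" using k by (intro exI[of _ k]) auto
next
  assume "\<exists>k\<le>t * N. m = real k - s * real N"
  then obtain k where k: "k \<le> t * N" "m = real k - s * real N" by blast
  have "2 * s * real N = real (t * N)" using t by simp
  then have "s * real N + m = real k" "s * real N - m = real (t * N - k)" using k by (auto simp: of_nat_diff)
  then show "m \<in> mags (s * real N)" by (simp add: mags_def)
qed

lemma mags_site: "m \<in> mags s \<longleftrightarrow> (\<exists>k\<le>t. m = real k - s)"
  using mags_iff[of m 1] by simp

lemma mags_image: "mags s = (\<lambda>k. real k - s) ` {..t}"
  using mags_site by auto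

lemma occ1_shift [simp]: "occ1 s (real k - s) = k"
  by (simp add: occ1_def)

lemma occ1_le: "m \<in> mags s \<Longrightarrow> occ1 s m \<le> t" and occ1_real: "m \<in> mags s \<Longrightarrow> real (occ1 s m) = s + m"
  by (auto simp: mags_site)

lemma finite_configs: "finite A \<Longrightarrow> finite (configs s A)"
  unfolding configs_def mags_image by (intro finite_PiE) auto

lemma sum_configs_insert:
  assumes "finite A" "j \<notin> A"
  shows "(\<Sum>x\<in>configs s (insert j A). f x) = (\<Sum>k\<le>t. \<Sum>y\<in>configs s A. f (y(j := real k - s)))"
proof -
  have "(\<Sum>x\<in>configs s (insert j A). f x) = (\<Sum>(m, y)\<in>mags s \<times> configs s A. f (y(j := m)))"
    unfolding configs_def PiE_insert_eq
    by (subst sum.reindex[OF inj_combinator[OF assms(2)]]) (simp add: case_prod_beta)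
  also have "\<dots> = (\<Sum>m\<in>mags s. \<Sum>y\<in>configs s A. f (y(j := m)))"
    by (simp add: sum.cartesian_product)
  also have "\<dots> = (\<Sum>k\<le>t. \<Sum>y\<in>configs s A. f (y(j := real k - s)))"
    unfolding mags_image by (subst sum.reindex) (auto simp: inj_on_def)
  finally show ?thesis .
qed

text \<open>Vandermonde's convolution, one site at a time. It normalizes the Dicke states and is the
  source of the binomials in the hypergeometric law.\<close>

lemma sum_weight:
  assumes "finite A"
  shows "(\<Sum>x\<in>configs s A. if occ s A x = l then weight s t A x else 0) = (t * card A) choose l"
  using assms
proof (induction A arbitrary: l rule: finite_induct)
  case empty
  then show ?case by (cases l) (simp_all add: configs_def occ_def weight_def)
next
  case (insert j A)
  have upd: "occ s (insert j A) (y(j := real k - s)) = k + occ s A y"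
    "weight s t (insert j A) (y(j := real k - s)) = (t choose k) * weight s t A y" for y k
  proof -
    have "(\<Sum>i\<in>A. occ1 s ((y(j := real k - s)) i)) = occ s A y"
      unfolding occ_def by (intro sum.cong) (use insert in auto)
    then show "occ s (insert j A) (y(j := real k - s)) = k + occ s A y"
      using insert by (simp add: occ_def)
    have "(\<Prod>i\<in>A. t choose occ1 s ((y(j := real k - s)) i)) = weight s t A y"
      unfolding weight_def by (intro prod.cong) (use insert in auto)
    then show "weight s t (insert j A) (y(j := real k - s)) = (t choose k) * weight s t A y"
      using insert by (simp add: weight_def)
  qed
  have "(\<Sum>x\<in>configs s (insert j A). if occ s (insert j A) x = l then weight s t (insert j A) x else 0)
      = (\<Sum>k\<le>t. (t choose k) * (if k \<le> l then (t * card A) choose (l - k) else 0))"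
    unfolding sum_configs_insert[OF insert(1,2)] upd
  proof (intro sum.cong refl)
    fix k
    show "(\<Sum>y\<in>configs s A. if k + occ s A y = l then (t choose k) * weight s t A y else 0)
      = (t choose k) * (if k \<le> l then (t * card A) choose (l - k) else 0)"
    proof (cases "k \<le> l")
      case True
      then show ?thesis unfolding insert.IH[symmetric] sum_distrib_left if_P[OF True]
        by (intro sum.cong) auto
    qed (auto intro: sum.neutral)
  qed
  \<comment> \<open>Terms beyond \<open>t\<close> vanish with \<open>t choose k\<close> and terms
    beyond \<open>l\<close> by the conditional, so the range passes from \<open>t\<close> to
    \<open>l\<close> through the maximum.\<close>
  also have "\<dots> = (\<Sum>k\<le>max t l. (t choose k) * (if k \<le> l then (t * card A) choose (l - k) else 0))"
    by (intro sum.mono_neutral_left) (auto simp: binomial_eq_0)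
  also have "\<dots> = (\<Sum>k\<le>l. (t choose k) * ((t * card A) choose (l - k)))"
    by (intro sum.mono_neutral_cong_right) auto
  also have "\<dots> = (t * card (insert j A)) choose l"
    using insert by (simp add: vandermonde)
  finally show ?case .
qed

lemma occ_le: "finite A \<Longrightarrow> x \<in> configs s A \<Longrightarrow> occ s A x \<le> t * card A"
  unfolding occ_def using sum_bounded_above[of A "\<lambda>j. occ1 s (x j)" t]
  by (auto simp: configs_def PiE_iff occ1_le mult.commute)

lemma sum_weight_occ:
  fixes g :: "nat \<Rightarrow> real"
  assumes "finite A"
  shows "(\<Sum>x\<in>configs s A. real (weight s t A x) * g (occ s A x)) =
    (\<Sum>k\<le>t * card A. real ((t * card A) choose k) * g k)"
proof -
  have "(\<Sum>x\<in>configs s A. real (weight s t A x) * g (occ s A x)) =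
    (\<Sum>x\<in>configs s A. \<Sum>k\<le>t * card A. if k = occ s A x then real (weight s t A x) * g k else 0)"
    using occ_le[OF assms] by (intro sum.cong refl) (simp add: sum.delta)
  also have "\<dots> = (\<Sum>k\<le>t * card A. real (\<Sum>x\<in>configs s A. if occ s A x = k then weight s t A x else 0) * g k)"
    unfolding of_nat_sum sum_distrib_right by (subst sum.swap) (intro sum.cong refl, auto)
  finally show ?thesis by (simp add: sum_weight[OF assms])
qed

lemma dicke_vecs: "dicke s t A l \<in> vecs (configs s A)"
  by (auto simp: vecs_def dicke_def)

lemma dicke_inner:
  assumes A: "finite A" and "l \<le> t * card A"
  shows "vinner (configs s A) (dicke s t A l) (dicke s t A l') = (if l = l' then 1 else 0)"
proof (cases "l = l'")
  case True
  let ?C = "(t * card A) choose l"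
  have "vinner (configs s A) (dicke s t A l) (dicke s t A l) =
     of_real (\<Sum>x\<in>configs s A. (cmod (dicke s t A l x))\<^sup>2)" by (rule vinner_self)
  also have "(\<Sum>x\<in>configs s A. (cmod (dicke s t A l x))\<^sup>2) =
     (\<Sum>x\<in>configs s A. real (if occ s A x = l then weight s t A x else 0) / real ?C)"
    by (intro sum.cong refl) (auto simp: dicke_def)
  also have "\<dots> = real (\<Sum>x\<in>configs s A. if occ s A x = l then weight s t A x else 0) / real ?C"
    by (simp only: of_nat_sum sum_divide_distrib)
  also have "\<dots> = 1" unfolding sum_weight[OF A] using assms(2) by simp
  finally show ?thesis using True by simp
next
  case False
  then show ?thesis by (auto simp: vinner_def dicke_def intro!: sum.neutral)
qed

section \<open>The total spin operators in the product basis\<close>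

lemma configs_upd: "x \<in> configs s A \<Longrightarrow> j \<in> A \<Longrightarrow> m \<in> mags s \<Longrightarrow> x(j := m) \<in> configs s A"
  by (auto simp: configs_def PiE_iff extensional_def)

lemma total_op_apply:
  "mapply I (total_op s N q) v x = (\<Sum>j<N. \<Sum>y\<in>I. site_op s N j q x y * v y)"
  unfolding mapply_def total_op_def sum_distrib_right by (rule sum.swap)

lemma site_op_apply:
  assumes x: "x \<in> configs s {..<N}" and j: "j < N"
  shows "(\<Sum>y\<in>configs s {..<N}. site_op s N j q x y * v y) = (\<Sum>m\<in>mags s. q (x j) m * v (x(j := m)))"
proof -
  let ?I = "configs s {..<N}"
  let ?S = "(\<lambda>m. x(j := m)) ` mags s"
  have S: "?S \<subseteq> ?I" using configs_upd[OF x] j by auto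
  have "(\<Sum>y\<in>?I. site_op s N j q x y * v y) = (\<Sum>y\<in>?S. site_op s N j q x y * v y)"
  proof (rule sum.mono_neutral_right[OF _ S])
    show "\<forall>y\<in>?I - ?S. site_op s N j q x y * v y = 0"
    proof
      fix y assume y: "y \<in> ?I - ?S"
      have "\<not> (\<forall>i. i \<noteq> j \<longrightarrow> x i = y i)"
      proof
        assume "\<forall>i. i \<noteq> j \<longrightarrow> x i = y i"
        then have "y = x(j := y j)" by auto
        moreover have "y j \<in> mags s" using y j by (auto simp: configs_def PiE_iff)
        ultimately show False using y by blast
      qed
      then show "site_op s N j q x y * v y = 0" by (auto simp: site_op_def)
    qed
  qed (simp add: finite_configs)
  also have "\<dots> = (\<Sum>m\<in>mags s. site_op s N j q x (x(j := m)) * v (x(j := m)))"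
    by (subst sum.reindex) (auto simp: inj_on_def dest: fun_upd_eqD)
  also have "\<dots> = (\<Sum>m\<in>mags s. q (x j) m * v (x(j := m)))"
    using x S by (intro sum.cong refl) (auto simp: site_op_def)
  finally show ?thesis .
qed

lemma total_z_apply:
  assumes x: "x \<in> configs s {..<N}"
  shows "mapply (configs s {..<N}) (total_op s N spin_z) v x = of_real (real (occ s {..<N} x) - s * real N) * v x"
proof -
  have xj: "x j \<in> mags s" if "j < N" for j using x that by (auto simp: configs_def PiE_iff)
  have fin: "finite (mags s)" by (simp add: mags_image)
  have "mapply (configs s {..<N}) (total_op s N spin_z) v x = (\<Sum>j<N. of_real (x j) * v x)"
    unfolding total_op_apply using xj fin
    by (intro sum.cong refl) (simp add: site_op_apply[OF x] spin_z_def if_distrib[of "\<lambda>x. x * _"] cong: if_cong)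
  also have "\<dots> = of_real (\<Sum>j<N. x j) * v x" by (simp add: sum_distrib_right)
  also have "(\<Sum>j<N. x j) = (\<Sum>j<N. real (occ1 s (x j)) - s)" using xj by (intro sum.cong refl) (simp add: occ1_real)
  also have "\<dots> = real (occ s {..<N} x) - s * real N" by (simp add: sum_subtractf occ_def)
  finally show ?thesis .
qed

lemma total_minus_apply:
  assumes x: "x \<in> configs s {..<N}"
  shows "mapply (configs s {..<N}) (total_op s N (spin_minus s)) v x =
    (\<Sum>j<N. of_real (sqrt (real (occ1 s (x j) + 1) * real (t - occ1 s (x j)))) * v (x(j := x j + 1)))"
  unfolding total_op_apply
proof (intro sum.cong refl)
  fix j assume "j \<in> {..<N}"
  then have j: "j < N" by simp
  then have "x j \<in> mags s" using x by (auto simp: configs_def PiE_iff)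
  then obtain k where k: "k \<le> t" "x j = real k - s" by (auto simp: mags_site)
  have fin: "finite (mags s)" by (simp add: mags_image)
  have "(\<Sum>y\<in>configs s {..<N}. site_op s N j (spin_minus s) x y * v y) =
     (\<Sum>m\<in>mags s. if m = x j + 1 then of_real (sqrt ((s + m) * (s - m + 1))) * v (x(j := m)) else 0)"
    unfolding site_op_apply[OF x j] by (intro sum.cong refl) (auto simp: spin_minus_def)
  also have "\<dots> = (if x j + 1 \<in> mags s then of_real (sqrt ((s + (x j + 1)) * (s - (x j + 1) + 1))) * v (x(j := x j + 1)) else 0)"
    using fin by (simp add: sum.delta)
  also have "\<dots> = of_real (sqrt (real (k + 1) * real (t - k))) * v (x(j := x j + 1))"
  proof (cases "k < t")
    case True
    then have "x j + 1 \<in> mags s" using k by (auto simp: mags_site intro!: exI[of _ "k + 1"])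
    moreover have "s - (x j + 1) + 1 = real (t - k)" using k t by (simp add: of_nat_diff)
    moreover have "s + (x j + 1) = real (k + 1)" using k by simp
    ultimately show ?thesis by simp
  next
    \<comment> \<open>Raising a full site leaves the label set, so the left side has no term; the
      right side vanishes through the factor \<open>t - k\<close>, whatever the value of
      \<open>v\<close> there.\<close>
    case False
    then have "\<not> x j + 1 \<in> mags s" using k t by (auto simp: mags_site)
    then show ?thesis using False k by simp
  qed
  finally show "(\<Sum>y\<in>configs s {..<N}. site_op s N j (spin_minus s) x y * v y) =
     of_real (sqrt (real (occ1 s (x j) + 1) * real (t - occ1 s (x j)))) * v (x(j := x j + 1))"
    using k by simp
qed

lemma raise_site:
  assumes x: "x \<in> configs s A" and j: "j \<in> A" and A: "finite A" and lt: "occ1 s (x j) < t"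
  shows "x(j := x j + 1) \<in> configs s A"
    and "occ s A (x(j := x j + 1)) = occ s A x + 1"
    and "(occ1 s (x j) + 1) * weight s t A (x(j := x j + 1)) = (t - occ1 s (x j)) * weight s t A x"
proof -
  have "x j \<in> mags s" using x j by (auto simp: configs_def PiE_iff)
  then obtain k where k: "k \<le> t" "x j = real k - s" by (auto simp: mags_site)
  have k': "x j + 1 = real (Suc k) - s" using k by simp
  have lt: "k < t" using lt k by simp
  have "x j + 1 \<in> mags s" unfolding mags_site k' using lt by (intro exI[of _ "Suc k"]) auto
  then show "x(j := x j + 1) \<in> configs s A" by (rule configs_upd[OF x j])
  have o: "occ1 s ((x(j := x j + 1)) j) = Suc k" "occ1 s (x j) = k"
    unfolding fun_upd_same k' using k by (simp_all only: occ1_shift)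
  have "occ s (A - {j}) (x(j := x j + 1)) = occ s (A - {j}) x"
    unfolding occ_def by (intro sum.cong) auto
  moreover have "occ s A z = occ1 s (z j) + occ s (A - {j}) z" for z
    unfolding occ_def using sum.remove[OF A j] by blast
  ultimately show "occ s A (x(j := x j + 1)) = occ s A x + 1" using o by simp
  have "weight s t (A - {j}) (x(j := x j + 1)) = weight s t (A - {j}) x"
    unfolding weight_def by (intro prod.cong) auto
  moreover have w: "weight s t A z = (t choose occ1 s (z j)) * weight s t (A - {j}) z" for z
    unfolding weight_def using prod.remove[OF A j] by blast
  moreover have "(k + 1) * (t choose Suc k) = (t - k) * (t choose k)"
    using binomial_step[of k t] lt by simp
  ultimately show "(occ1 s (x j) + 1) * weight s t A (x(j := x j + 1)) = (t - occ1 s (x j)) * weight s t A x"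
    unfolding w[of "x(j := x j + 1)"] w[of x] o by (metis Suc_eq_plus1 mult.assoc)
qed

text \<open>A configuration that is lowered to x has one site raised, and its amplitude times the
  matrix element is t minus the occupation of that site, times a factor common to all sites. These
  differences sum to t N - K for every x of occupation K, which is why the result is again
  proportional to a Dicke state.\<close>

lemma total_minus_dicke:
  assumes x: "x \<in> configs s {..<N}" and K: "Suc K \<le> t * N"
  shows "mapply (configs s {..<N}) (total_op s N (spin_minus s)) (dicke s t {..<N} (Suc K)) x =
     of_real (sqrt (real (Suc K) * real (t * N - K))) * dicke s t {..<N} K x"
proof (cases "occ s {..<N} x = K")
  case False
  have "dicke s t {..<N} (Suc K) (x(j := x j + 1)) = 0" if "j < N" "occ1 s (x j) < t" for j
    using raise_site[OF x _ _ that(2)] that False by (simp add: dicke_def)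
  then have "mapply (configs s {..<N}) (total_op s N (spin_minus s)) (dicke s t {..<N} (Suc K)) x = 0"
    unfolding total_minus_apply[OF x] by (intro sum.neutral ballI) (metis diff_is_0_eq lessThan_iff linorder_not_less mult_zero_right mult_zero_left of_nat_0 of_real_0 real_sqrt_zero)
  then show ?thesis using False by (simp add: dicke_def)
next
  case True
  let ?W = "real (weight s t {..<N} x)"
  let ?C = "\<lambda>l. real ((t * N) choose l)"
  have xj: "x j \<in> mags s" if "j < N" for j using x that by (auto simp: configs_def PiE_iff)
  have "of_real (sqrt (real (occ1 s (x j) + 1) * real (t - occ1 s (x j)))) * dicke s t {..<N} (Suc K) (x(j := x j + 1))
      = complex_of_real (real (t - occ1 s (x j)) * sqrt (?W / ?C (Suc K)))" if j: "j < N" for j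
  proof (cases "occ1 s (x j) < t")
    case False
    then show ?thesis by simp
  next
    case lt: True
    let ?k = "occ1 s (x j)"
    let ?x = "x(j := x j + 1)"
    have d: "dicke s t {..<N} (Suc K) ?x = of_real (sqrt (real (weight s t {..<N} ?x) / ?C (Suc K)))"
      using raise_site[OF x _ _ lt] j True by (simp add: dicke_def)
    have "real (?k + 1) * real (t - ?k) * (real (weight s t {..<N} ?x) / ?C (Suc K))
        = real (t - ?k) * real ((?k + 1) * weight s t {..<N} ?x) / ?C (Suc K)"
      by (simp only: of_nat_mult times_divide_eq_right mult_ac)
    also have "\<dots> = (real (t - ?k))\<^sup>2 * (?W / ?C (Suc K))"
      using raise_site(3)[OF x _ _ lt] j by (simp add: power2_eq_square)
    finally have "sqrt (real (?k + 1) * real (t - ?k) * (real (weight s t {..<N} ?x) / ?C (Suc K))) =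
        real (t - ?k) * sqrt (?W / ?C (Suc K))"
      by (simp only: real_sqrt_mult) simp
    then show ?thesis unfolding d of_real_mult[symmetric] real_sqrt_mult[symmetric] by simp
  qed
  then have "mapply (configs s {..<N}) (total_op s N (spin_minus s)) (dicke s t {..<N} (Suc K)) x =
      (\<Sum>j<N. complex_of_real (real (t - occ1 s (x j)) * sqrt (?W / ?C (Suc K))))"
    unfolding total_minus_apply[OF x] by (intro sum.cong refl) auto
  also have "\<dots> = of_real (real (\<Sum>j<N. t - occ1 s (x j)) * sqrt (?W / ?C (Suc K)))"
    by (simp add: sum_distrib_right)
  also have "(\<Sum>j<N. t - occ1 s (x j)) = t * N - K"
  proof -
    have "(\<Sum>j<N. t - occ1 s (x j)) = (\<Sum>j<N. t) - (\<Sum>j<N. occ1 s (x j))"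
      using xj occ1_le by (intro sum_subtractf_nat) auto
    then show ?thesis using True by (simp add: occ_def mult.commute)
  qed
  also have "real (t * N - K) * sqrt (?W / ?C (Suc K)) = sqrt (real (Suc K) * real (t * N - K)) * sqrt (?W / ?C K)"
  proof -
    have "Suc K * ((t * N) choose Suc K) = (t * N - K) * ((t * N) choose K)"
      by (rule binomial_step[OF K])
    then have "real (Suc K) * ?C (Suc K) = real (t * N - K) * ?C K" by (metis of_nat_mult)
    moreover have "?C K > 0" "?C (Suc K) > 0" "real (t * N - K) > 0" using K by (auto simp del: of_nat_diff of_nat_mult)
    ultimately have "(real (t * N - K))\<^sup>2 * (?W / ?C (Suc K)) = real (Suc K) * real (t * N - K) * (?W / ?C K)"
      by (simp add: divide_simps power2_eq_square mult_ac del: of_nat_Suc)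
    then have "sqrt ((real (t * N - K))\<^sup>2 * (?W / ?C (Suc K))) = sqrt (real (Suc K) * real (t * N - K) * (?W / ?C K))"
      by simp
    then show ?thesis by (simp only: real_sqrt_mult) simp
  qed
  also have "complex_of_real (sqrt (real (Suc K) * real (t * N - K)) * sqrt (?W / ?C K)) =
      of_real (sqrt (real (Suc K) * real (t * N - K))) * dicke s t {..<N} K x"
    using True x by (simp only: dicke_def of_real_mult card_lessThan simp_thms if_True)
  finally show ?thesis .
qed

text \<open>The weight space of M = J is spanned by the fully occupied configuration, which fixes
  the top state up to a phase. The lowering coefficients prescribed for the multiplet coincide with
  those of the Dicke states and do not vanish above the bottom, so the same phase is carried
  down.\<close>

lemma max_spin_basis_dicke:
  assumes ket: "max_spin_basis s N ket"
  shows "\<exists>g. cmod g = 1 \<and> (\<forall>K\<le>t * N. ket (real K - s * real N) = (\<lambda>x. g * dicke s t {..<N} K x))"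
proof -
  let ?I = "configs s {..<N}" and ?J = "s * real N"
  have J: "real (t * N) = 2 * ?J" using t by simp
  have vec: "ket M \<in> vecs ?I"
    and norm: "vinner ?I (ket M) (ket M) = 1"
    and z: "mapply ?I (total_op s N spin_z) (ket M) = (\<lambda>x. complex_of_real M * ket M x)"
    and minus: "mapply ?I (total_op s N (spin_minus s)) (ket M) =
           (\<lambda>x. complex_of_real (sqrt ((?J + M) * (?J - M + 1))) * ket (M - 1) x)"
    if "M \<in> mags ?J" for M
    using ket that unfolding max_spin_basis_def Let_def by auto
  have mags: "real K - ?J \<in> mags ?J" if "K \<le> t * N" for K using that mags_iff by blast
  have J': "real (t * N) - ?J = ?J" using J by linarith
  have top_mag: "?J \<in> mags ?J" using mags[of "t * N"] unfolding J' by simp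
  define top where "top = (\<lambda>j\<in>{..<N}. s)"
  have s_mag: "s \<in> mags s" unfolding mags_site using t by (intro exI[of _ t]) auto
  have occ1_s: "occ1 s s = t" using t by (simp add: occ1_def)
  have top: "top \<in> ?I" using s_mag by (auto simp: top_def configs_def)
  have occ_top: "occ s {..<N} x = t * N \<longleftrightarrow> x = top" if x: "x \<in> ?I" for x
  proof
    assume *: "occ s {..<N} x = t * N"
    have xj: "x j \<in> mags s" if "j < N" for j using x that by (auto simp: configs_def PiE_iff)
    have "(\<Sum>j<N. t - occ1 s (x j)) = (\<Sum>j<N. t) - (\<Sum>j<N. occ1 s (x j))"
      using xj occ1_le by (intro sum_subtractf_nat) auto
    then have "(\<Sum>j<N. t - occ1 s (x j)) = 0" using * by (simp add: occ_def mult.commute)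
    then have "occ1 s (x j) = t" if "j < N" for j using that occ1_le[OF xj[OF that]] by (simp add: le_antisym)
    then have "x j = s" if "j < N" for j using occ1_real[OF xj[OF that]] t that by simp
    then show "x = top" using x by (auto simp: top_def configs_def PiE_iff extensional_def fun_eq_iff)
  next
    assume "x = top"
    then show "occ s {..<N} x = t * N" by (simp add: occ_def top_def occ1_s)
  qed
  define g where "g = ket ?J top"
  have base: "ket ?J = (\<lambda>x. g * dicke s t {..<N} (t * N) x)"
  proof
    fix x
    show "ket ?J x = g * dicke s t {..<N} (t * N) x"
    proof (cases "x \<in> ?I")
      case False
      then show ?thesis using vecs_eq_0[OF vec[OF top_mag]] vecs_eq_0[OF dicke_vecs] by simp
    next
      case x: True
      show ?thesis
      proof (cases "x = top")
        case True
        have "weight s t {..<N} top = 1" by (simp add: weight_def top_def occ1_s)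
        then have "dicke s t {..<N} (t * N) top = 1" using top occ_top[OF top] by (simp add: dicke_def)
        then show ?thesis using True by (simp add: g_def)
      next
        case False
        then have ne: "occ s {..<N} x \<noteq> t * N" using occ_top[OF x] by simp
        have "complex_of_real (real (occ s {..<N} x) - ?J) * ket ?J x = complex_of_real ?J * ket ?J x"
          using fun_cong[OF z[OF top_mag], of x] unfolding total_z_apply[OF x] .
        moreover have "real (occ s {..<N} x) - ?J \<noteq> ?J" using ne J by (metis add_diff_cancel_right' diff_add_cancel mult_2 of_nat_eq_iff)
        ultimately have "ket ?J x = 0" using of_real_eq_iff mult_right_cancel by blast
        then show ?thesis using ne by (simp add: dicke_def)
      qed
    qed
  qed
  have "vinner ?I (ket ?J) (ket ?J) = of_real ((cmod g)\<^sup>2) * vinner ?I (dicke s t {..<N} (t * N)) (dicke s t {..<N} (t * N))"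
    unfolding base complex_norm_square by (simp add: vinner_def sum_distrib_left mult_ac)
  then have "complex_of_real ((cmod g)\<^sup>2) = 1"
    using norm[OF top_mag] dicke_inner[of "{..<N}" "t * N" "t * N"] by simp
  then have "(cmod g)\<^sup>2 = 1" by (simp only: of_real_eq_1_iff)
  then have g: "cmod g = 1" using power2_eq_iff_nonneg[of "cmod g" 1] by simp
  \<comment> \<open>Here \<open>i\<close> counts the lowering steps from the top.\<close>
  have "ket (real (t * N - i) - ?J) = (\<lambda>x. g * dicke s t {..<N} (t * N - i) x)" if "i \<le> t * N" for i
    using that
  proof (induction i)
    case 0
    then show ?case using base unfolding diff_zero J' by simp
  next
    case (Suc i)
    define K where "K = t * N - Suc i"
    have K: "Suc K = t * N - i" "Suc K \<le> t * N" using Suc.prems by (auto simp: K_def)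
    let ?M = "real (Suc K) - ?J"
    have M: "?M \<in> mags ?J" by (rule mags[OF K(2)])
    have IH: "ket ?M = (\<lambda>x. g * dicke s t {..<N} (Suc K) x)" using Suc K by simp
    have M1: "?M - 1 = real K - ?J" by simp
    have co: "(?J + ?M) * (?J - ?M + 1) = real (Suc K) * real (t * N - K)"
      using K(2) t by (simp add: of_nat_diff)
    have pos: "real (Suc K) * real (t * N - K) > 0" using K(2) by (intro mult_pos_pos) (auto simp del: of_nat_diff of_nat_mult)
    have "ket (real K - ?J) x = g * dicke s t {..<N} K x" for x
    proof (cases "x \<in> ?I")
      case False
      have "K \<le> t * N" using K by simp
      then show ?thesis using False vecs_eq_0[OF vec[OF mags]] vecs_eq_0[OF dicke_vecs] by simp
    next
      case x: True
      have lin: "mapply ?I A (\<lambda>x. g * v x) x = g * mapply ?I A v x" for A v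
        by (simp add: mapply_def sum_distrib_left mult_ac)
      define c where "c = complex_of_real (sqrt (real (Suc K) * real (t * N - K)))"
      have "c * ket (real K - ?J) x = g * (c * dicke s t {..<N} K x)"
        using fun_cong[OF minus[OF M], of x]
        unfolding co M1 IH lin total_minus_dicke[OF x K(2)] c_def[symmetric] by (rule sym)
      then have "c * ket (real K - ?J) x = c * (g * dicke s t {..<N} K x)" by (simp only: mult.left_commute)
      moreover have "c \<noteq> 0" unfolding c_def using pos by (simp only: of_real_eq_0_iff real_sqrt_eq_0_iff)
      ultimately show ?thesis by (metis mult_left_cancel)
    qed
    then show ?case unfolding K_def by (rule ext)
  qed
  then have "ket (real K - ?J) = (\<lambda>x. g * dicke s t {..<N} K x)" if "K \<le> t * N" for K
    using that by (metis diff_diff_cancel diff_le_self)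
  then show ?thesis using g by blast
qed

section \<open>Dicke states split into lost and remaining sites\<close>

lemma override_configs:
  assumes "\<alpha> \<subseteq> {..<N}" "y \<in> configs s ({..<N} - \<alpha>)" "z \<in> configs s \<alpha>"
  shows "override_on y z \<alpha> \<in> configs s {..<N}"
  using assms by (auto simp: configs_def PiE_iff extensional_def override_on_def)

text \<open>Weights multiply and occupations add over the two parts. The coefficient squared is the
  probability of finding z on the lost sites when the remaining state is normalized.\<close>

lemma dicke_override:
  assumes \<alpha>: "\<alpha> \<subseteq> {..<N}" and y: "y \<in> configs s ({..<N} - \<alpha>)" and z: "z \<in> configs s \<alpha>"
    and K: "occ s \<alpha> z \<le> K"
  shows "dicke s t {..<N} K (override_on y z \<alpha>) =
    of_real (sqrt (real (weight s t \<alpha> z)) *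
       sqrt (real ((t * N - t * card \<alpha>) choose (K - occ s \<alpha> z)) / real ((t * N) choose K)))
    * dicke s t ({..<N} - \<alpha>) (K - occ s \<alpha> z) y"
proof -
  let ?\<beta> = "{..<N} - \<alpha>"
  let ?x = "override_on y z \<alpha>"
  let ?C = "real ((t * N - t * card \<alpha>) choose (K - occ s \<alpha> z))"
  have fin: "finite \<alpha>" "finite ?\<beta>" using \<alpha> finite_subset by auto
  have N: "{..<N} = ?\<beta> \<union> \<alpha>" "?\<beta> \<inter> \<alpha> = {}" using \<alpha> by auto
  have card: "t * card ?\<beta> = t * N - t * card \<alpha>"
    using \<alpha> fin by (simp add: card_Diff_subset diff_mult_distrib2)
  have "occ s ?\<beta> ?x = occ s ?\<beta> y" "occ s \<alpha> ?x = occ s \<alpha> z"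
    unfolding occ_def by (intro sum.cong; simp add: override_on_def)+
  then have occ: "occ s {..<N} ?x = occ s ?\<beta> y + occ s \<alpha> z"
    unfolding occ_def using sum.union_disjoint[OF fin(2,1) N(2)] N(1) by metis
  have "weight s t ?\<beta> ?x = weight s t ?\<beta> y" "weight s t \<alpha> ?x = weight s t \<alpha> z"
    unfolding weight_def by (intro prod.cong; simp add: override_on_def)+
  then have w: "weight s t {..<N} ?x = weight s t ?\<beta> y * weight s t \<alpha> z"
    unfolding weight_def using prod.union_disjoint[OF fin(2,1) N(2)] N(1) by metis
  show ?thesis
  proof (cases "occ s ?\<beta> y = K - occ s \<alpha> z")
    case False
    then show ?thesis using occ K by (auto simp: dicke_def)
  next
    case True
    then have "K - occ s \<alpha> z \<le> t * card ?\<beta>" using occ_le[OF fin(2) y] by simp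
    then have C: "?C > 0" unfolding card by simp
    have "sqrt (real (weight s t \<alpha> z) * (?C / real ((t * N) choose K)) * (real (weight s t ?\<beta> y) / ?C))
       = sqrt (real (weight s t ?\<beta> y * weight s t \<alpha> z) / real ((t * N) choose K))"
      using C by simp
    then have "sqrt (real (weight s t \<alpha> z)) * sqrt (?C / real ((t * N) choose K)) * sqrt (real (weight s t ?\<beta> y) / ?C)
       = sqrt (real (weight s t ?\<beta> y * weight s t \<alpha> z) / real ((t * N) choose K))"
      by (simp only: real_sqrt_mult)
    moreover have "occ s {..<N} ?x = K" using True occ K by simp
    ultimately show ?thesis using True y override_configs[OF \<alpha> y z]
      by (simp only: dicke_def w card lessThan_iff finite_lessThan card_lessThan simp_thms if_True of_real_mult[symmetric])
  qed
qed

end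

section \<open>Recovery from erasures\<close>

lemma mapply_scale: "mapply I A (\<lambda>i. c * v i) = (\<lambda>i. c * mapply I A v i)"
  by (simp add: mapply_def sum_distrib_left mult_ac)

lemma mapply_sum_right: "mapply I A (\<lambda>i. \<Sum>q\<in>Q. w q i) = (\<lambda>k. \<Sum>q\<in>Q. mapply I A (w q) k)"
  unfolding mapply_def sum_distrib_left by (intro ext sum.swap)

lemma vinner_scale_right: "vinner I u (\<lambda>i. c * v i) = c * vinner I u v"
  by (simp add: vinner_def sum_distrib_left mult_ac)

lemma sum_fun_apply: "(\<Sum>x\<in>A. f x) i = (\<Sum>x\<in>A. f x i)"
  by (induction A rule: infinite_finite_induct) auto

text \<open>
  The recovery maps \<open>\<eta> e i\<close> to \<open>u i\<close> and sends the orthogonal complement of all \<open>\<eta> e i\<close>, which the noise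
  never reaches from the code, to the fixed state \<open>u i0\<close>.
\<close>

lemma recovery_channel:
  fixes \<eta> :: "'e \<Rightarrow> 'i \<Rightarrow> 'o \<Rightarrow> complex" and u :: "'i \<Rightarrow> 'l \<Rightarrow> complex"
  assumes fin: "finite K" "finite L" "finite E" "finite I"
    and \<eta>: "\<And>e i. e \<in> E \<Longrightarrow> i \<in> I \<Longrightarrow> \<eta> e i \<in> vecs K"
    and ortho: "\<And>e i e' i'. e \<in> E \<Longrightarrow> i \<in> I \<Longrightarrow> e' \<in> E \<Longrightarrow> i' \<in> I \<Longrightarrow>
      vinner K (\<eta> e i) (\<eta> e' i') = (if e = e' \<and> i = i' then 1 else 0)"
    and u: "\<And>i. i \<in> I \<Longrightarrow> u i \<in> vecs L"
    and u_ortho: "\<And>i i'. i \<in> I \<Longrightarrow> i' \<in> I \<Longrightarrow> vinner L (u i) (u i') = (if i = i' then 1 else 0)"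
    and i0: "i0 \<in> I"
  shows "\<exists>A. channel K L (kraus (E <+> K) K A) \<and> (\<forall>r\<in>E <+> K. A r \<in> mats L K) \<and>
    (\<forall>e\<in>E. A (Inl e) = (\<lambda>l w. \<Sum>i\<in>I. u i l * cnj (\<eta> e i w)))"
proof -
  define J where "J = E \<times> I"
  define h where "h = (\<lambda>(e, i). \<eta> e i)"
  have J: "finite J" using fin by (simp add: J_def)
  have h: "h j \<in> vecs K" if "j \<in> J" for j using that \<eta> by (auto simp: J_def h_def)
  have h_ortho: "vinner K (h j) (h j') = (if j = j' then 1 else 0)" if "j \<in> J" "j' \<in> J" for j j'
    using that by (cases j; cases j') (simp add: J_def h_def ortho)
  define Q where "Q = (\<lambda>w y. \<Sum>j\<in>J. h j w * cnj (h j y))"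
  define P where "P = (\<lambda>w y. mone K w y - Q w y)"
  have Q_mats: "Q w y = 0" if "w \<notin> K \<or> y \<notin> K" for w y
    unfolding Q_def using that vecs_eq_0[OF h] by (intro sum.neutral) auto
  have P_mats: "P \<in> mats K K" using Q_mats by (auto simp: P_def mats_def mone_def split: if_splits)
  have QQ: "mmul K Q Q = Q"
  proof (intro ext)
    fix w y
    have "mmul K Q Q w y = (\<Sum>k\<in>K. \<Sum>j\<in>J. \<Sum>j'\<in>J. h j w * cnj (h j' y) * (cnj (h j k) * h j' k))"
      unfolding mmul_def Q_def sum_product by (simp add: mult_ac)
    also have "\<dots> = (\<Sum>j\<in>J. \<Sum>k\<in>K. \<Sum>j'\<in>J. h j w * cnj (h j' y) * (cnj (h j k) * h j' k))"
      by (rule sum.swap)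
    also have "\<dots> = (\<Sum>j\<in>J. \<Sum>j'\<in>J. \<Sum>k\<in>K. h j w * cnj (h j' y) * (cnj (h j k) * h j' k))"
      by (rule sum.cong[OF refl], rule sum.swap)
    also have "\<dots> = (\<Sum>j\<in>J. \<Sum>j'\<in>J. h j w * cnj (h j' y) * vinner K (h j) (h j'))"
      unfolding vinner_def sum_distrib_left ..
    also have "\<dots> = (\<Sum>j\<in>J. \<Sum>j'\<in>J. if j = j' then h j w * cnj (h j' y) else 0)"
      by (intro sum.cong refl) (simp add: h_ortho)
    also have "\<dots> = Q w y" using J by (simp add: Q_def)
    finally show "mmul K Q Q w y = Q w y" .
  qed
  have Q_in: "Q \<in> mats K K" using Q_mats by (auto simp: mats_def)
  have PP: "mmul K P P = P"
  proof (intro ext)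
    fix w y
    have eq: "mmul K P P w y = mmul K (mone K) (mone K) w y - mmul K (mone K) Q w y - mmul K Q (mone K) w y + mmul K Q Q w y"
      unfolding mmul_def P_def sum_subtractf[symmetric] sum.distrib[symmetric]
      by (intro sum.cong refl) (simp add: algebra_simps)
    show "mmul K P P w y = P w y"
      unfolding eq QQ mmul_mone_left[OF fin(1) mone_mats] mmul_mone_left[OF fin(1) Q_in] mmul_mone_right[OF fin(1) Q_in]
      by (simp add: P_def)
  qed
  have P_adj: "cnj (P w y) = P y w" for w y
    by (auto simp: P_def Q_def mone_def mult.commute)
  \<comment> \<open>One operator per syndrome acts coherently on all codewords. The complement takes
    one operator for each output basis vector \<open>y\<close>; their completeness sum is PP =
    P.\<close>
  define A where "A r = (case r of Inl e \<Rightarrow> (\<lambda>l w. \<Sum>i\<in>I. u i l * cnj (\<eta> e i w)) | Inr y \<Rightarrow> (\<lambda>l w. u i0 l * P y w))" for r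
  have A_mats: "A r \<in> mats L K" if "r \<in> E <+> K" for r
  proof -
    have "A r l w = 0" if lw: "l \<notin> L \<or> w \<notin> K" for l w
    proof (cases r)
      case (Inl e)
      then have "e \<in> E" using \<open>r \<in> E <+> K\<close> by auto
      then show ?thesis using lw vecs_eq_0[OF u] vecs_eq_0[OF \<eta>] by (auto simp: A_def Inl intro!: sum.neutral)
    next
      case (Inr y)
      then show ?thesis using lw vecs_eq_0[OF u[OF i0]] mats_eq_0[OF P_mats] by (auto simp: A_def)
    qed
    then show ?thesis by (auto simp: mats_def)
  qed
  have "channel K L (kraus (E <+> K) K A)"
  proof (rule kraus_channel[OF fin(1) A_mats])
    fix a a' assume "a \<in> K" "a' \<in> K"
    have "(\<Sum>l\<in>L. A (Inl e) l a * cnj (A (Inl e) l a')) = (\<Sum>i\<in>I. \<eta> e i a' * cnj (\<eta> e i a))" if "e \<in> E" for e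
    proof -
      have "(\<Sum>l\<in>L. A (Inl e) l a * cnj (A (Inl e) l a')) =
         (\<Sum>l\<in>L. \<Sum>i\<in>I. \<Sum>i'\<in>I. \<eta> e i' a' * cnj (\<eta> e i a) * (cnj (u i' l) * u i l))"
        unfolding A_def sum.case cnj_sum sum_product by (simp add: mult_ac)
      also have "\<dots> = (\<Sum>i\<in>I. \<Sum>l\<in>L. \<Sum>i'\<in>I. \<eta> e i' a' * cnj (\<eta> e i a) * (cnj (u i' l) * u i l))"
        by (rule sum.swap)
      also have "\<dots> = (\<Sum>i\<in>I. \<Sum>i'\<in>I. \<Sum>l\<in>L. \<eta> e i' a' * cnj (\<eta> e i a) * (cnj (u i' l) * u i l))"
        by (rule sum.cong[OF refl], rule sum.swap)
      also have "\<dots> = (\<Sum>i\<in>I. \<Sum>i'\<in>I. \<eta> e i' a' * cnj (\<eta> e i a) * vinner L (u i') (u i))"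
        unfolding vinner_def sum_distrib_left ..
      also have "\<dots> = (\<Sum>i\<in>I. \<Sum>i'\<in>I. if i' = i then \<eta> e i' a' * cnj (\<eta> e i a) else 0)"
        by (intro sum.cong refl) (simp add: u_ortho)
      finally show ?thesis using fin by simp
    qed
    then have 1: "(\<Sum>e\<in>E. \<Sum>l\<in>L. A (Inl e) l a * cnj (A (Inl e) l a')) = Q a' a"
      by (simp add: Q_def J_def h_def sum.cartesian_product')
    have "(\<Sum>l\<in>L. A (Inr y) l a * cnj (A (Inr y) l a')) = P a' y * P y a" for y
    proof -
      have "(\<Sum>l\<in>L. A (Inr y) l a * cnj (A (Inr y) l a')) = P y a * cnj (P y a') * vinner L (u i0) (u i0)"
        by (simp add: A_def vinner_def sum_distrib_left mult_ac)
      then show ?thesis using u_ortho[OF i0 i0] by (simp add: P_adj)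
    qed
    then have 2: "(\<Sum>y\<in>K. \<Sum>l\<in>L. A (Inr y) l a * cnj (A (Inr y) l a')) = P a' a"
      using fun_cong[OF fun_cong[OF PP], of a' a] by (simp add: mmul_def)
    have "(\<Sum>r\<in>E <+> K. \<Sum>l\<in>L. A r l a * cnj (A r l a')) = Q a' a + P a' a"
      using fin 1 2 by (simp add: sum.Plus)
    then show "(\<Sum>r\<in>E <+> K. \<Sum>l\<in>L. A r l a * cnj (A r l a')) = (if a = a' then 1 else 0)"
      using \<open>a' \<in> K\<close> by (simp add: P_def mone_def)
  qed
  then show ?thesis using A_mats by (intro exI[of _ A]) (auto simp: A_def)
qed

section \<open>Kraus operators of the erasure channel\<close>

definition erasure_kraus ::
  "real \<Rightarrow> nat \<Rightarrow> nat \<Rightarrow> (nat set \<Rightarrow> real) \<Rightarrow> nat set \<times> (nat \<Rightarrow> real) \<Rightarrow> (nat set \<times> (nat \<Rightarrow> real), nat \<Rightarrow> real) cmat" where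
  "erasure_kraus s N d p = (\<lambda>(\<alpha>, z) (\<alpha>', y) x.
     if \<alpha>' = \<alpha> \<and> (\<alpha>, y) \<in> erasure_output s N d \<and> x = override_on y z \<alpha> then of_real (sqrt (p \<alpha>)) else 0)"

definition erasure_index :: "real \<Rightarrow> nat \<Rightarrow> nat \<Rightarrow> (nat set \<times> (nat \<Rightarrow> real)) set" where
  "erasure_index s N d = (SIGMA \<alpha>:erasure_sets N d. configs s \<alpha>)"

lemma finite_erasure_sets: "finite (erasure_sets N d)"
  by (rule finite_subset[of _ "Pow {..<N}"]) (auto simp: erasure_sets_def)

lemma erasure_sets_finite: "\<alpha> \<in> erasure_sets N d \<Longrightarrow> finite \<alpha>"
  by (auto simp: erasure_sets_def intro: finite_subset)

lemma encoding_kraus: "encoding L V = kraus {()} L (\<lambda>_. V)"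
  unfolding encoding_def kraus_mmul by simp

context spin
begin

lemma finite_erasure_output: "finite (erasure_output s N d)"
  unfolding erasure_output_def by (intro finite_SigmaI finite_erasure_sets finite_configs) auto

lemma finite_erasure_index: "finite (erasure_index s N d)"
  unfolding erasure_index_def by (intro finite_SigmaI finite_erasure_sets finite_configs erasure_sets_finite)

lemma erasure_kraus_mats: "q \<in> erasure_index s N d \<Longrightarrow> erasure_kraus s N d p q \<in> mats (erasure_output s N d) (configs s {..<N})"
  by (auto simp: mats_def erasure_kraus_def erasure_index_def erasure_output_def erasure_sets_def
      intro!: override_configs split: if_splits)

text \<open>Measuring the lost sites in the product basis and forgetting the outcome z realizes the
  partial trace, so pairs (\<alpha>, z) index the operators. Nonnegativity of
  \<open>p \<alpha>\<close> lets the two factors \<open>sqrt (p \<alpha>)\<close> multiply back to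
  it.\<close>

lemma erasure_noise_kraus:
  assumes p: "erasure_distribution N d p"
  shows "erasure_noise s N d p = kraus (erasure_index s N d) (configs s {..<N}) (erasure_kraus s N d p)"
proof (intro ext)
  fix X and w w' :: "nat set \<times> (nat \<Rightarrow> real)"
  obtain \<alpha> y \<alpha>' y' where w: "w = (\<alpha>, y)" "w' = (\<alpha>', y')" by (cases w, cases w')
  let ?I = "configs s {..<N}"
  have fI: "finite ?I" by (simp add: finite_configs)
  let ?T = "\<lambda>\<beta> z. \<Sum>a\<in>?I. \<Sum>a'\<in>?I. erasure_kraus s N d p (\<beta>, z) w a * X a a' * cnj (erasure_kraus s N d p (\<beta>, z) w' a')"
  have k: "kraus (erasure_index s N d) ?I (erasure_kraus s N d p) X w w' = (\<Sum>\<beta>\<in>erasure_sets N d. \<Sum>z\<in>configs s \<beta>. ?T \<beta> z)"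
    unfolding kraus_def erasure_index_def
    by (subst sum.Sigma) (auto simp: finite_erasure_sets intro!: finite_configs erasure_sets_finite)
  show "erasure_noise s N d p X w w' = kraus (erasure_index s N d) ?I (erasure_kraus s N d p) X w w'"
  proof (cases "\<alpha> = \<alpha>' \<and> (\<alpha>, y) \<in> erasure_output s N d \<and> (\<alpha>', y') \<in> erasure_output s N d")
    case False
    have "?T \<beta> z = 0" for \<beta> z
      using False by (intro sum.neutral ballI) (auto simp: erasure_kraus_def w split: if_splits)
    then show ?thesis using False unfolding k by (auto simp: erasure_noise_def w)
  next
    case True
    then have \<alpha>: "\<alpha> \<in> erasure_sets N d" "\<alpha> \<subseteq> {..<N}"
      and y: "y \<in> configs s ({..<N} - \<alpha>)" "y' \<in> configs s ({..<N} - \<alpha>)"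
      by (auto simp: erasure_output_def erasure_sets_def)
    have p0: "0 \<le> p \<alpha>" using p \<alpha> by (simp add: erasure_distribution_def)
    have "?T \<beta> z = 0" if "\<beta> \<noteq> \<alpha>" for \<beta> z
      using that by (auto simp: erasure_kraus_def w intro!: sum.neutral)
    then have "(\<Sum>\<beta>\<in>erasure_sets N d. \<Sum>z\<in>configs s \<beta>. ?T \<beta> z) = (\<Sum>\<beta>\<in>erasure_sets N d. if \<beta> = \<alpha> then \<Sum>z\<in>configs s \<alpha>. ?T \<alpha> z else 0)"
      by (intro sum.cong refl) auto
    also have "\<dots> = (\<Sum>z\<in>configs s \<alpha>. ?T \<alpha> z)"
      using \<alpha> finite_erasure_sets by (simp add: sum.delta)
    also have "\<dots> = (\<Sum>z\<in>configs s \<alpha>. of_real (p \<alpha>) * X (override_on y z \<alpha>) (override_on y' z \<alpha>))"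
    proof (intro sum.cong refl)
      fix z assume z: "z \<in> configs s \<alpha>"
      have o: "override_on y z \<alpha> \<in> ?I" "override_on y' z \<alpha> \<in> ?I" using override_configs \<alpha> y z by auto
      have "?T \<alpha> z = (\<Sum>a\<in>?I. \<Sum>a'\<in>?I. if a' = override_on y' z \<alpha> then
          (if a = override_on y z \<alpha> then of_real (sqrt (p \<alpha>)) * X a a' * of_real (sqrt (p \<alpha>)) else 0) else 0)"
        using True by (intro sum.cong refl) (auto simp: erasure_kraus_def w)
      also have "\<dots> = of_real (sqrt (p \<alpha>)) * X (override_on y z \<alpha>) (override_on y' z \<alpha>) * of_real (sqrt (p \<alpha>))"
        using o fI by (simp add: sum.delta)
      also have "\<dots> = of_real (sqrt (p \<alpha>) * sqrt (p \<alpha>)) * X (override_on y z \<alpha>) (override_on y' z \<alpha>)"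
        by (simp only: of_real_mult mult_ac)
      finally show "?T \<alpha> z = of_real (p \<alpha>) * X (override_on y z \<alpha>) (override_on y' z \<alpha>)"
        using p0 by simp
    qed
    also have "\<dots> = erasure_noise s N d p X w w'"
      using True by (auto simp: erasure_noise_def partial_trace_def w sum_distrib_left)
    finally show ?thesis unfolding k by simp
  qed
qed

end

text \<open>\<open>spacing\<close> separates codewords by more than the occupation that erased sites
  can carry. \<open>low\<close> and \<open>high\<close> put all code occupations between a quarter
  and three quarters of \<open>t * N\<close>, with room for \<open>t * d\<close> units on either
  side.\<close>

locale dicke_code = spin +
  fixes N d K0 \<Delta> m :: nat and g :: complex and kt :: "nat \<Rightarrow> (nat \<Rightarrow> real) \<Rightarrow> complex"
  assumes spacing: "t * d < \<Delta>"
    and low: "t * N + 4 * (t * d) \<le> 4 * K0"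
    and high: "4 * (K0 + m * \<Delta>) + 4 * (t * d) \<le> 3 * (t * N)"
    and g: "cmod g = 1"
    and kt: "\<And>i. i \<le> m \<Longrightarrow> kt i = (\<lambda>x. g * dicke s t {..<N} (K0 + i * \<Delta>) x)"
begin

abbreviation "\<kappa> i \<equiv> K0 + i * \<Delta>"

section \<open>Orthonormality and dimension of the code\<close>

lemma \<kappa>_le: "i \<le> m \<Longrightarrow> \<kappa> i \<le> K0 + m * \<Delta>" by simp

lemma \<kappa>_range: "K0 + m * \<Delta> \<le> t * N"
proof -
  have "4 * (K0 + m * \<Delta>) \<le> 3 * (t * N)" using high by (rule add_leD1)
  also have "\<dots> \<le> 4 * (t * N)" by simp
  finally show ?thesis by simp
qed

lemma kt_inner:
  assumes "i \<le> m" "j \<le> m"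
  shows "vinner (configs s {..<N}) (kt i) (kt j) = (if i = j then 1 else 0)"
proof -
  have "vinner (configs s {..<N}) (kt i) (kt j) = (cnj g * g) * vinner (configs s {..<N}) (dicke s t {..<N} (\<kappa> i)) (dicke s t {..<N} (\<kappa> j))"
    using assms by (simp add: kt vinner_def sum_distrib_left mult_ac)
  moreover have "cnj g * g = 1" using g complex_norm_square[of g] by (simp add: mult.commute)
  moreover have "\<kappa> i \<le> t * N" using \<kappa>_le[OF assms(1)] \<kappa>_range by (meson le_trans)
  moreover have "\<kappa> i = \<kappa> j \<longleftrightarrow> i = j" using spacing by auto
  ultimately show ?thesis using dicke_inner[of "{..<N}" "\<kappa> i" "\<kappa> j"] by simp
qed

lemma kt_inj: "inj_on kt {..m}"
  by (rule inj_onI) (metis atMost_iff kt_inner zero_neq_one)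

text \<open>Vectors that equal their own expansion form a subspace containing every
  \<open>kt i\<close>, hence the whole span.\<close>

lemma span_expand:
  assumes "v \<in> cfun.span (kt ` {..m})"
  shows "v = (\<lambda>x. \<Sum>i\<le>m. vinner (configs s {..<N}) (kt i) v * kt i x)"
proof -
  let ?W = "{v. v = (\<lambda>x. \<Sum>i\<le>m. vinner (configs s {..<N}) (kt i) v * kt i x)}"
  have "cfun.subspace ?W"
    unfolding cfun.subspace_def
  proof (intro conjI ballI allI)
    show "0 \<in> ?W" by (simp add: vinner_def fun_eq_iff)
  next
    fix x y assume "x \<in> ?W" "y \<in> ?W"
    then have "x = (\<lambda>z. \<Sum>i\<le>m. vinner (configs s {..<N}) (kt i) x * kt i z)"
      "y = (\<lambda>z. \<Sum>i\<le>m. vinner (configs s {..<N}) (kt i) y * kt i z)" by auto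
    then have "x + y = (\<lambda>z. (\<Sum>i\<le>m. vinner (configs s {..<N}) (kt i) x * kt i z) + (\<Sum>i\<le>m. vinner (configs s {..<N}) (kt i) y * kt i z))"
      by (metis (no_types, lifting) plus_fun_def)
    moreover have "vinner I u (x + y) = vinner I u x + vinner I u y" for I u
      by (simp add: vinner_def algebra_simps sum.distrib)
    ultimately show "x + y \<in> ?W" by (simp add: algebra_simps sum.distrib)
  next
    fix c x assume "x \<in> ?W"
    then have e: "x = (\<lambda>z. \<Sum>i\<le>m. vinner (configs s {..<N}) (kt i) x * kt i z)" by simp
    have cx: "c * x z = (\<Sum>i\<le>m. c * vinner (configs s {..<N}) (kt i) x * kt i z)" for z
      by (subst fun_cong[OF e, of z]) (simp add: sum_distrib_left mult.assoc)
    show "(\<lambda>z. c * x z) \<in> ?W"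
      unfolding mem_Collect_eq vinner_scale_right by (rule ext) (rule cx)
  qed
  moreover have "kt ` {..m} \<subseteq> ?W"
  proof
    fix v assume "v \<in> kt ` {..m}"
    then obtain j where j: "j \<le> m" "v = kt j" by auto
    have "(\<Sum>i\<le>m. vinner (configs s {..<N}) (kt i) (kt j) * kt i x) = kt j x" for x
    proof -
      have "(\<Sum>i\<le>m. vinner (configs s {..<N}) (kt i) (kt j) * kt i x) = (\<Sum>i\<le>m. if i = j then kt i x else 0)"
        using j by (intro sum.cong refl) (simp add: kt_inner)
      then show ?thesis using j by simp
    qed
    then show "v \<in> ?W" using j by simp
  qed
  ultimately show ?thesis using cfun.span_minimal[of "kt ` {..m}" ?W] assms by blast
qed

lemma dim_code: "cfun.dim (cfun.span (kt ` {..m})) = Suc m"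
proof -
  have "cfun.independent (kt ` {..m})"
  proof (rule cfun.independent_if_scalars_zero)
    fix f v assume 0: "(\<Sum>x\<in>kt ` {..m}. (\<lambda>i. f x * x i)) = 0" and v: "v \<in> kt ` {..m}"
    then obtain j where j: "j \<le> m" "v = kt j" by auto
    have "0 = vinner (configs s {..<N}) (kt j) (\<Sum>x\<in>kt ` {..m}. (\<lambda>i. f x * x i))"
      by (simp add: 0 vinner_def)
    also have "(\<Sum>x\<in>kt ` {..m}. (\<lambda>i. f x * x i)) = (\<lambda>x. \<Sum>i\<le>m. f (kt i) * kt i x)"
      by (subst sum.reindex[OF kt_inj]) (simp add: fun_eq_iff sum_fun_apply)
    also have "vinner (configs s {..<N}) (kt j) \<dots> = (\<Sum>i\<le>m. f (kt i) * vinner (configs s {..<N}) (kt j) (kt i))"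
      by (simp only: vinner_sum_right vinner_scale_right)
    also have "\<dots> = (\<Sum>i\<le>m. if i = j then f (kt i) else 0)"
      using j by (intro sum.cong refl) (simp add: kt_inner)
    also have "\<dots> = f v" using j by simp
    finally show "f v = 0" by simp
  qed simp
  from cfun.dim_eq_card_independent[OF this] show ?thesis by (simp add: card_image[OF kt_inj])
qed

end

section \<open>Syndromes, recovery and the error of the code\<close>

context dicke_code
begin

text \<open>These inequalities make the truncated differences of occupations genuine and supply the
  margins that the affinity estimate asks for.\<close>

lemma occupation_range:
  assumes "a \<le> t * d" "k \<le> a" "i \<le> m"
  shows "k \<le> \<kappa> i" and "\<kappa> i - k \<le> t * N - a" and "a \<le> t * N"
    and "t * N + 4 * a \<le> 4 * \<kappa> i" and "4 * \<kappa> i + 4 * a \<le> 3 * (t * N)"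
proof -
  have 1: "4 * \<kappa> i \<le> 4 * (K0 + m * \<Delta>)" using \<kappa>_le[OF assms(3)] by simp
  show lo: "t * N + 4 * a \<le> 4 * \<kappa> i" using low assms(1) by simp
  show hi: "4 * \<kappa> i + 4 * a \<le> 3 * (t * N)" using high assms(1) 1 by linarith
  show "k \<le> \<kappa> i" using lo assms(2) by simp
  define X where "X = t * N"
  define Y where "Y = \<kappa> i"
  show "\<kappa> i - k \<le> t * N - a" "a \<le> t * N"
    using lo hi unfolding X_def[symmetric] Y_def[symmetric] by arith+
qed

text \<open>\<open>\<eta> (\<alpha>, k) i\<close> is what remains of the \<open>i\<close>th code state when \<open>\<alpha>\<close> is lost with occupation \<open>k\<close>.\<close>

definition \<eta> :: "nat set \<times> nat \<Rightarrow> nat \<Rightarrow> nat set \<times> (nat \<Rightarrow> real) \<Rightarrow> complex" where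
  "\<eta> = (\<lambda>(\<alpha>, k) i (\<alpha>', y). if \<alpha>' = \<alpha> then dicke s t ({..<N} - \<alpha>) (\<kappa> i - k) y else 0)"

definition syndromes :: "(nat set \<times> nat) set" where
  "syndromes = (SIGMA \<alpha>:erasure_sets N d. {..t * card \<alpha>})"

lemma finite_syndromes: "finite syndromes"
  unfolding syndromes_def by (intro finite_SigmaI finite_erasure_sets) auto

lemma \<eta>_vecs: "e \<in> syndromes \<Longrightarrow> \<eta> e i \<in> vecs (erasure_output s N d)"
  by (auto simp: \<eta>_def syndromes_def vecs_def erasure_output_def dicke_def split: if_splits)

text \<open>Equal remaining occupations mean i \<Delta> + k' = i' \<Delta> + k with both k and k'
  below \<Delta>, and division by \<Delta> recovers the indices: different codewords never collide,
  whatever occupation was lost.\<close>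

lemma \<eta>_inner:
  assumes e: "e \<in> syndromes" "e' \<in> syndromes" and i: "i \<le> m" "i' \<le> m"
  shows "vinner (erasure_output s N d) (\<eta> e i) (\<eta> e' i') = (if e = e' \<and> i = i' then 1 else 0)"
proof -
  obtain \<alpha> k \<alpha>' k' where ek: "e = (\<alpha>, k)" "e' = (\<alpha>', k')" by (cases e, cases e')
  have \<alpha>: "\<alpha> \<in> erasure_sets N d" "k \<le> t * card \<alpha>" "\<alpha>' \<in> erasure_sets N d" "k' \<le> t * card \<alpha>'"
    using e by (auto simp: ek syndromes_def)
  have card: "t * card \<alpha> \<le> t * d" "t * card \<alpha>' \<le> t * d" "\<alpha> \<subseteq> {..<N}"
    using \<alpha> by (auto simp: erasure_sets_def)
  have r: "k \<le> \<kappa> i" "\<kappa> i - k \<le> t * N - t * card \<alpha>" "k' \<le> \<kappa> i'"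
    using occupation_range[OF card(1) \<alpha>(2) i(1)] occupation_range[OF card(2) \<alpha>(4) i(2)] by auto
  have cardb: "t * card ({..<N} - \<alpha>) = t * N - t * card \<alpha>"
    using card(3) erasure_sets_finite[OF \<alpha>(1)] by (simp add: card_Diff_subset diff_mult_distrib2)
  have "vinner (erasure_output s N d) (\<eta> e i) (\<eta> e' i') =
      (\<Sum>\<beta>\<in>erasure_sets N d. \<Sum>y\<in>configs s ({..<N} - \<beta>). cnj (\<eta> e i (\<beta>, y)) * \<eta> e' i' (\<beta>, y))"
    unfolding vinner_def erasure_output_def
    by (subst sum.Sigma) (auto simp: finite_erasure_sets finite_configs)
  also have "\<dots> = (\<Sum>\<beta>\<in>erasure_sets N d. if \<beta> = \<alpha> then (if \<alpha>' = \<alpha> then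
      vinner (configs s ({..<N} - \<alpha>)) (dicke s t ({..<N} - \<alpha>) (\<kappa> i - k)) (dicke s t ({..<N} - \<alpha>) (\<kappa> i' - k')) else 0) else 0)"
    by (intro sum.cong refl) (auto simp: ek \<eta>_def vinner_def)
  also have "\<dots> = (if \<alpha>' = \<alpha> then
      vinner (configs s ({..<N} - \<alpha>)) (dicke s t ({..<N} - \<alpha>) (\<kappa> i - k)) (dicke s t ({..<N} - \<alpha>) (\<kappa> i' - k')) else 0)"
    using \<alpha>(1) finite_erasure_sets by simp
  also have "\<dots> = (if \<alpha>' = \<alpha> \<and> \<kappa> i - k = \<kappa> i' - k' then 1 else 0)"
    by (subst dicke_inner) (use r(2) cardb in auto)
  also have "\<alpha>' = \<alpha> \<and> \<kappa> i - k = \<kappa> i' - k' \<longleftrightarrow> e = e' \<and> i = i'"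
  proof -
    have "i = i' \<and> k = k'" if "\<kappa> i - k = \<kappa> i' - k'"
    proof -
      have sum: "i * \<Delta> + k' = i' * \<Delta> + k" using that r by linarith
      have k: "k < \<Delta>" "k' < \<Delta>" using \<alpha> card spacing by linarith+
      have "i = (i * \<Delta> + k') div \<Delta>" "i' = (i' * \<Delta> + k) div \<Delta>" using k by auto
      then have "i = i'" using sum by metis
      then show ?thesis using sum by simp
    qed
    then show ?thesis by (auto simp: ek)
  qed
  finally show ?thesis .
qed

text \<open>The outcome z enters the remaining state only through its occupation; all other
  dependence is a scalar. A recovery that knows \<alpha> and the occupation is therefore
  enough.\<close>

lemma erasure_kraus_kt:
  assumes \<alpha>: "\<alpha> \<in> erasure_sets N d" and z: "z \<in> configs s \<alpha>" and j: "j \<le> m"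
  shows "mapply (configs s {..<N}) (erasure_kraus s N d p (\<alpha>, z)) (kt j) =
    (\<lambda>w. of_real (sqrt (p \<alpha>)) * g * of_real (sqrt (real (weight s t \<alpha> z)) *
        sqrt (real ((t * N - t * card \<alpha>) choose (\<kappa> j - occ s \<alpha> z)) / real ((t * N) choose (\<kappa> j)))) *
      \<eta> (\<alpha>, occ s \<alpha> z) j w)"
proof
  fix w :: "nat set \<times> (nat \<Rightarrow> real)"
  obtain \<beta> y where w: "w = (\<beta>, y)" by (cases w)
  have fI: "finite (configs s {..<N})" by (simp add: finite_configs)
  have sub: "\<alpha> \<subseteq> {..<N}" "t * card \<alpha> \<le> t * d" using \<alpha> by (auto simp: erasure_sets_def)
  show "mapply (configs s {..<N}) (erasure_kraus s N d p (\<alpha>, z)) (kt j) w =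
    of_real (sqrt (p \<alpha>)) * g * of_real (sqrt (real (weight s t \<alpha> z)) *
        sqrt (real ((t * N - t * card \<alpha>) choose (\<kappa> j - occ s \<alpha> z)) / real ((t * N) choose (\<kappa> j)))) *
      \<eta> (\<alpha>, occ s \<alpha> z) j w"
  proof (cases "\<beta> = \<alpha> \<and> y \<in> configs s ({..<N} - \<alpha>)")
    case False
    then have "erasure_kraus s N d p (\<alpha>, z) w x = 0" for x
      by (auto simp: erasure_kraus_def w erasure_output_def)
    moreover have "\<eta> (\<alpha>, occ s \<alpha> z) j w = 0" using False by (auto simp: \<eta>_def w dicke_def)
    ultimately show ?thesis by (simp add: mapply_def)
  next
    case True
    have "occ s \<alpha> z \<le> t * card \<alpha>" using occ_le[OF erasure_sets_finite[OF \<alpha>] z] .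
    then have o: "occ s \<alpha> z \<le> \<kappa> j" using occupation_range(1)[OF sub(2) _ j] by blast
    have "mapply (configs s {..<N}) (erasure_kraus s N d p (\<alpha>, z)) (kt j) w
      = (\<Sum>x\<in>configs s {..<N}. if x = override_on y z \<alpha> then of_real (sqrt (p \<alpha>)) * kt j x else 0)"
      unfolding mapply_def using True \<alpha>
      by (intro sum.cong refl) (simp add: erasure_kraus_def w erasure_output_def)
    also have "\<dots> = of_real (sqrt (p \<alpha>)) * kt j (override_on y z \<alpha>)"
      using override_configs[OF sub(1) _ z] True fI by (simp add: sum.delta)
    also have "\<dots> = of_real (sqrt (p \<alpha>)) * (g * dicke s t {..<N} (\<kappa> j) (override_on y z \<alpha>))"
      by (simp only: kt[OF j])
    finally show ?thesis
      using True by (simp only: dicke_override[OF sub(1) _ z o] \<eta>_def w prod.case mult.assoc if_True simp_thms)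
  qed
qed

text \<open>Expanding the square and summing over z first gives the affinities of pairs of
  codewords, averaged with the weights \<open>q j * q j'\<close>. A bound common to all pairs passes
  to the average because \<open>q\<close> sums to 1.\<close>

lemma affinity_bound:
  assumes \<alpha>: "\<alpha> \<in> erasure_sets N d" and N: "0 < t * N" and q: "\<And>j. j \<le> m \<Longrightarrow> 0 \<le> q j" "(\<Sum>j\<le>m. q j) = 1"
  shows "1 - real (t * d) * (real (m * \<Delta>) / (real (t * N) / 2))\<^sup>2 \<le>
    (\<Sum>z\<in>configs s \<alpha>. (\<Sum>j\<le>m. q j * (sqrt (real (weight s t \<alpha> z)) *
        sqrt (real ((t * N - t * card \<alpha>) choose (\<kappa> j - occ s \<alpha> z)) / real ((t * N) choose (\<kappa> j)))))\<^sup>2)"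
proof -
  let ?n = "t * N" and ?a = "t * card \<alpha>"
  let ?\<theta> = "(real (m * \<Delta>) / (real (t * N) / 2))\<^sup>2"
  define r where "r j k = sqrt (real ((t * N - t * card \<alpha>) choose (\<kappa> j - k)) / real ((t * N) choose (\<kappa> j)))" for j k
  have fin: "finite \<alpha>" by (rule erasure_sets_finite[OF \<alpha>])
  have sub: "?a \<le> t * d" using \<alpha> by (auto simp: erasure_sets_def)
  have aff: "(\<Sum>z\<in>configs s \<alpha>. real (weight s t \<alpha> z) * (r j (occ s \<alpha> z) * r j' (occ s \<alpha> z))) =
      hypergeometric_affinity ?n ?a (\<kappa> j) (\<kappa> j')" for j j'
    using sum_weight_occ[OF fin, of "\<lambda>k. r j k * r j' k"] by (simp only: hypergeometric_affinity_def r_def)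
  have ge: "1 - real (t * d) * ?\<theta> \<le> hypergeometric_affinity ?n ?a (\<kappa> j) (\<kappa> j')" if j: "j \<le> m" "j' \<le> m" for j j'
  proof -
    note R = occupation_range[OF sub le0 j(1)] and R' = occupation_range[OF sub le0 j(2)]
    have "real (j * \<Delta>) \<le> real (m * \<Delta>)" "real (j' * \<Delta>) \<le> real (m * \<Delta>)"
      using j by (simp_all only: of_nat_le_iff mult_le_mono1)
    then have D: "\<bar>real (\<kappa> j) - real (\<kappa> j')\<bar> \<le> real (m * \<Delta>)"
      unfolding of_nat_add using of_nat_0_le_iff[of "j * \<Delta>"] of_nat_0_le_iff[of "j' * \<Delta>"] by linarith
    \<comment> \<open>The margins leave at least half of the units after all draws, whence the
      population bound t N / 2 in the denominator.\<close>
    have "2 * ?a \<le> ?n" using R(4,5) by linarith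
    then have "2 * real ?a \<le> real ?n" by (metis of_nat_le_iff of_nat_mult of_nat_numeral)
    then have half: "real ?n / 2 \<le> real ?n - real ?a" by linarith
    have "1 - real (t * d) * ?\<theta> \<le> 1 - real ?a * ?\<theta>"
      using sub by (intro diff_left_mono mult_right_mono) (simp_all only: of_nat_le_iff zero_le_power2)
    also have "\<dots> \<le> hypergeometric_affinity ?n ?a (\<kappa> j) (\<kappa> j')"
      using N by (intro hypergeometric_affinity_ge half R(4,5) R'(4,5) D) (simp only: of_nat_0_less_iff half_gt_zero_iff)
    finally show ?thesis .
  qed
  have "1 - real (t * d) * ?\<theta> = (\<Sum>j\<le>m. \<Sum>j'\<le>m. q j * q j' * (1 - real (t * d) * ?\<theta>))"
    unfolding sum_distrib_right[symmetric] sum_product[symmetric] q(2) by simp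
  also have "\<dots> \<le> (\<Sum>j\<le>m. \<Sum>j'\<le>m. q j * q j' * hypergeometric_affinity ?n ?a (\<kappa> j) (\<kappa> j'))"
    by (intro sum_mono mult_left_mono ge mult_nonneg_nonneg q) auto
  also have "\<dots> = (\<Sum>j\<le>m. \<Sum>j'\<le>m. \<Sum>z\<in>configs s \<alpha>. q j * q j' * (real (weight s t \<alpha> z) * (r j (occ s \<alpha> z) * r j' (occ s \<alpha> z))))"
    unfolding aff[symmetric] sum_distrib_left ..
  also have "\<dots> = (\<Sum>j\<le>m. \<Sum>z\<in>configs s \<alpha>. \<Sum>j'\<le>m. q j * q j' * (real (weight s t \<alpha> z) * (r j (occ s \<alpha> z) * r j' (occ s \<alpha> z))))"
    by (rule sum.cong[OF refl], rule sum.swap)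
  also have "\<dots> = (\<Sum>z\<in>configs s \<alpha>. \<Sum>j\<le>m. \<Sum>j'\<le>m. q j * q j' * (real (weight s t \<alpha> z) * (r j (occ s \<alpha> z) * r j' (occ s \<alpha> z))))"
    by (rule sum.swap)
  also have "\<dots> = (\<Sum>z\<in>configs s \<alpha>. (\<Sum>j\<le>m. q j * (sqrt (real (weight s t \<alpha> z)) * r j (occ s \<alpha> z)))\<^sup>2)"
  proof (intro sum.cong refl)
    fix z
    have w: "real (weight s t \<alpha> z) = sqrt (real (weight s t \<alpha> z)) * sqrt (real (weight s t \<alpha> z))" by simp
    show "(\<Sum>j\<le>m. \<Sum>j'\<le>m. q j * q j' * (real (weight s t \<alpha> z) * (r j (occ s \<alpha> z) * r j' (occ s \<alpha> z)))) =
        (\<Sum>j\<le>m. q j * (sqrt (real (weight s t \<alpha> z)) * r j (occ s \<alpha> z)))\<^sup>2"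
      unfolding power2_eq_square sum_product by (subst w) (simp only: mult_ac)
  qed
  finally show ?thesis unfolding r_def .
qed

text \<open>As \<open>V\<close> is an arbitrary isometry, the codewords correspond to some
  orthonormal basis \<open>u\<close> of the logical space and not to its labels. In that basis,
  noise followed by the recovery for the matching syndrome is diagonal, which leaves only dephasing
  to estimate.\<close>

theorem code_inaccuracy:
  assumes p: "erasure_distribution N d p" and N: "0 < t * N"
    and V: "isometry_onto {..<Suc m} (configs s {..<N}) (cfun.span (kt ` {..m})) V"
  shows "inaccuracy {..<Suc m} (erasure_output s N d) V (erasure_noise s N d p) \<le>
    sqrt (real (t * d)) * (real (m * \<Delta>) / (real (t * N) / 2))"
proof -
  let ?L = "{..<Suc m}" and ?I = "configs s {..<N}" and ?K = "erasure_output s N d" and ?Q = "erasure_index s N d"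
  let ?B = "erasure_kraus s N d p"
  let ?\<theta> = "(real (m * \<Delta>) / (real (t * N) / 2))\<^sup>2"
  let ?C = "cfun.span (kt ` {..m})"
  have V_mats: "V \<in> mats ?I ?L" and VV: "mmul ?I (madj V) V = mone ?L" and V_onto: "mapply ?L V ` vecs ?L = ?C"
    using V by (auto simp: isometry_onto_def)
  have iso: "vinner ?I (mapply ?L V a) (mapply ?L V b) = vinner ?L a b" if "b \<in> vecs ?L" for a b
  proof -
    have "vinner ?I (mapply ?L V a) (mapply ?L V b) = vinner ?L a (mapply ?L (mmul ?I (madj V) V) b)"
      unfolding mapply_mmul by (subst vinner_mapply_adj) (simp add: madj_madj)
    then show ?thesis using that by (simp add: VV mapply_mone)
  qed
  have "\<exists>w\<in>vecs ?L. mapply ?L V w = kt j" if "j \<le> m" for j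
  proof -
    have "kt j \<in> ?C" using that by (intro cfun.span_base) auto
    then show ?thesis unfolding V_onto[symmetric] by (metis imageE)
  qed
  then obtain u where u: "u j \<in> vecs ?L" "mapply ?L V (u j) = kt j" if "j \<le> m" for j by metis
  have u_ortho: "vinner ?L (u i) (u j) = (if i = j then 1 else 0)" if "i \<le> m" "j \<le> m" for i j
    using iso[OF u(1)[OF that(2)], of "u i"] that by (simp add: u kt_inner)
  have expand: "\<phi> = (\<lambda>l. \<Sum>j\<le>m. vinner ?L (u j) \<phi> * u j l)" if \<phi>: "\<phi> \<in> vecs ?L" for \<phi>
  proof -
    have "mapply ?L V \<phi> \<in> ?C" using \<phi> V_onto by blast
    from span_expand[OF this] have "mapply ?L V \<phi> = (\<lambda>x. \<Sum>j\<le>m. vinner ?I (kt j) (mapply ?L V \<phi>) * kt j x)" .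
    also have "\<dots> = (\<lambda>x. \<Sum>j\<le>m. vinner ?L (u j) \<phi> * mapply ?L V (u j) x)"
      by (intro ext sum.cong refl) (simp add: u(2)[symmetric] iso[OF \<phi>])
    also have "\<dots> = mapply ?L V (\<lambda>l. \<Sum>j\<le>m. vinner ?L (u j) \<phi> * u j l)"
      by (simp only: mapply_sum_right mapply_scale)
    finally have eq: "mapply ?I (madj V) (mapply ?L V \<phi>) = mapply ?I (madj V) (mapply ?L V (\<lambda>l. \<Sum>j\<le>m. vinner ?L (u j) \<phi> * u j l))"
      by (rule arg_cong)
    have "(\<Sum>j\<le>m. vinner ?L (u j) \<phi> * u j l) = 0" if "l \<notin> ?L" for l
      using that vecs_eq_0[OF u(1)] by (intro sum.neutral) auto
    then have "(\<lambda>l. \<Sum>j\<le>m. vinner ?L (u j) \<phi> * u j l) \<in> vecs ?L" unfolding vecs_def by blast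
    then show ?thesis using eq \<phi> unfolding mapply_mmul[symmetric] VV by (simp add: mapply_mone)
  qed
  obtain A where A_channel: "channel ?K ?L (kraus (syndromes <+> ?K) ?K A)"
    and A_mats: "\<And>r. r \<in> syndromes <+> ?K \<Longrightarrow> A r \<in> mats ?L ?K"
    and A: "\<And>e. e \<in> syndromes \<Longrightarrow> A (Inl e) = (\<lambda>l w. \<Sum>i\<in>{..m}. u i l * cnj (\<eta> e i w))"
    using recovery_channel[of ?K ?L syndromes "{..m}" \<eta> u 0] finite_erasure_output finite_syndromes \<eta>_vecs \<eta>_inner u(1) u_ortho
    by auto
  let ?R = "kraus (syndromes <+> ?K) ?K A"
  have fQ: "finite ?Q" by (rule finite_erasure_index)
  have NE: "erasure_noise s N d p \<circ> encoding ?L V = kraus ?Q ?L (\<lambda>q. mmul ?I (?B q) V)"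
  proof
    fix X
    have "(erasure_noise s N d p \<circ> encoding ?L V) X = kraus (?Q \<times> {()}) ?L (\<lambda>(q, _). mmul ?I (?B q) V) X"
      by (simp add: erasure_noise_kraus[OF p] encoding_kraus kraus_comp)
    also have "\<dots> = kraus ?Q ?L (\<lambda>q. mmul ?I (?B q) V) X"
      by (simp add: kraus_def sum.cartesian_product')
    finally show "(erasure_noise s N d p \<circ> encoding ?L V) X = kraus ?Q ?L (\<lambda>q. mmul ?I (?B q) V) X" .
  qed
  have total: "?R \<circ> erasure_noise s N d p \<circ> encoding ?L V =
      kraus ((syndromes <+> ?K) \<times> ?Q) ?L (\<lambda>(r, q). mmul ?K (A r) (mmul ?I (?B q) V))"
    unfolding comp_assoc NE by (rule ext) (simp add: kraus_comp[OF fQ])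
  show ?thesis
  proof (rule inaccuracy_le[OF finite_erasure_output _ NE _ A_channel])
    show "mmul ?I (?B q) V \<in> mats ?K ?L" if "q \<in> ?Q" for q
      using that by (intro mmul_mats erasure_kraus_mats V_mats)
    show "0 \<le> sqrt (real (t * d)) * (real (m * \<Delta>) / (real (t * N) / 2))" by simp
    fix \<psi> assume \<psi>: "\<psi> \<in> unit_vecs (?L \<times> ?L)"
    define \<psi>r where "\<psi>r r = (\<lambda>l. \<psi> (l, r))" for r
    have \<psi>r: "\<psi>r r \<in> vecs ?L" for r using \<psi> by (auto simp: \<psi>r_def unit_vecs_def vecs_def)
    define c where "c r j = vinner ?L (u j) (\<psi>r r)" for r j
    have ex: "\<psi>r r = (\<lambda>l. \<Sum>j\<le>m. c r j * u j l)" for r using expand[OF \<psi>r] unfolding c_def .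
    \<comment> \<open>The distribution of the codeword index in the input, with the reference traced
      out.\<close>
    define q where "q j = (\<Sum>r<Suc m. (cmod (c r j))\<^sup>2)" for j
    have q0: "0 \<le> q j" for j by (simp add: q_def sum_nonneg)
    have self: "vinner ?L (\<psi>r r) (\<lambda>l. \<Sum>j\<le>m. c r j * (h j * u j l)) = (\<Sum>j\<le>m. h j * of_real ((cmod (c r j))\<^sup>2))" for r h
    proof -
      have "vinner ?L (\<psi>r r) (\<lambda>l. \<Sum>j\<le>m. c r j * (h j * u j l)) = (\<Sum>j\<le>m. c r j * (h j * vinner ?L (\<psi>r r) (u j)))"
        by (simp only: vinner_sum_right vinner_scale_right)
      also have "\<dots> = (\<Sum>j\<le>m. h j * (c r j * cnj (c r j)))"
        unfolding c_def vinner_cnj by (simp add: mult_ac)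
      finally show ?thesis by (simp only: complex_norm_square)
    qed
    have q1: "(\<Sum>j\<le>m. q j) = 1"
    proof -
      have "1 = vinner (?L \<times> ?L) \<psi> \<psi>" using \<psi> by (simp add: unit_vecs_def)
      also have "\<dots> = (\<Sum>r<Suc m. vinner ?L (\<psi>r r) (\<psi>r r))"
        unfolding vinner_def sum.cartesian_product' \<psi>r_def by (rule sum.swap)
      also have "\<dots> = (\<Sum>r<Suc m. \<Sum>j\<le>m. of_real ((cmod (c r j))\<^sup>2))"
        using self[of _ "\<lambda>_. 1"] ex by (intro sum.cong refl) simp
      also have "\<dots> = of_real (\<Sum>j\<le>m. q j)"
        unfolding q_def of_real_sum by (rule sum.swap)
      finally show ?thesis by (metis of_real_eq_1_iff)
    qed
    define G where "G \<alpha> z j = sqrt (real (weight s t \<alpha> z)) *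
        sqrt (real ((t * N - t * card \<alpha>) choose (\<kappa> j - occ s \<alpha> z)) / real ((t * N) choose (\<kappa> j)))" for \<alpha> z j
    \<comment> \<open>For the syndrome that matches z, noise and recovery multiply
      \<open>u j\<close> by \<open>G \<alpha> z j\<close> and by a factor of modulus
      \<open>sqrt (p \<alpha>)\<close> common to all j; the phase \<open>g\<close> disappears in the
      modulus.\<close>
    have overlap: "(cmod (vinner (?L \<times> ?L) \<psi> (mapply (?L \<times> ?L) (tensor_id (mmul ?K (A (Inl (\<alpha>, occ s \<alpha> z))) (mmul ?I (?B (\<alpha>, z)) V))) \<psi>)))\<^sup>2
        = p \<alpha> * (\<Sum>j\<le>m. q j * G \<alpha> z j)\<^sup>2" if \<alpha>: "\<alpha> \<in> erasure_sets N d" and z: "z \<in> configs s \<alpha>" for \<alpha> z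
    proof -
      let ?e = "(\<alpha>, occ s \<alpha> z)"
      let ?D = "mmul ?K (A (Inl ?e)) (mmul ?I (?B (\<alpha>, z)) V)"
      have e: "?e \<in> syndromes" using \<alpha> occ_le[OF erasure_sets_finite[OF \<alpha>] z] by (auto simp: syndromes_def)
      have A\<eta>: "mapply ?K (A (Inl ?e)) (\<eta> ?e j) = u j" if j: "j \<le> m" for j
      proof
        fix l
        have "mapply ?K (A (Inl ?e)) (\<eta> ?e j) l = (\<Sum>i\<le>m. u i l * vinner ?K (\<eta> ?e i) (\<eta> ?e j))"
          unfolding mapply_def A[OF e] vinner_def sum_distrib_left sum_distrib_right
          by (subst sum.swap) (simp add: mult_ac)
        also have "\<dots> = (\<Sum>i\<le>m. if i = j then u i l else 0)"
          by (intro sum.cong refl) (simp add: \<eta>_inner[OF e e] j)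
        also have "\<dots> = u j l" using j by simp
        finally show "mapply ?K (A (Inl ?e)) (\<eta> ?e j) l = u j l" .
      qed
      have Du: "mapply ?L ?D (u j) = (\<lambda>l. of_real (sqrt (p \<alpha>)) * g * of_real (G \<alpha> z j) * u j l)" if j: "j \<le> m" for j
        unfolding mapply_mmul u(2)[OF j] erasure_kraus_kt[OF \<alpha> z j] mapply_scale A\<eta>[OF j] G_def ..
      have "mapply ?L ?D (\<psi>r r) = (\<lambda>l. \<Sum>j\<le>m. c r j * ((of_real (sqrt (p \<alpha>)) * g * of_real (G \<alpha> z j)) * u j l))" for r
      proof -
        have "mapply ?L ?D (\<psi>r r) = (\<lambda>l. \<Sum>j\<le>m. c r j * mapply ?L ?D (u j) l)"
          by (subst ex) (simp only: mapply_sum_right mapply_scale)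
        then show ?thesis by (simp add: Du)
      qed
      then have "vinner (?L \<times> ?L) \<psi> (mapply (?L \<times> ?L) (tensor_id ?D) \<psi>) =
          (\<Sum>r<Suc m. \<Sum>j\<le>m. (of_real (sqrt (p \<alpha>)) * g * of_real (G \<alpha> z j)) * of_real ((cmod (c r j))\<^sup>2))"
        using self by (simp add: tensor_id_form \<psi>r_def[symmetric])
      also have "\<dots> = of_real (sqrt (p \<alpha>)) * g * of_real (\<Sum>j\<le>m. q j * G \<alpha> z j)"
        unfolding q_def of_real_sum of_real_mult sum_distrib_left sum_distrib_right
        by (subst sum.swap) (simp add: mult_ac)
      finally have "cmod (vinner (?L \<times> ?L) \<psi> (mapply (?L \<times> ?L) (tensor_id ?D) \<psi>)) = sqrt (p \<alpha>) * \<bar>\<Sum>j\<le>m. q j * G \<alpha> z j\<bar>"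
        using p \<alpha> g by (simp add: norm_mult erasure_distribution_def del: of_real_sum)
      then show ?thesis using p \<alpha> by (simp add: power_mult_distrib erasure_distribution_def)
    qed
    have \<psi>v: "\<psi> \<in> vecs (?L \<times> ?L)" by (rule unit_vecs_vecs[OF \<psi>])
    let ?f = "\<lambda>r q. (cmod (vinner (?L \<times> ?L) \<psi> (mapply (?L \<times> ?L) (tensor_id (mmul ?K (A r) (mmul ?I (?B q) V))) \<psi>)))\<^sup>2"
    have "1 - real (t * d) * ?\<theta> = (\<Sum>\<alpha>\<in>erasure_sets N d. p \<alpha> * (1 - real (t * d) * ?\<theta>))"
      using p by (simp only: sum_distrib_right[symmetric] erasure_distribution_def mult_1)
    also have "\<dots> \<le> (\<Sum>\<alpha>\<in>erasure_sets N d. p \<alpha> * (\<Sum>z\<in>configs s \<alpha>. (\<Sum>j\<le>m. q j * G \<alpha> z j)\<^sup>2))"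
      unfolding G_def using p
      by (intro sum_mono mult_left_mono affinity_bound N q0 q1) (auto simp: erasure_distribution_def)
    also have "\<dots> = (\<Sum>\<alpha>\<in>erasure_sets N d. \<Sum>z\<in>configs s \<alpha>. p \<alpha> * (\<Sum>j\<le>m. q j * G \<alpha> z j)\<^sup>2)"
      unfolding sum_distrib_left ..
    also have "\<dots> = (\<Sum>q\<in>?Q. ?f (Inl (fst q, occ s (fst q) (snd q))) q)"
      unfolding erasure_index_def
      by (subst sum.Sigma) (auto simp: finite_erasure_sets overlap intro!: finite_configs erasure_sets_finite sum.cong)
    \<comment> \<open>For each noise operator only the recovery operator of the matching syndrome
      was kept; the others add nonnegative terms.\<close>
    also have "\<dots> \<le> (\<Sum>q\<in>?Q. \<Sum>r\<in>syndromes <+> ?K. ?f r q)"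
    proof (rule sum_mono)
      fix q assume "q \<in> ?Q"
      then obtain \<alpha> z where q: "q = (\<alpha>, z)" "\<alpha> \<in> erasure_sets N d" "z \<in> configs s \<alpha>" by (auto simp: erasure_index_def)
      have "Inl (\<alpha>, occ s \<alpha> z) \<in> syndromes <+> ?K"
        using q occ_le[OF erasure_sets_finite[OF q(2)] q(3)] by (auto simp: syndromes_def)
      then show "?f (Inl (fst q, occ s (fst q) (snd q))) q \<le> (\<Sum>r\<in>syndromes <+> ?K. ?f r q)"
        using q(1) finite_syndromes finite_erasure_output by (intro member_le_sum) auto
    qed
    also have "\<dots> = (\<Sum>r\<in>syndromes <+> ?K. \<Sum>q\<in>?Q. ?f r q)" by (rule sum.swap)
    also have "\<dots> = Re (vinner (?L \<times> ?L) \<psi> (mapply (?L \<times> ?L) (ampliate (?R \<circ> erasure_noise s N d p \<circ> encoding ?L V) (outer \<psi>)) \<psi>))"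
      unfolding total ampliate_kraus[OF finite_lessThan psd_mats[OF outer_psd[OF \<psi>v]]] kraus_outer_form Re_complex_of_real
        sum.cartesian_product' by simp
    finally have "1 - real (t * d) * ?\<theta> \<le> \<dots>" .
    moreover have "(sqrt (real (t * d)) * (real (m * \<Delta>) / (real (t * N) / 2)))\<^sup>2 = real (t * d) * ?\<theta>"
      by (simp only: power_mult_distrib real_sqrt_pow2 of_nat_0_le_iff)
    ultimately show "1 - Re (vinner (?L \<times> ?L) \<psi> (mapply (?L \<times> ?L) (ampliate (?R \<circ> erasure_noise s N d p \<circ> encoding ?L V) (outer \<psi>)) \<psi>))
        \<le> (sqrt (real (t * d)) * (real (m * \<Delta>) / (real (t * N) / 2)))\<^sup>2"
      by linarith
  qed simp
qed

end

section \<open>The asymptotic bounds\<close>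

text \<open>The shift by J = s N turns magnetizations into occupations out of t N = 2 J. A margin of
  J / 2 is a quarter of t N, so \<open>small\<close> provides the quarter margins of the code with
  room for all erased units.\<close>

lemma (in spin) finite_size_bounds:
  fixes N m \<Delta> d :: nat and Mmin Mmax :: real
  assumes N: "N > 0" and s: "s > 0" and ket: "max_spin_basis s N ket"
    and Mmin: "Mmin \<in> mags (s * real N)" and Mmax: "Mmax = Mmin + real m * real \<Delta>"
    and \<Delta>: "2 * s * real d + 1 \<le> real \<Delta>"
    and small: "\<bar>Mmin\<bar> + 2 * s * real d \<le> s * real N / 2" "\<bar>Mmax\<bar> + 2 * s * real d \<le> s * real N / 2"
  shows "real (cfun.dim (code_space ket Mmin Mmax \<Delta>)) = 2 powr logical_qubits Mmin Mmax \<Delta>"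
    and "\<lbrakk>erasure_distribution N d p; real n = 2 powr logical_qubits Mmin Mmax \<Delta>;
      isometry_onto {..<n} (configs s {..<N}) (code_space ket Mmin Mmax \<Delta>) V\<rbrakk>
      \<Longrightarrow> inaccuracy {..<n} (erasure_output s N d) V (erasure_noise s N d p)
        \<le> sqrt (2 * s * real d) * ((Mmax - Mmin) / (s * real N))"
proof -
  obtain K0 where K0: "K0 \<le> t * N" "Mmin = real K0 - s * real N" using Mmin mags_iff by blast
  obtain g where g: "cmod g = 1" "\<And>K. K \<le> t * N \<Longrightarrow> ket (real K - s * real N) = (\<lambda>x. g * dicke s t {..<N} K x)"
    using max_spin_basis_dicke[OF ket] by blast
  have td: "real (t * d) = 2 * s * real d" "real (t * N) = 2 * (s * real N)" using t by simp_all
  have \<Delta>0: "real \<Delta> > 0" using \<Delta> s by (smt (verit) mult_nonneg_nonneg of_nat_0_le_iff)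
  have "real (t * d) < real \<Delta>" using \<Delta> td by linarith
  then have spacing: "t * d < \<Delta>" by (simp only: of_nat_less_iff)
  have "real (t * N + 4 * (t * d)) \<le> real (4 * K0)"
    using small(1) K0(2) td abs_ge_minus_self[of Mmin] unfolding of_nat_add of_nat_mult[of 4] of_nat_numeral by linarith
  then have low: "t * N + 4 * (t * d) \<le> 4 * K0" by (simp only: of_nat_le_iff)
  have KM: "real (K0 + m * \<Delta>) = Mmax + s * real N" using Mmax K0 by simp
  have "real (4 * (K0 + m * \<Delta>) + 4 * (t * d)) \<le> real (3 * (t * N))"
  proof -
    have "4 * (M + S) + 4 * D \<le> 3 * (2 * S)" if "\<bar>M\<bar> + D \<le> S / 2" for M S D :: real
      using that by (simp add: abs_le_iff)
    from this[OF small(2)] show ?thesis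
      unfolding of_nat_add[of "4 * _"] of_nat_mult[of 4] of_nat_mult[of 3] of_nat_numeral KM td .
  qed
  then have high: "4 * (K0 + m * \<Delta>) + 4 * (t * d) \<le> 3 * (t * N)" by (simp only: of_nat_le_iff)
  have top: "K0 + i * \<Delta> \<le> t * N" if "i \<le> m" for i
  proof -
    have "4 * (K0 + m * \<Delta>) \<le> 3 * (t * N)" using high by (rule add_leD1)
    also have "\<dots> \<le> 4 * (t * N)" by simp
    finally have "K0 + m * \<Delta> \<le> t * N" by simp
    moreover have "K0 + i * \<Delta> \<le> K0 + m * \<Delta>" using that by simp
    ultimately show ?thesis by (rule le_trans[rotated])
  qed
  define kt where "kt i = ket (Mmin + real i * real \<Delta>)" for i :: nat
  have M: "Mmin + real i * real \<Delta> = real (K0 + i * \<Delta>) - s * real N" for i using K0 by simp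
  interpret dicke_code s t N d K0 \<Delta> m g kt
    using spacing low high g(1) by unfold_locales (simp_all only: kt_def M g(2)[OF top])
  have "Mmin + real i * real \<Delta> \<le> Mmax \<longleftrightarrow> i \<le> m" for i
    using \<Delta>0 by (simp add: Mmax)
  then have code: "code_space ket Mmin Mmax \<Delta> = cfun.span (kt ` {..m})"
    unfolding code_space_def kt_def by (intro arg_cong[where f = cfun.span]) auto
  have k: "2 powr logical_qubits Mmin Mmax \<Delta> = real (Suc m)"
    using \<Delta>0 unfolding logical_qubits_def Mmax by (simp add: powr_log_cancel add_pos_nonneg)
  show "real (cfun.dim (code_space ket Mmin Mmax \<Delta>)) = 2 powr logical_qubits Mmin Mmax \<Delta>"
    unfolding code dim_code k ..
  assume p: "erasure_distribution N d p" and n: "real n = 2 powr logical_qubits Mmin Mmax \<Delta>"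
    and V: "isometry_onto {..<n} (configs s {..<N}) (code_space ket Mmin Mmax \<Delta>) V"
  have n: "n = Suc m" using n unfolding k by (simp only: of_nat_eq_iff)
  have "t > 0" using t s by (cases t) auto
  then have "inaccuracy {..<n} (erasure_output s N d) V (erasure_noise s N d p) \<le>
      sqrt (real (t * d)) * (real (m * \<Delta>) / (real (t * N) / 2))"
    using V N unfolding n code by (intro code_inaccuracy[OF p]) auto
  also have "real (m * \<Delta>) / (real (t * N) / 2) = (Mmax - Mmin) / (s * real N)"
    unfolding td(2) by (simp add: Mmax)
  finally show "inaccuracy {..<n} (erasure_output s N d) V (erasure_noise s N d p)
        \<le> sqrt (2 * s * real d) * ((Mmax - Mmin) / (s * real N))"
    by (simp only: td)
qed

text \<open>The 1 inside the logarithm is absorbed because \<open>x powr (b - c)\<close> is at least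
  1.\<close>

lemma logical_qubits_le:
  fixes b c \<kappa> x :: real
  assumes x: "x \<ge> 1" and "c \<le> b" and \<kappa>: "\<kappa> \<ge> 0" and \<Delta>: "real \<Delta> > 0" and "Mmin < Mmax"
    and le: "(Mmax - Mmin) / real \<Delta> \<le> \<kappa> * x powr (b - c)"
  shows "logical_qubits Mmin Mmax \<Delta> \<le> log 2 (\<kappa> + 1) + (b - c) * log 2 x"
proof -
  have pos: "(Mmax - Mmin) / real \<Delta> > 0" using assms by simp
  have "1 \<le> x powr (b - c)" using assms by (intro ge_one_powr_ge_zero) auto
  then have "(Mmax - Mmin) / real \<Delta> + 1 \<le> (\<kappa> + 1) * x powr (b - c)"
    using le by (simp add: distrib_right)
  then have "logical_qubits Mmin Mmax \<Delta> \<le> log 2 ((\<kappa> + 1) * x powr (b - c))"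
    unfolding logical_qubits_def using pos by (intro log_mono) auto
  also have "\<dots> = log 2 (\<kappa> + 1) + (b - c) * log 2 x"
    using x \<kappa> by (simp add: log_mult_pos log_powr)
  finally show ?thesis .
qed

lemma eventually_powr_sum_le:
  fixes A B C b c :: real
  assumes "b < 1" "c < 1" "C > 0"
  shows "\<forall>\<^sub>F N in sequentially. A * real N powr b + B * real N powr c \<le> C * real N"
proof -
  have l: "(\<lambda>N. real N powr (e - 1)) \<longlonglongrightarrow> 0" if "e < 1" for e :: real
    using that by (intro tendsto_neg_powr filterlim_real_sequentially) auto
  have "(\<lambda>N. A * real N powr (b - 1) + B * real N powr (c - 1)) \<longlonglongrightarrow> A * 0 + B * 0"
    using assms by (intro tendsto_intros l)
  then have "\<forall>\<^sub>F N in sequentially. A * real N powr (b - 1) + B * real N powr (c - 1) < C"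
    using assms by (intro order_tendstoD) auto
  then show ?thesis
    using eventually_gt_at_top[of 0]
  proof eventually_elim
    case (elim N)
    then have "(A * real N powr (b - 1) + B * real N powr (c - 1)) * real N \<le> C * real N"
      by (intro mult_right_mono) auto
    moreover have "real N powr (e - 1) * real N = real N powr e" for e
      using elim by (simp add: powr_diff)
    ultimately show ?case by (simp add: distrib_right mult.assoc)
  qed
qed

theorem theorem2:
  fixes s b c :: real
    and w\<^sub>1 w\<^sub>2 r e\<^sub>1 e\<^sub>2 :: real
  assumes "s > 0" and "2 * s \<in> \<nat>"
    and "0 \<le> c" and "c \<le> b" and "b < 1"
    and "w\<^sub>1 > 0" and "e\<^sub>1 > 0"
  shows "\<exists>C\<^sub>k C\<^sub>\<epsilon> :: real.
    \<forall>(Mmin :: nat \<Rightarrow> real) (Mmax :: nat \<Rightarrow> real) (\<Delta> :: nat \<Rightarrow> nat) (d :: nat \<Rightarrow> nat).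
      (\<forall>\<^sub>F N in sequentially.
         Mmin N \<in> mags (s * real N) \<and> Mmax N \<in> mags (s * real N) \<and> Mmin N < Mmax N \<and>
         (\<exists>m::nat. Mmax N = Mmin N + real m * real (\<Delta> N)) \<and>
         w\<^sub>1 * real N powr b \<le> Mmax N - Mmin N \<and> Mmax N - Mmin N \<le> w\<^sub>2 * real N powr b \<and>
         \<bar>Mmin N\<bar> \<le> r * real N powr b \<and> \<bar>Mmax N\<bar> \<le> r * real N powr b \<and>
         e\<^sub>1 * real N powr c \<le> real (d N) \<and> real (d N) \<le> e\<^sub>2 * real N powr c \<and>
         real (\<Delta> N) \<ge> 2 * s * real (d N) + 1) \<longrightarrow>
      (\<forall>\<^sub>F N in sequentially. \<forall>ket. max_spin_basis s N ket \<longrightarrow>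
         (let \<CC> = code_space ket (Mmin N) (Mmax N) (\<Delta> N);
              k = logical_qubits (Mmin N) (Mmax N) (\<Delta> N)
          in real (cfun.dim \<CC>) = 2 powr k \<and>
             k \<le> C\<^sub>k * (if c < b then (b - c) * log 2 (real N) else 1) \<and>
             (\<forall>p (n::nat) V.
                erasure_distribution N (d N) p \<and> real n = 2 powr k \<and>
                isometry_onto {..<n} (configs s {..<N}) \<CC> V \<longrightarrow>
                inaccuracy {..<n} (erasure_output s N (d N)) V (erasure_noise s N (d N) p)
                  \<le> C\<^sub>\<epsilon> * real N powr (- (1 - b - c / 2)))))"
proof -
  obtain t where t: "2 * s = real t" using assms(2) by (auto elim: Nats_cases)
  interpret spin s t using t by unfold_locales
  \<comment> \<open>Since \<Delta> exceeds 2 s d and d is at least \<open>e\<^sub>1\<close> N^c,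
    this bounds (Mmax - Mmin) / \<Delta> up to the factor N^(b - c). The absolute value covers any
    sign of \<open>w\<^sub>2\<close>.\<close>
  define \<kappa> where "\<kappa> = \<bar>w\<^sub>2\<bar> / (2 * s * e\<^sub>1)"
  have \<kappa>: "\<kappa> \<ge> 0" unfolding \<kappa>_def using assms by simp
  \<comment> \<open>For c < b the constant \<open>log 2 (\<kappa> + 1)\<close> is eventually at most
    (b - c) log N to base 2, whence the factor 2; for c = b it is the bound itself.\<close>
  define C\<^sub>k where "C\<^sub>k = max 2 (log 2 (\<kappa> + 1))"
  define C\<^sub>\<epsilon> where "C\<^sub>\<epsilon> = sqrt (2 * s * \<bar>e\<^sub>2\<bar>) * (\<bar>w\<^sub>2\<bar> / s)"
  \<comment> \<open>These thresholds on N depend on the fixed constants only; where they and the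
    scaling hypotheses hold, the estimates hold for every basis, distribution and encoding at
    once.\<close>
  have ev: "\<forall>\<^sub>F N in sequentially. real N \<ge> 1 \<and> log 2 (\<kappa> + 1) \<le> (if c < b then (b - c) * log 2 (real N) else log 2 (\<kappa> + 1)) \<and>
      r * real N powr b + (2 * s * e\<^sub>2) * real N powr c \<le> (s / 2) * real N"
  proof (intro eventually_conj)
    have ge: "\<forall>\<^sub>F N in sequentially. real N \<ge> X" for X
      using filterlim_real_sequentially unfolding filterlim_at_top by blast
    show "\<forall>\<^sub>F N in sequentially. real N \<ge> 1" by (rule ge)
    show "\<forall>\<^sub>F N in sequentially. r * real N powr b + (2 * s * e\<^sub>2) * real N powr c \<le> (s / 2) * real N"
      using assms by (intro eventually_powr_sum_le) auto
    show "\<forall>\<^sub>F N in sequentially. log 2 (\<kappa> + 1) \<le> (if c < b then (b - c) * log 2 (real N) else log 2 (\<kappa> + 1))"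
      using ge[of "2 powr (log 2 (\<kappa> + 1) / (b - c))"]
    proof eventually_elim
      case (elim N)
      show ?case
      proof (cases "c < b")
        case True
        have "0 < real N" using elim by (smt (verit) powr_gt_zero)
        then have "log 2 (\<kappa> + 1) / (b - c) \<le> log 2 (real N)" using elim by (simp add: le_log_iff)
        then show ?thesis using True by (simp add: divide_le_eq mult.commute)
      qed simp
    qed
  qed
  show ?thesis
  proof (rule exI[of _ C\<^sub>k], rule exI[of _ C\<^sub>\<epsilon>], intro allI impI)
    fix Mmin Mmax :: "nat \<Rightarrow> real" and \<Delta> d :: "nat \<Rightarrow> nat"
    assume H: "\<forall>\<^sub>F N in sequentially.
         Mmin N \<in> mags (s * real N) \<and> Mmax N \<in> mags (s * real N) \<and> Mmin N < Mmax N \<and>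
         (\<exists>m::nat. Mmax N = Mmin N + real m * real (\<Delta> N)) \<and>
         w\<^sub>1 * real N powr b \<le> Mmax N - Mmin N \<and> Mmax N - Mmin N \<le> w\<^sub>2 * real N powr b \<and>
         \<bar>Mmin N\<bar> \<le> r * real N powr b \<and> \<bar>Mmax N\<bar> \<le> r * real N powr b \<and>
         e\<^sub>1 * real N powr c \<le> real (d N) \<and> real (d N) \<le> e\<^sub>2 * real N powr c \<and>
         real (\<Delta> N) \<ge> 2 * s * real (d N) + 1"
    from H ev show "\<forall>\<^sub>F N in sequentially. \<forall>ket. max_spin_basis s N ket \<longrightarrow>
         (let \<CC> = code_space ket (Mmin N) (Mmax N) (\<Delta> N);
              k = logical_qubits (Mmin N) (Mmax N) (\<Delta> N)
          in real (cfun.dim \<CC>) = 2 powr k \<and>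
             k \<le> C\<^sub>k * (if c < b then (b - c) * log 2 (real N) else 1) \<and>
             (\<forall>p (n::nat) V.
                erasure_distribution N (d N) p \<and> real n = 2 powr k \<and>
                isometry_onto {..<n} (configs s {..<N}) \<CC> V \<longrightarrow>
                inaccuracy {..<n} (erasure_output s N (d N)) V (erasure_noise s N (d N) p)
                  \<le> C\<^sub>\<epsilon> * real N powr (- (1 - b - c / 2))))"
    proof eventually_elim
      case (elim N)
      then obtain m where m: "Mmax N = Mmin N + real m * real (\<Delta> N)" by blast
      have Mmin: "Mmin N \<in> mags (s * real N)" and lt: "Mmin N < Mmax N"
        and width: "Mmax N - Mmin N \<le> w\<^sub>2 * real N powr b"
        and size: "\<bar>Mmin N\<bar> \<le> r * real N powr b" "\<bar>Mmax N\<bar> \<le> r * real N powr b"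
        and d: "e\<^sub>1 * real N powr c \<le> real (d N)" "real (d N) \<le> e\<^sub>2 * real N powr c"
        and \<Delta>: "2 * s * real (d N) + 1 \<le> real (\<Delta> N)"
        and N: "real N \<ge> 1" and lg: "log 2 (\<kappa> + 1) \<le> (if c < b then (b - c) * log 2 (real N) else log 2 (\<kappa> + 1))"
        and small: "r * real N powr b + (2 * s * e\<^sub>2) * real N powr c \<le> (s / 2) * real N"
        using elim by blast+
      have N0: "N > 0" using N by (cases N) auto
      have pc: "real N powr c > 0" using N0 by simp
      have sd: "2 * s * real (d N) \<le> (2 * s * e\<^sub>2) * real N powr c"
        using d(2) assms(1) by simp
      have sm: "\<bar>Mmin N\<bar> + 2 * s * real (d N) \<le> s * real N / 2" "\<bar>Mmax N\<bar> + 2 * s * real (d N) \<le> s * real N / 2"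
        using size sd small by simp_all
      have \<Delta>_ge: "2 * s * e\<^sub>1 * real N powr c \<le> real (\<Delta> N)"
      proof -
        have "2 * s * (e\<^sub>1 * real N powr c) \<le> 2 * s * real (d N)" using d(1) assms(1) by simp
        then show ?thesis using \<Delta> by (simp add: mult.assoc)
      qed
      have \<Delta>0: "real (\<Delta> N) > 0"
        using \<Delta>_ge pc assms by (smt (verit) mult_pos_pos)
      have "w\<^sub>2 * real N powr b \<le> \<bar>w\<^sub>2\<bar> * real N powr b" by (intro mult_right_mono) auto
      with width have w2: "Mmax N - Mmin N \<le> \<bar>w\<^sub>2\<bar> * real N powr b" by linarith
      have "(Mmax N - Mmin N) / real (\<Delta> N) \<le> \<bar>w\<^sub>2\<bar> * real N powr b / (2 * s * e\<^sub>1 * real N powr c)"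
        using w2 lt \<Delta>_ge pc assms by (intro frac_le) auto
      also have "\<dots> = \<kappa> * real N powr (b - c)"
        by (simp add: \<kappa>_def powr_diff)
      finally have k1: "logical_qubits (Mmin N) (Mmax N) (\<Delta> N) \<le> log 2 (\<kappa> + 1) + (b - c) * log 2 (real N)"
        by (rule logical_qubits_le[OF N assms(4) \<kappa> \<Delta>0 lt])
      have k: "logical_qubits (Mmin N) (Mmax N) (\<Delta> N) \<le> C\<^sub>k * (if c < b then (b - c) * log 2 (real N) else 1)"
      proof (cases "c < b")
        case True
        have "0 \<le> (b - c) * log 2 (real N)" using True N by simp
        then have "2 * ((b - c) * log 2 (real N)) \<le> C\<^sub>k * ((b - c) * log 2 (real N))"
          by (intro mult_right_mono) (auto simp: C\<^sub>k_def)
        then show ?thesis using k1 lg unfolding if_P[OF True] by linarith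
      next
        case False
        then show ?thesis using k1 assms(4) by (simp add: C\<^sub>k_def)
      qed
      have bound: "sqrt (2 * s * real (d N)) * ((Mmax N - Mmin N) / (s * real N)) \<le> C\<^sub>\<epsilon> * real N powr (- (1 - b - c / 2))"
      proof -
        have "2 * s * real (d N) \<le> 2 * s * \<bar>e\<^sub>2\<bar> * real N powr c"
          using sd pc assms(1) by (smt (verit) mult_right_mono mult_left_mono)
        then have "sqrt (2 * s * real (d N)) \<le> sqrt (2 * s * \<bar>e\<^sub>2\<bar>) * sqrt (real N powr c)"
          by (simp add: real_sqrt_mult[symmetric])
        also have "sqrt (real N powr c) = real N powr (c / 2)"
          using N0 by (simp add: powr_half_sqrt[symmetric] powr_powr)
        finally have 1: "sqrt (2 * s * real (d N)) \<le> sqrt (2 * s * \<bar>e\<^sub>2\<bar>) * real N powr (c / 2)" .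
        have 2: "(Mmax N - Mmin N) / (s * real N) \<le> \<bar>w\<^sub>2\<bar> * real N powr b / (s * real N)"
          using w2 assms(1) N0 by (intro divide_right_mono) auto
        have "sqrt (2 * s * real (d N)) * ((Mmax N - Mmin N) / (s * real N)) \<le>
          (sqrt (2 * s * \<bar>e\<^sub>2\<bar>) * real N powr (c / 2)) * (\<bar>w\<^sub>2\<bar> * real N powr b / (s * real N))"
          using 1 2 lt assms(1) by (intro mult_mono) auto
        also have "\<dots> = C\<^sub>\<epsilon> * (real N powr (c / 2) * real N powr b * real N powr (- 1))"
          using N0 by (simp add: C\<^sub>\<epsilon>_def powr_minus divide_simps)
        \<comment> \<open>The exponent collects c / 2 from the root of d, b from the width of the
          code and -1 from J.\<close>
        also have "real N powr (c / 2) * real N powr b * real N powr (- 1) = real N powr (- (1 - b - c / 2))"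
          unfolding powr_add[symmetric] by (rule arg_cong[where f = "(powr) _"]) simp
        finally show ?thesis .
      qed
      show ?case
        unfolding Let_def
      proof (intro allI impI)
        fix ket assume ket: "max_spin_basis s N ket"
        note F = finite_size_bounds[OF N0 assms(1) ket Mmin m \<Delta> sm]
        have err: "inaccuracy {..<n} (erasure_output s N (d N)) V (erasure_noise s N (d N) p) \<le> C\<^sub>\<epsilon> * real N powr (- (1 - b - c / 2))"
          if "erasure_distribution N (d N) p \<and> real n = 2 powr logical_qubits (Mmin N) (Mmax N) (\<Delta> N) \<and>
            isometry_onto {..<n} (configs s {..<N}) (code_space ket (Mmin N) (Mmax N) (\<Delta> N)) V" for p n V
          using F(2)[of p n V] that bound by linarith
        show "real (cfun.dim (code_space ket (Mmin N) (Mmax N) (\<Delta> N))) = 2 powr logical_qubits (Mmin N) (Mmax N) (\<Delta> N) \<and>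
            logical_qubits (Mmin N) (Mmax N) (\<Delta> N) \<le> C\<^sub>k * (if c < b then (b - c) * log 2 (real N) else 1) \<and>
            (\<forall>p n V. erasure_distribution N (d N) p \<and> real n = 2 powr logical_qubits (Mmin N) (Mmax N) (\<Delta> N) \<and>
              isometry_onto {..<n} (configs s {..<N}) (code_space ket (Mmin N) (Mmax N) (\<Delta> N)) V \<longrightarrow>
              inaccuracy {..<n} (erasure_output s N (d N)) V (erasure_noise s N (d N) p) \<le> C\<^sub>\<epsilon> * real N powr (- (1 - b - c / 2)))"
          by (intro conjI F(1) k) (use err in blast)
      qed
    qed
  qed
qed

end
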